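(* Let $\boldsymbol e_h:=\boldsymbol u-\boldsymbol u_h$, where $(\boldsymbol u,\boldsymbol\sigma)$ is the normalized eigenfunction of the mixed Maxwell eigenvalue problem associated with the simple eigenvalue $\lambda$ and $(\boldsymbol u_h,\boldsymbol\sigma_h)$ is its normalized Nédélec finite element approximation (see context). There exists $C>0$, independent of $h$, such that, for any $K\in\mathcal T_h$, $$h_K\|\mathrm{div}\,\boldsymbol u_h\|_{0,K}\le C\|\boldsymbol e_h\|_{0,K}$$ and, for any inner face $F\in\mathcal F_h^{\rm I}$, $$h_F^{1/2}\big\|[\![\boldsymbol u_h\cdot\boldsymbol n_F]\!]_F\big\|_{0,F}\le C\|\boldsymbol e_h\|_{0,\tilde\omega_F},$$ where $\tilde\omega_F$ denotes the union of the two tetrahedra sharing the face $F$. Consequently, $$\eta_K\le C\|\boldsymbol e_h\|_{0,\tilde\omega_K},$$ where $\tilde\omega_K$ is the union of the tetrahedra sharing a face with $K$ (including $K$ itself).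
   Context: Domain and spaces. $\Omega\subset\mathbb R^3$ is a bounded non-convex domain with polyhedral Lipschitz boundary $\partial\Omega$, simply connected, with connected boundary; $\boldsymbol n$ is the unit outward normal. $(\cdot,\cdot)$ and $\|\cdot\|_0$ are the $L^2(\Omega)$ (or $L^2(\Omega)^3$) inner product and norm; $\|\cdot\|_{0,S}$ is the $L^2$ norm on $S$; $\|\cdot\|_t$ is the norm of the fractional Sobolev space $H^t(\Omega)^3$. $\mathbf H(\mathbf{curl},\Omega)$, $\mathbf H(\mathrm{div},\Omega)$ are the usual spaces of $L^2$ fields with $L^2$ curl, resp. divergence; $\mathbf H_0(\mathbf{curl},\Omega)$ is the subspace with $\boldsymbol v\times\boldsymbol n=\boldsymbol 0$ on $\partial\Omega$ and $\mathbf H_0(\mathrm{div},\Omega)$ the subspace with $\boldsymbol v\cdot\boldsymbol n=0$ on $\partial\Omega$. $\boldsymbol{\mathcal M}:=\mathbf{curl}(\mathbf H_0(\mathbf{curl},\Omega))$ with the $L^2$ norm. Exponent. $t\in(\frac12,1)$ is fixed such that $\mathbf H_0(\mathbf{curl},\Omega)\cap\mathbf H(\mathrm{div},\Omega)$ and $\mathbf H(\mathbf{curl},\Omega)\cap\mathbf H_0(\mathrm{div},\Omega)$ are continuously embedded in $H^t(\Omega)^3$, with $\|\boldsymbol v\|_t\le C(\|\mathbf{curl}\,\boldsymbol v\|_0+\|\mathrm{div}\,\boldsymbol v\|_0)$ for $\boldsymbol v$ in either space (such $t$ exists). Discretization. $\{\mathcal T_h\}$ is a regular (shape-regular, conforming)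 family of partitions of $\overline\Omega$ into tetrahedra $K$; $h_S$ is the diameter of $S$, $h=\max_K h_K$. Fix an integer $k\ge0$. $\mathbb P_k(K)$: polynomials of degree at most $k$; $\tilde{\mathbb P}_k(K)$: homogeneous polynomials of degree $k$. $\boldsymbol{\mathcal N}_h^0(\Omega):=\{\boldsymbol v_h\in\mathbf H_0(\mathbf{curl},\Omega): \boldsymbol v_h|_K\in[\mathbb P_k(K)]^3\oplus\boldsymbol x\times[\tilde{\mathbb P}_k(K)]^3\ \forall K\in\mathcal T_h\}$ and $\boldsymbol{\mathcal M}_h:=\mathbf{curl}(\boldsymbol{\mathcal N}_h^0(\Omega))$. Eigenvalue problems. Continuous: find $(\lambda,\boldsymbol u,\boldsymbol\sigma)\in\mathbb R\times\mathbf H_0(\mathbf{curl},\Omega)\times\boldsymbol{\mathcal M}$, $(\boldsymbol u,\boldsymbol\sigma)\ne\boldsymbol0$, with $(\boldsymbol u,\boldsymbol v)-(\mathbf{curl}\,\boldsymbol v,\boldsymbol\sigma)=0$ for all $\boldsymbol v\in\mathbf H_0(\mathbf{curl},\Omega)$ and $-(\mathbf{curl}\,\boldsymbol u,\boldsymbol\tau)=-\lambda(\boldsymbol\sigma,\boldsymbol\tau)$ for all $\boldsymbol\tau\in\boldsymbol{\mathcal M}$. Discrete: find $(\lambda_h,\boldsymbol u_h,\boldsymbol\sigma_h)\in\mathbb R\times\boldsymbol{\mathcal N}_h^0(\Omega)\times\boldsymbol{\mathcal M}_h$, $(\boldsymbol u_h,\boldsymbol\sigma_h)\neq\boldsymbol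 0$, satisfying the same equations with test functions $\boldsymbol v_h\in\boldsymbol{\mathcal N}_h^0(\Omega)$, $\boldsymbol\tau_h\in\boldsymbol{\mathcal M}_h$ and $\lambda_h$ in place of $\lambda$. Chosen eigenpairs. $\lambda$ is a fixed eigenvalue of the continuous problem of multiplicity one, with eigenfunction $(\boldsymbol u,\boldsymbol\sigma)$ normalized by $\|\boldsymbol\sigma\|_0=1$. $\lambda_h$ is the simple discrete eigenvalue converging to $\lambda$ as $h\to0$, with discrete eigenfunction $(\boldsymbol u_h,\boldsymbol\sigma_h)$ normalized by $\|\boldsymbol\sigma_h\|_0=1$ and chosen so that the known a priori estimates $|\lambda-\lambda_h|\le Ch^{2t}$ and $\|\boldsymbol\sigma-\boldsymbol\sigma_h\|_0\le Ch^t$ hold. $C$ denotes generic positive constants independent of $h$. Indicators. $\mathcal F_h^{\rm I}$ is the set of tetrahedra faces lying in the interior of $\Omega$; $\boldsymbol n_F$ is a unit normal to $F$; $[\![\cdot]\!]_F$ is the jump across $F$. For $K\in\mathcal T_h$, $$\eta_K^2:=h_K^2\|\mathrm{div}\,\boldsymbol u_h\|_{0,K}^2+\sum_{F\in\mathcal F_h^{\rm I}:\,F\subset\partial K}\frac{h_F}{4}\big\|[\![\boldsymbol u_h\cdot\boldsymbol n_F]\!]_F\big\|_{0,F}^2 .$$ *)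

theory Defs
  imports "HOL-Analysis.Analysis"
begin

text \<open>Square-integrable functions are represented by genuine functions, not by equivalence classes;
  wherever identity of \<open>L\<^sup>2\<close> functions matters it is stated almost everywhere.\<close>

definition L2 :: "(real^3) set \<Rightarrow> (real^3 \<Rightarrow> 'b::real_normed_vector) set" where
  "L2 S = {f. f \<in> borel_measurable (lebesgue_on S)
            \<and> integrable (lebesgue_on S) (\<lambda>x. (norm (f x))\<^sup>2)}"

definition L2inner :: "(real^3) set \<Rightarrow> (real^3 \<Rightarrow> 'b::{real_inner,second_countable_topology})
    \<Rightarrow> (real^3 \<Rightarrow> 'b) \<Rightarrow> real" where
  "L2inner S f g = (LINT x|lebesgue_on S. f x \<bullet> g x)"

definition L2norm :: "(real^3) set \<Rightarrow> (real^3 \<Rightarrow> 'b::real_normed_vector) \<Rightarrow> real" where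
  "L2norm S f = sqrt (LINT x|lebesgue_on S. (norm (f x))\<^sup>2)"

text \<open>Fractional Sobolev space \<open>H\<^sup>s(S)\<^sup>3\<close> for \<open>0 < s < 1\<close>, with the Sobolev--Slobodeckij norm.\<close>

definition slobodeckij_kernel :: "real \<Rightarrow> (real^3 \<Rightarrow> real^3) \<Rightarrow> (real^3) \<times> (real^3) \<Rightarrow> real" where
  "slobodeckij_kernel s v = (\<lambda>(x, y). (norm (v x - v y))\<^sup>2 / norm (x - y) powr (3 + 2 * s))"

definition Hfrac :: "(real^3) set \<Rightarrow> real \<Rightarrow> (real^3 \<Rightarrow> real^3) set" where
  "Hfrac S s = {v \<in> L2 S.
     integrable (lebesgue_on S \<Otimes>\<^sub>M lebesgue_on S) (slobodeckij_kernel s v)}"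

definition Hfrac_norm :: "(real^3) set \<Rightarrow> real \<Rightarrow> (real^3 \<Rightarrow> real^3) \<Rightarrow> real" where
  "Hfrac_norm S s v = sqrt ((L2norm S v)\<^sup>2
     + (LINT z|(lebesgue_on S \<Otimes>\<^sub>M lebesgue_on S). slobodeckij_kernel s v z))"


section \<open>Classical differential operators and smooth functions\<close>

definition pderiv3 :: "3 \<Rightarrow> (real^3 \<Rightarrow> real) \<Rightarrow> real^3 \<Rightarrow> real" where
  "pderiv3 i f x = frechet_derivative f (at x) (axis i 1)"

definition grad3 :: "(real^3 \<Rightarrow> real) \<Rightarrow> real^3 \<Rightarrow> real^3" where
  "grad3 f x = (\<chi> i. pderiv3 i f x)"

definition div3 :: "(real^3 \<Rightarrow> real^3) \<Rightarrow> real^3 \<Rightarrow> real" where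
  "div3 v x = (\<Sum>i\<in>UNIV. pderiv3 i (\<lambda>y. v y $ i) x)"

definition curl3 :: "(real^3 \<Rightarrow> real^3) \<Rightarrow> real^3 \<Rightarrow> real^3" where
  "curl3 v x = vector
     [pderiv3 2 (\<lambda>y. v y $ 3) x - pderiv3 3 (\<lambda>y. v y $ 2) x,
      pderiv3 3 (\<lambda>y. v y $ 1) x - pderiv3 1 (\<lambda>y. v y $ 3) x,
      pderiv3 1 (\<lambda>y. v y $ 2) x - pderiv3 2 (\<lambda>y. v y $ 1) x]"

primrec cont_diff3 :: "nat \<Rightarrow> (real^3 \<Rightarrow> real) \<Rightarrow> bool" where
  "cont_diff3 0 f = continuous_on UNIV f"
| "cont_diff3 (Suc n) f = (f differentiable_on UNIV \<and> (\<forall>i. cont_diff3 n (pderiv3 i f)))"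

definition smooth3 :: "(real^3 \<Rightarrow> real) \<Rightarrow> bool" where
  "smooth3 f \<longleftrightarrow> (\<forall>n. cont_diff3 n f)"

definition smooth_field3 :: "(real^3 \<Rightarrow> real^3) \<Rightarrow> bool" where
  "smooth_field3 v \<longleftrightarrow> (\<forall>i. smooth3 (\<lambda>x. v x $ i))"

definition supported_in :: "(real^3) set \<Rightarrow> (real^3 \<Rightarrow> 'b::zero) \<Rightarrow> bool" where
  "supported_in S f \<longleftrightarrow> compact (closure {x. f x \<noteq> 0}) \<and> closure {x. f x \<noteq> 0} \<subseteq> S"


section \<open>The spaces H(curl), H(div) and their subspaces with vanishing traces\<close>

text \<open>\<open>w\<close> is (a representative of) the distributional curl, resp. divergence, of \<open>v\<close>.
  Membership of \<open>v\<close> in the \<open>L\<^sup>2\<close> space of the domain is part of the predicates, so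
  \<open>v \<in> H(curl)\<close> iff \<open>v\<close> has some weak curl, and likewise for \<open>H(div)\<close>.\<close>

definition has_weak_curl :: "(real^3) set \<Rightarrow> (real^3 \<Rightarrow> real^3) \<Rightarrow> (real^3 \<Rightarrow> real^3) \<Rightarrow> bool" where
  "has_weak_curl S v w \<longleftrightarrow> v \<in> L2 S \<and> w \<in> L2 S \<and>
     (\<forall>\<phi>. smooth_field3 \<phi> \<longrightarrow> supported_in S \<phi> \<longrightarrow> L2inner S w \<phi> = L2inner S v (curl3 \<phi>))"

definition has_weak_div :: "(real^3) set \<Rightarrow> (real^3 \<Rightarrow> real^3) \<Rightarrow> (real^3 \<Rightarrow> real) \<Rightarrow> bool" where
  "has_weak_div S v d \<longleftrightarrow> v \<in> L2 S \<and> d \<in> L2 S \<and>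
     (\<forall>\<phi>. smooth3 \<phi> \<longrightarrow> supported_in S \<phi> \<longrightarrow> L2inner S d \<phi> = - L2inner S v (grad3 \<phi>))"

definition Hcurl :: "(real^3) set \<Rightarrow> (real^3 \<Rightarrow> real^3) set" where
  "Hcurl S = {v. \<exists>w. has_weak_curl S v w}"

definition Hdiv :: "(real^3) set \<Rightarrow> (real^3 \<Rightarrow> real^3) set" where
  "Hdiv S = {v. \<exists>d. has_weak_div S v d}"

text \<open>The traces \<open>v \<times> n\<close> and \<open>v \<cdot> n\<close> of such fields are the functionals
  \<open>\<phi> \<mapsto> (v, curl \<phi>) - (curl v, \<phi>)\<close> (up to sign) and \<open>\<phi> \<mapsto> (v, grad \<phi>) + (div v, \<phi>)\<close>
  given by Green's formulas, where \<open>\<phi>\<close> is smooth up to the boundary. The boundary conditions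
  state that these functionals vanish.\<close>

definition H0curl :: "(real^3) set \<Rightarrow> (real^3 \<Rightarrow> real^3) set" where
  "H0curl S = {v. \<exists>w. has_weak_curl S v w \<and>
     (\<forall>\<phi>. smooth_field3 \<phi> \<longrightarrow> L2inner S v (curl3 \<phi>) - L2inner S w \<phi> = 0)}"

definition H0div :: "(real^3) set \<Rightarrow> (real^3 \<Rightarrow> real^3) set" where
  "H0div S = {v. \<exists>d. has_weak_div S v d \<and>
     (\<forall>\<phi>. smooth3 \<phi> \<longrightarrow> L2inner S v (grad3 \<phi>) + L2inner S d \<phi> = 0)}"

text \<open>The image of a space \<open>V\<close> of fields under the (weak) curl.\<close>

definition curl_image :: "(real^3) set \<Rightarrow> (real^3 \<Rightarrow> real^3) set \<Rightarrow> (real^3 \<Rightarrow> real^3) set" where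
  "curl_image S V = {w. \<exists>v\<in>V. has_weak_curl S v w}"


section \<open>The domain and the regularity exponent\<close>

definition lipschitz_boundary :: "(real^3) set \<Rightarrow> bool" where
  "lipschitz_boundary S \<longleftrightarrow>
     (\<forall>x\<in>frontier S. \<exists>r>0. \<exists>e g L. norm e = 1 \<and> L-lipschitz_on UNIV (g :: real^3 \<Rightarrow> real) \<and>
        (\<forall>y\<in>ball x r. y \<in> S \<longleftrightarrow> y \<bullet> e < g (y - (y \<bullet> e) *\<^sub>R e)))"

definition polyhedral_boundary :: "(real^3) set \<Rightarrow> bool" where
  "polyhedral_boundary S \<longleftrightarrow>
     (\<exists>P. finite P \<and> (\<forall>F\<in>P. polytope F \<and> aff_dim F = 2) \<and> frontier S = \<Union>P)"

definition regularity_exponent :: "(real^3) set \<Rightarrow> real \<Rightarrow> bool" where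
  "regularity_exponent S t \<longleftrightarrow>
     (\<exists>C>0. \<forall>v \<in> (H0curl S \<inter> Hdiv S) \<union> (Hcurl S \<inter> H0div S). \<forall>w d.
        has_weak_curl S v w \<longrightarrow> has_weak_div S v d \<longrightarrow>
        v \<in> Hfrac S t \<and> Hfrac_norm S t v \<le> C * (L2norm S w + L2norm S d))"


section \<open>Meshes\<close>

text \<open>Elements are closed tetrahedra; the library's notion of triangulation says that
  two of them intersect in a (possibly empty) common face.\<close>

definition tetrahedral_mesh :: "(real^3) set \<Rightarrow> (real^3) set set \<Rightarrow> bool" where
  "tetrahedral_mesh \<Omega> \<T> \<longleftrightarrow> triangulation \<T> \<and> (\<forall>K\<in>\<T>. 3 simplex K) \<and> \<Union>\<T> = closure \<Omega>"

definition meshsize :: "(real^3) set set \<Rightarrow> real" where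
  "meshsize \<T> = Max (diameter ` \<T>)"

definition inball_diameter :: "(real^3) set \<Rightarrow> real" where
  "inball_diameter K = Sup {2 * r | x r. 0 \<le> r \<and> cball x r \<subseteq> K}"

definition shape_regular :: "('i \<Rightarrow> (real^3) set set) \<Rightarrow> bool" where
  "shape_regular T \<longleftrightarrow> (\<exists>\<kappa>>0. \<forall>i. \<forall>K\<in>T i. diameter K \<le> \<kappa> * inball_diameter K)"

text \<open>Only the relative interior of an inner face lies in the open set \<open>\<Omega>\<close> in general: its edges
  and vertices may belong to the boundary.\<close>

definition inner_faces :: "(real^3) set \<Rightarrow> (real^3) set set \<Rightarrow> (real^3) set set" where
  "inner_faces \<Omega> \<T> = {F. (\<exists>K\<in>\<T>. F facet_of K) \<and> rel_interior F \<subseteq> \<Omega>}"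

definition face_patch :: "(real^3) set set \<Rightarrow> (real^3) set \<Rightarrow> (real^3) set" where
  "face_patch \<T> F = \<Union>{K\<in>\<T>. F facet_of K}"

definition element_patch :: "(real^3) set set \<Rightarrow> (real^3) set \<Rightarrow> (real^3) set" where
  "element_patch \<T> K = \<Union>{K'\<in>\<T>. \<exists>F. F facet_of K \<and> F facet_of K'}"


section \<open>Nedelec elements\<close>

definition polys_with_exponents :: "(3 \<Rightarrow> nat) set \<Rightarrow> (real^3 \<Rightarrow> real) set" where
  "polys_with_exponents A = {p. \<exists>c. p = (\<lambda>x. \<Sum>\<alpha>\<in>A. c \<alpha> * (\<Prod>i\<in>UNIV. (x $ i) ^ \<alpha> i))}"

definition polys_upto :: "nat \<Rightarrow> (real^3 \<Rightarrow> real) set" where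
  "polys_upto k = polys_with_exponents {\<alpha>. sum \<alpha> UNIV \<le> k}"

definition polys_homogeneous :: "nat \<Rightarrow> (real^3 \<Rightarrow> real) set" where
  "polys_homogeneous k = polys_with_exponents {\<alpha>. sum \<alpha> UNIV = k}"

definition nedelec_local :: "nat \<Rightarrow> (real^3 \<Rightarrow> real^3) set" where
  "nedelec_local k = {v. \<exists>p q.
      (\<forall>i. (\<lambda>x. p x $ i) \<in> polys_upto k) \<and>
      (\<forall>i. (\<lambda>x. q x $ i) \<in> polys_homogeneous k) \<and>
      v = (\<lambda>x. p x + cross3 x (q x))}"

text \<open>Finite element functions are represented by fields that coincide with the local polynomial
  everywhere in the interior of each tetrahedron; the values on the mesh skeleton, a null set,
  are arbitrary.\<close>

definition nedelec_space :: "(real^3) set \<Rightarrow> (real^3) set set \<Rightarrow> nat \<Rightarrow> (real^3 \<Rightarrow> real^3) set" where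
  "nedelec_space \<Omega> \<T> k =
     {v \<in> H0curl \<Omega>. \<forall>K\<in>\<T>. \<exists>p\<in>nedelec_local k. \<forall>x\<in>interior K. v x = p x}"


section \<open>The mixed eigenvalue problems\<close>

text \<open>The continuous problem is the case \<open>V = H0curl \<Omega>\<close>, the discrete one the case
  \<open>V = nedelec_space \<Omega> \<T> k\<close>.\<close>

definition mixed_eigenpair :: "(real^3) set \<Rightarrow> (real^3 \<Rightarrow> real^3) set \<Rightarrow> real
    \<Rightarrow> (real^3 \<Rightarrow> real^3) \<Rightarrow> (real^3 \<Rightarrow> real^3) \<Rightarrow> bool" where
  "mixed_eigenpair \<Omega> V lam u \<sigma> \<longleftrightarrow>
     u \<in> V \<and> \<sigma> \<in> curl_image \<Omega> V \<and>
     \<not> (AE x in lebesgue_on \<Omega>. u x = 0 \<and> \<sigma> x = 0) \<and>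
     (\<forall>v\<in>V. \<forall>cv. has_weak_curl \<Omega> v cv \<longrightarrow>
        L2inner \<Omega> u v - L2inner \<Omega> cv \<sigma> = 0) \<and>
     (\<forall>cu. has_weak_curl \<Omega> u cu \<longrightarrow>
        (\<forall>\<tau>\<in>curl_image \<Omega> V. - L2inner \<Omega> cu \<tau> = - lam * L2inner \<Omega> \<sigma> \<tau>))"

definition simple_eigenvalue :: "(real^3) set \<Rightarrow> (real^3 \<Rightarrow> real^3) set \<Rightarrow> real \<Rightarrow> bool" where
  "simple_eigenvalue \<Omega> V lam \<longleftrightarrow>
     (\<exists>u \<sigma>. mixed_eigenpair \<Omega> V lam u \<sigma> \<and>
        (\<forall>u' \<sigma>'. mixed_eigenpair \<Omega> V lam u' \<sigma>' \<longrightarrow>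
           (\<exists>c. AE x in lebesgue_on \<Omega>. u' x = c *\<^sub>R u x \<and> \<sigma>' x = c *\<^sub>R \<sigma> x)))"


section \<open>Surface norms, jumps and the error indicator\<close>

text \<open>Surface integral over a triangle \<open>F\<close> in space, via an affine parametrization over the
  reference triangle; the value does not depend on the enumeration of the vertices of \<open>F\<close>.\<close>

definition reference_triangle :: "(real \<times> real) set" where
  "reference_triangle = {(s, r). 0 \<le> s \<and> 0 \<le> r \<and> s + r \<le> 1}"

definition triangle_vertices :: "(real^3) set \<Rightarrow> (real^3) \<times> (real^3) \<times> (real^3)" where
  "triangle_vertices F = (SOME (a, b, c). F = convex hull {a, b, c})"

definition face_integral :: "(real^3) set \<Rightarrow> (real^3 \<Rightarrow> real) \<Rightarrow> real" where
  "face_integral F f = (case triangle_vertices F of (a, b, c) \<Rightarrow>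
     norm (cross3 (b - a) (c - a)) *
     (LINT z|lebesgue_on reference_triangle.
        f (a + fst z *\<^sub>R (b - a) + snd z *\<^sub>R (c - a))))"

definition face_L2norm :: "(real^3) set \<Rightarrow> (real^3 \<Rightarrow> real) \<Rightarrow> real" where
  "face_L2norm F f = sqrt (face_integral F (\<lambda>x. (f x)\<^sup>2))"

definition face_normal :: "(real^3) set \<Rightarrow> real^3" where
  "face_normal F = (SOME n. norm n = 1 \<and> (\<forall>x\<in>F. \<forall>y\<in>F. n \<bullet> (x - y) = 0))"

text \<open>Difference of the two one-sided traces of \<open>f\<close> at a point of \<open>F\<close>.\<close>

definition jump :: "(real^3) set \<Rightarrow> (real^3 \<Rightarrow> real) \<Rightarrow> real^3 \<Rightarrow> real" where
  "jump F f x = Lim (at_right (0::real)) (\<lambda>s. f (x + s *\<^sub>R face_normal F))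
              - Lim (at_right (0::real)) (\<lambda>s. f (x - s *\<^sub>R face_normal F))"

definition normal_jump_norm :: "(real^3) set \<Rightarrow> (real^3 \<Rightarrow> real^3) \<Rightarrow> real" where
  "normal_jump_norm F v = face_L2norm F (jump F (\<lambda>x. v x \<bullet> face_normal F))"

text \<open>On an element, finite element functions are polynomials up to the boundary (a null set), so
  their elementwise divergence is the classical one.\<close>

definition error_indicator :: "(real^3) set \<Rightarrow> (real^3) set set \<Rightarrow> (real^3 \<Rightarrow> real^3)
    \<Rightarrow> (real^3) set \<Rightarrow> real" where
  "error_indicator \<Omega> \<T> v K = sqrt ((diameter K)\<^sup>2 * (L2norm K (div3 v))\<^sup>2
     + (\<Sum>F | F \<in> inner_faces \<Omega> \<T> \<and> F \<subseteq> frontier K.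
          diameter F / 4 * (normal_jump_norm F v)\<^sup>2))"

end

theory Submission
  imports Defs "HOL-Computational_Algebra.Polynomial"
begin

text \<open>Both estimates come from testing the weak identity \<open>div u = 0\<close>, which holds because gradients of
  test functions lie in \<open>H0curl\<close> and are curl-free.
  On an element the test function is \<open>\<beta> div u_h\<close> with a smooth bump \<open>\<beta>\<close> on an inscribed ball;
  across an inner face it is \<open>\<beta> J\<close>, where \<open>\<beta>\<close> is a bump on a ball around the barycentre of the face and
  \<open>J\<close> extends the polynomial normal jump constantly in the normal direction. Integration by parts turns
  \<open>(u - u_h, grad \<phi>)\<close> into the weighted square of the quantity to be estimated (plus, for the face,
  divergence terms that the element estimate controls).

  Using balls instead of bubble functions makes affine equivalence of elements unnecessary: all constants reduce to
  the equivalence of norms for real polynomials of bounded degree on an interval, applied along lines,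
  and shape regularity only enters through the radii of inscribed balls.\<close>

section \<open>Polynomials along lines\<close>

text \<open>Every polynomial is measured by a single number, its modulus \<open>M\<close> at a point
  \<open>x1\<close> where it is largest on the ball of half the radius (within the plane of the
  face, for a jump). The bounds along lines yield three facts in terms of \<open>M\<close>: an upper
  bound of order \<open>M\<close> on a much larger ball, a gradient bound of order
  \<open>M / \<rho>\<close>, and the lower bound \<open>M / 2\<close> on a small ball around
  \<open>x1\<close>, where the bump is still bounded below. Both sides of the tested identity then
  become powers of \<open>M\<close> and \<open>\<rho>\<close> times fixed constants, and cancelling
  one factor \<open>M\<close> leaves the estimate.

  The trace of a jump polynomial on the face does not control its growth off the face; the extension
  constant along the normal repairs this, since its full gradient is as small as its tangential one.
  That a ball around the barycentre of a face fits into the two neighbours is a statement about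
  barycentric coordinates: their gradients are at most \<open>1 / (2 * r)\<close> in norm if the
  element contains a ball of radius \<open>r\<close>.\<close>

lemma poly_coeff_bound:
  fixes a b :: real
  assumes "a < b"
  shows "\<exists>C>0. \<forall>P. degree P \<le> m \<longrightarrow> (\<forall>M. (\<forall>t\<in>{a..b}. \<bar>poly P t\<bar> \<le> M) \<longrightarrow> (\<forall>i. \<bar>coeff P i\<bar> \<le> C * M))"
  using assms
proof (induction m arbitrary: a)
  case 0
  have "\<bar>coeff P i\<bar> \<le> M" if "degree P \<le> 0" "\<forall>t\<in>{a..b}. \<bar>poly P t\<bar> \<le> M" for P M i
  proof -
    obtain c where P: "P = [:c:]" using \<open>degree P \<le> 0\<close> degree_eq_zeroE by blast
    have "\<bar>c\<bar> \<le> M" using that(2) 0 unfolding P by (auto dest: bspec[of _ _ a])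
    then show ?thesis unfolding P by (cases i) auto
  qed
  then show ?case by (intro exI[of _ 1]) auto
next
  case (Suc m)
  \<comment> \<open>Splitting off the value at \<open>a\<close> leaves \<open>(X - a) * Q\<close>
    with \<open>Q\<close> of lower degree. The bound on \<open>P\<close> passes to \<open>Q\<close>
    only where \<open>t - a\<close> is bounded below, hence on the right half of the interval; this
    is why the induction runs over all left end points.\<close>
  define c where "c = (a + b) / 2"
  have c: "a < c" "c < b" using Suc.prems by (auto simp: c_def)
  obtain D where D: "D > 0" and DI: "\<And>P M i. degree P \<le> m \<Longrightarrow> (\<forall>t\<in>{c..b}. \<bar>poly P t\<bar> \<le> M) \<Longrightarrow> \<bar>coeff P i\<bar> \<le> D * M"
    using Suc.IH[OF c(2)] by metis
  \<comment> \<open>\<open>Q\<close> is at most \<open>2 / (c - a) * M\<close> on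
    \<open>{c..b}\<close>, and \<open>D\<close> turns this into a bound for its
    coefficients.\<close>
  define E where "E = D * (2 / (c - a))"
  have E: "E > 0" using D c by (simp add: E_def)
  have "\<bar>coeff P i\<bar> \<le> (1 + \<bar>a\<bar> * E + E) * M"
    if dP: "degree P \<le> Suc m" and PM: "\<forall>t\<in>{a..b}. \<bar>poly P t\<bar> \<le> M" for P M i
  proof -
    have Pa: "\<bar>poly P a\<bar> \<le> M" using PM c by auto
    then have M: "0 \<le> M" by linarith
    have "poly (P - [:poly P a:]) a = 0" by simp
    then obtain Q where Q: "P - [:poly P a:] = [:-a, 1:] * Q"
      unfolding poly_eq_0_iff_dvd by (auto elim: dvdE)
    have dQ: "degree Q \<le> m"
    proof (cases "Q = 0")
      case False
      have "degree ([:-a, 1:] * Q) = 1 + degree Q"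
        using False by (subst degree_mult_eq) auto
      moreover have "degree (P - [:poly P a:]) \<le> Suc m"
        using degree_diff_le[of P "Suc m" "[:poly P a:]"] dP by simp
      ultimately show ?thesis using Q by simp
    qed simp
    have Qb: "\<bar>poly Q t\<bar> \<le> 2 / (c - a) * M" if t: "t \<in> {c..b}" for t
    proof -
      have "poly (P - [:poly P a:]) t = (t - a) * poly Q t" by (simp add: Q algebra_simps)
      then have e: "(t - a) * poly Q t = poly P t - poly P a" by simp
      have "\<bar>poly P t\<bar> \<le> M" using PM t c by auto
      then have "\<bar>(t - a) * poly Q t\<bar> \<le> 2 * M" unfolding e using Pa by linarith
      then have "(t - a) * \<bar>poly Q t\<bar> \<le> 2 * M" using t c by (simp add: abs_mult)
      moreover have "(c - a) * \<bar>poly Q t\<bar> \<le> (t - a) * \<bar>poly Q t\<bar>"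
        using t by (intro mult_right_mono) auto
      ultimately show ?thesis using c by (simp add: field_simps)
    qed
    have cQ: "\<bar>coeff Q j\<bar> \<le> E * M" for j
      using DI[OF dQ, of "2 / (c - a) * M" j] Qb by (auto simp: E_def mult.assoc)
    have "P = [:poly P a:] + [:-a, 1:] * Q" using Q by (simp add: algebra_simps)
    then have "coeff P i = coeff ([:poly P a:] + [:-a, 1:] * Q) i" by (rule arg_cong)
    also have "\<dots> = (if i = 0 then poly P a else 0) - a * coeff Q i + (if i = 0 then 0 else coeff Q (i - 1))"
      by (cases i) (simp_all add: coeff_pCons)
    also have "\<bar>\<dots>\<bar> \<le> M + \<bar>a\<bar> * (E * M) + E * M"
    proof -
      have "\<bar>a * coeff Q i\<bar> \<le> \<bar>a\<bar> * (E * M)" using cQ[of i] by (simp add: abs_mult mult_left_mono)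
      moreover have "\<bar>if i = 0 then 0 else coeff Q (i - 1)\<bar> \<le> E * M"
        using cQ[of "i - 1"] M E by auto
      moreover have "\<bar>if i = 0 then poly P a else 0\<bar> \<le> M" using Pa M by auto
      ultimately show ?thesis by linarith
    qed
    finally show ?thesis by (simp add: algebra_simps)
  qed
  moreover have "1 + \<bar>a\<bar> * E + E > 0" using E by (simp add: add_pos_nonneg)
  ultimately show ?case by blast
qed

lemma poly_altdef_le: "degree P \<le> m \<Longrightarrow> poly P (x::real) = (\<Sum>i\<le>m. coeff P i * x ^ i)"
  unfolding poly_altdef by (rule sum.mono_neutral_left) (auto simp: coeff_eq_0)

text \<open>Together with continuity, the only property of multivariate polynomials on which the
  size estimates rest. It is stable under affine substitutions, so no reference element
  appears.\<close>

definition line_poly :: "nat \<Rightarrow> ('a::real_vector \<Rightarrow> real) \<Rightarrow> bool" where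
  "line_poly m f \<longleftrightarrow> (\<forall>x v. \<exists>P. degree P \<le> m \<and> (\<forall>t. f (x + t *\<^sub>R v) = poly P t))"

text \<open>Both bounds are read off the coefficients. Outside the unit interval monomials grow by
  at most \<open>R ^ m\<close>. In the increment the constant coefficient cancels and every other
  power of \<open>t\<close> is at most \<open>t\<close>, which gives a bound linear in
  \<open>t\<close>.\<close>

lemma line_poly_bounds:
  assumes "1 \<le> R"
  obtains C where "1 \<le> C"
    "\<And>(f :: 'a::real_vector \<Rightarrow> real) x v M s. line_poly m f \<Longrightarrow> (\<And>t. 0 \<le> t \<Longrightarrow> t \<le> 1 \<Longrightarrow> \<bar>f (x + t *\<^sub>R v)\<bar> \<le> M) \<Longrightarrow> \<bar>s\<bar> \<le> R \<Longrightarrow>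
        \<bar>f (x + s *\<^sub>R v)\<bar> \<le> C * M"
    "\<And>(f :: 'a::real_vector \<Rightarrow> real) x v M t. line_poly m f \<Longrightarrow> (\<And>t. 0 \<le> t \<Longrightarrow> t \<le> 1 \<Longrightarrow> \<bar>f (x + t *\<^sub>R v)\<bar> \<le> M) \<Longrightarrow> 0 \<le> t \<Longrightarrow> t \<le> 1 \<Longrightarrow>
        \<bar>f (x + t *\<^sub>R v) - f x\<bar> \<le> C * M * t"
proof -
  obtain D where D: "D > 0" and DI: "\<And>(P::real poly) M i. degree P \<le> m \<Longrightarrow> (\<forall>t\<in>{0..1}. \<bar>poly P t\<bar> \<le> M) \<Longrightarrow> \<bar>coeff P i\<bar> \<le> D * M"
    using poly_coeff_bound[OF zero_less_one, of m] by metis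
  define C where "C = max 1 (real (Suc m) * D * R ^ m)"
  have C1: "1 \<le> C" by (simp add: C_def)
  have Rp: "1 \<le> R ^ m" using assms by simp
  have CR: "real (Suc m) * D * R ^ m \<le> C" by (simp add: C_def)
  have CD: "real (Suc m) * D \<le> C"
  proof -
    have "real (Suc m) * D * 1 \<le> real (Suc m) * D * R ^ m"
      using D by (intro mult_left_mono[OF Rp]) simp
    then show ?thesis using CR by linarith
  qed
  show ?thesis
  proof (rule that[OF C1])
    fix f :: "'a \<Rightarrow> real" and x v and M s :: real
    assume f: "line_poly m f" and b: "\<And>t. 0 \<le> t \<Longrightarrow> t \<le> 1 \<Longrightarrow> \<bar>f (x + t *\<^sub>R v)\<bar> \<le> M" and s: "\<bar>s\<bar> \<le> R"
    obtain P where P: "degree P \<le> m" "\<And>t. f (x + t *\<^sub>R v) = poly P t" using f unfolding line_poly_def by metis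
    have M: "0 \<le> M" using b[of 0] by simp
    have c: "\<bar>coeff P i\<bar> \<le> D * M" for i using DI[OF P(1), of M i] b P(2) by auto
    have "\<bar>poly P s\<bar> = \<bar>\<Sum>i\<le>m. coeff P i * s ^ i\<bar>"
      using P(1) by (subst poly_altdef_le) auto
    also have "\<dots> \<le> (\<Sum>i\<le>m. \<bar>coeff P i * s ^ i\<bar>)" by (rule sum_abs)
    also have "\<dots> \<le> (\<Sum>i\<le>m. D * M * R ^ m)"
    proof (rule sum_mono)
      fix i assume i: "i \<in> {..m}"
      have "\<bar>s\<bar> ^ i \<le> R ^ i" using s by (intro power_mono) auto
      also have "\<dots> \<le> R ^ m" using assms i by (intro power_increasing) auto
      finally show "\<bar>coeff P i * s ^ i\<bar> \<le> D * M * R ^ m"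
        unfolding abs_mult power_abs using c[of i] D M by (intro mult_mono) auto
    qed
    also have "\<dots> = real (Suc m) * D * R ^ m * M" by simp
    also have "\<dots> \<le> C * M" using CR M by (intro mult_right_mono) auto
    finally show "\<bar>f (x + s *\<^sub>R v)\<bar> \<le> C * M" by (simp add: P(2))
  next
    fix f :: "'a \<Rightarrow> real" and x v and M t :: real
    assume f: "line_poly m f" and b: "\<And>t. 0 \<le> t \<Longrightarrow> t \<le> 1 \<Longrightarrow> \<bar>f (x + t *\<^sub>R v)\<bar> \<le> M" and t: "0 \<le> t" "t \<le> 1"
    obtain P where P: "degree P \<le> m" "\<And>t. f (x + t *\<^sub>R v) = poly P t" using f unfolding line_poly_def by metis
    have M: "0 \<le> M" using b[of 0] by simp
    have c: "\<bar>coeff P i\<bar> \<le> D * M" for i using DI[OF P(1), of M i] b P(2) by auto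
    have "f x = poly P 0" using P(2)[of 0] by simp
    have "poly P t - poly P 0 = (\<Sum>i\<le>m. coeff P i * t ^ i) - (\<Sum>i\<le>m. coeff P i * 0 ^ i)"
      using P(1) by (subst (1 2) poly_altdef_le[of P m]) auto
    also have "\<dots> = (\<Sum>i\<le>m. coeff P i * (t ^ i - 0 ^ i))" by (simp add: sum_subtractf algebra_simps)
    finally have "\<bar>poly P t - poly P 0\<bar> \<le> (\<Sum>i\<le>m. \<bar>coeff P i * (t ^ i - 0 ^ i)\<bar>)" by simp
    also have "\<dots> \<le> (\<Sum>i\<le>m. D * M * t)"
    proof (rule sum_mono)
      fix i assume i: "i \<in> {..m}"
      have "\<bar>t ^ i - 0 ^ i\<bar> \<le> t"
      proof (cases i)
        case (Suc j)
        have "t ^ j \<le> 1" using t by (simp add: power_le_one)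
        then show ?thesis using t Suc by (simp add: mult_left_le)
      qed (use t in auto)
      then show "\<bar>coeff P i * (t ^ i - 0 ^ i)\<bar> \<le> D * M * t"
        unfolding abs_mult using c[of i] D M by (intro mult_mono) auto
    qed
    also have "\<dots> = real (Suc m) * D * (M * t)" by simp
    also have "\<dots> \<le> C * (M * t)" using CD M t by (intro mult_right_mono) auto
    finally show "\<bar>f (x + t *\<^sub>R v) - f x\<bar> \<le> C * M * t" using P(2) \<open>f x = poly P 0\<close> by (simp add: mult.assoc)
  qed
qed

text \<open>The normal \<open>N = 0\<close> gives the statement on the whole space.\<close>

lemma line_poly_core:
  assumes "1 \<le> R"
  obtains C where "4 \<le> C"
    "\<And>f N x0 \<rho>. line_poly m f \<Longrightarrow> continuous_on UNIV f \<Longrightarrow> 0 < \<rho> \<Longrightarrow>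
       \<exists>x1::'a::euclidean_space. N \<bullet> (x1 - x0) = 0 \<and> dist x0 x1 \<le> \<rho> / 2 \<and>
        (\<forall>x. N \<bullet> (x - x0) = 0 \<longrightarrow> dist x0 x \<le> R * \<rho> \<longrightarrow> \<bar>f x\<bar> \<le> C * \<bar>f x1\<bar>) \<and>
        (\<forall>x v f'. N \<bullet> (x - x0) = 0 \<longrightarrow> dist x0 x \<le> \<rho> \<longrightarrow> N \<bullet> v = 0 \<longrightarrow> (f has_derivative f') (at x)
            \<longrightarrow> \<bar>f' v\<bar> \<le> C * \<bar>f x1\<bar> * norm v / \<rho>) \<and>
        (\<forall>x. N \<bullet> (x - x0) = 0 \<longrightarrow> dist x1 x \<le> \<rho> / C \<longrightarrow> \<bar>f x1\<bar> / 2 \<le> \<bar>f x\<bar>)"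
proof -
  \<comment> \<open>Lengths are counted in units of \<open>\<rho>/2\<close>, the radius on which
    \<open>x1\<close> is a maximum: \<open>2 * R\<close> units reach distance
    \<open>R * \<rho>\<close>, and \<open>4\<close> units reach \<open>2 * \<rho>\<close>, the end
    of a segment of length \<open>\<rho>\<close> that starts within distance
    \<open>\<rho>\<close>.\<close>
  have "1 \<le> max 4 (2 * R)" by simp
  from line_poly_bounds[where 'a='a and m=m, OF this] obtain B where B: "1 \<le> B"
    and B1: "\<And>f (x::'a) v M s. line_poly m f \<Longrightarrow> (\<And>t. 0 \<le> t \<Longrightarrow> t \<le> 1 \<Longrightarrow> \<bar>f (x + t *\<^sub>R v)\<bar> \<le> M) \<Longrightarrow> \<bar>s\<bar> \<le> max 4 (2 * R) \<Longrightarrow>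
        \<bar>f (x + s *\<^sub>R v)\<bar> \<le> B * M"
    and B2: "\<And>f (x::'a) v M t. line_poly m f \<Longrightarrow> (\<And>t. 0 \<le> t \<Longrightarrow> t \<le> 1 \<Longrightarrow> \<bar>f (x + t *\<^sub>R v)\<bar> \<le> M) \<Longrightarrow> 0 \<le> t \<Longrightarrow> t \<le> 1 \<Longrightarrow>
        \<bar>f (x + t *\<^sub>R v) - f x\<bar> \<le> B * M * t"
    by metis
  \<comment> \<open>One factor \<open>B\<close> carries the bound from the half ball to the larger
    ball, the other is the Lipschitz factor there; the \<open>4\<close> makes the variation over the
    distance \<open>\<rho> / C\<close> at most \<open>M / 4\<close>.\<close>
  define C where "C = 4 * B * B"
  have BB: "1 \<le> B * B" using B mult_mono[of 1 B 1 B] by simp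
  have C4: "4 \<le> C" unfolding C_def using BB by simp
  have BC: "B \<le> C" unfolding C_def using B BB mult_right_mono[OF B, of B] by linarith
  show ?thesis
  proof (rule that[OF C4])
    fix f :: "'a \<Rightarrow> real" and N x0 :: 'a and \<rho> :: real
    assume f: "line_poly m f" and cont: "continuous_on UNIV f" and \<rho>: "0 < \<rho>"
    \<comment> \<open>Half the radius leaves room for the bump: since \<open>C\<close> is at least
      \<open>4\<close>, the ball of radius \<open>\<rho> / C\<close> around \<open>x1\<close> stays
      within \<open>3 / 4 * \<rho>\<close> of the centre.\<close>
    let ?A = "cball x0 (\<rho>/2) \<inter> {x. N \<bullet> (x - x0) = 0}"
    have cl: "closed {x. N \<bullet> (x - x0) = 0}"
      by (intro closed_Collect_eq continuous_intros)
    have "compact ?A" using cl by (rule compact_Int_closed[OF compact_cball])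
    moreover have "x0 \<in> ?A" using \<rho> by simp
    moreover have "continuous_on ?A (\<lambda>x. \<bar>f x\<bar>)"
      using cont continuous_on_subset by (intro continuous_intros) blast
    ultimately obtain x1 where x1: "x1 \<in> ?A" and mx: "\<And>x. x \<in> ?A \<Longrightarrow> \<bar>f x\<bar> \<le> \<bar>f x1\<bar>"
      using continuous_attains_sup[of ?A "\<lambda>x. \<bar>f x\<bar>"] by blast
    define M where "M = \<bar>f x1\<bar>"
    have M: "0 \<le> M" by (simp add: M_def)
    have big: "\<bar>f x\<bar> \<le> B * M" if x: "N \<bullet> (x - x0) = 0" "dist x0 x \<le> max 4 (2*R) * (\<rho> / 2)" for x
    proof (cases "x = x0")
      case True
      then show ?thesis using mx[of x0] \<rho> M mult_right_mono[OF B M] unfolding M_def by simp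
    next
      case False
      define s where "s = dist x0 x / (\<rho>/2)"
      have s: "s > 0" using False \<rho> by (simp add: s_def)
      define v where "v = (1 / s) *\<^sub>R (x - x0)"
      have nv: "norm v = \<rho>/2" using False \<rho> by (simp add: v_def s_def dist_norm norm_minus_commute)
      have "\<bar>f (x0 + s *\<^sub>R v)\<bar> \<le> B * M"
      proof (rule B1[OF f])
        fix t :: real assume t: "0 \<le> t" "t \<le> 1"
        have "dist x0 (x0 + t *\<^sub>R v) \<le> \<rho>/2" using t \<rho> by (simp add: dist_norm nv mult_left_le_one_le)
        moreover have "N \<bullet> (x0 + t *\<^sub>R v - x0) = 0" using x(1) by (simp add: v_def)
        ultimately show "\<bar>f (x0 + t *\<^sub>R v)\<bar> \<le> M" unfolding M_def by (intro mx) auto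
      next
        show "\<bar>s\<bar> \<le> max 4 (2 * R)" using s x(2) \<rho> by (simp add: s_def divide_le_eq)
      qed
      then show ?thesis using s by (simp add: v_def)
    qed
    have lip: "\<bar>f (x + t *\<^sub>R v) - f x\<bar> \<le> B * (B * M) * t"
      if x: "N \<bullet> (x - x0) = 0" "dist x0 x \<le> \<rho>" and v: "N \<bullet> v = 0" "norm v \<le> \<rho>" and t: "0 \<le> t" "t \<le> 1" for x v t
    proof (rule B2[OF f _ t])
      fix t :: real assume t: "0 \<le> t" "t \<le> 1"
      have "dist x0 (x + t *\<^sub>R v) \<le> dist x0 x + norm (t *\<^sub>R v)"
        using dist_triangle[of x0 "x + t *\<^sub>R v" x] by (simp add: dist_norm)
      also have "\<dots> \<le> \<rho> + 1 * \<rho>" using x v t mult_mono[of t 1 "norm v" \<rho>] by (intro add_mono) auto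
      also have "\<dots> = 4 * (\<rho>/2)" by simp
      also have "\<dots> \<le> max 4 (2*R) * (\<rho>/2)" using \<rho> by (intro mult_right_mono) auto
      finally have d: "dist x0 (x + t *\<^sub>R v) \<le> max 4 (2*R) * (\<rho>/2)" .
      have "x + t *\<^sub>R v - x0 = (x - x0) + t *\<^sub>R v" by simp
      then have "N \<bullet> (x + t *\<^sub>R v - x0) = 0" using x v by (metis inner_add_right inner_scaleR_right mult_zero_right add_0)
      then show "\<bar>f (x + t *\<^sub>R v)\<bar> \<le> B * M" using big d by blast
    qed
    have lip': "\<bar>f (x + v) - f x\<bar> \<le> B * (B * M) * (norm v / \<rho>)"
      if x: "N \<bullet> (x - x0) = 0" "dist x0 x \<le> \<rho>" and v: "N \<bullet> v = 0" "norm v \<le> \<rho>" for x v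
    proof (cases "v = 0")
      case False
      \<comment> \<open>The step \<open>v\<close> is seen as the fraction
        \<open>norm v / \<rho>\<close> of a segment of length exactly \<open>\<rho>\<close>, so that
        the bound linear in the parameter becomes linear in \<open>norm v\<close>.\<close>
      have "\<bar>f (x + (norm v / \<rho>) *\<^sub>R ((\<rho> / norm v) *\<^sub>R v)) - f x\<bar> \<le> B * (B * M) * (norm v / \<rho>)"
        using x v \<rho> False by (intro lip) auto
      then show ?thesis using False \<rho> by simp
    qed simp
    have x1A: "N \<bullet> (x1 - x0) = 0" "dist x0 x1 \<le> \<rho>/2" using x1 by auto
    show "\<exists>x1. N \<bullet> (x1 - x0) = 0 \<and> dist x0 x1 \<le> \<rho> / 2 \<and>
        (\<forall>x. N \<bullet> (x - x0) = 0 \<longrightarrow> dist x0 x \<le> R * \<rho> \<longrightarrow> \<bar>f x\<bar> \<le> C * \<bar>f x1\<bar>) \<and>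
        (\<forall>x v f'. N \<bullet> (x - x0) = 0 \<longrightarrow> dist x0 x \<le> \<rho> \<longrightarrow> N \<bullet> v = 0 \<longrightarrow> (f has_derivative f') (at x)
            \<longrightarrow> \<bar>f' v\<bar> \<le> C * \<bar>f x1\<bar> * norm v / \<rho>) \<and>
        (\<forall>x. N \<bullet> (x - x0) = 0 \<longrightarrow> dist x1 x \<le> \<rho> / C \<longrightarrow> \<bar>f x1\<bar> / 2 \<le> \<bar>f x\<bar>)"
    proof (intro exI[of _ x1] conjI allI impI)
      fix x assume x: "N \<bullet> (x - x0) = 0" "dist x0 x \<le> R * \<rho>"
      have "R * \<rho> \<le> max 4 (2*R) * (\<rho>/2)"
        using \<rho> mult_right_mono[of "2*R" "max 4 (2*R)" "\<rho>/2"] by simp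
      then have "\<bar>f x\<bar> \<le> B * M" using big x by simp
      also have "\<dots> \<le> C * M" using BC M by (rule mult_right_mono)
      finally show "\<bar>f x\<bar> \<le> C * \<bar>f x1\<bar>" by (simp add: M_def)
    next
      fix x v f' assume x: "N \<bullet> (x - x0) = 0" "dist x0 x \<le> \<rho>" and v: "N \<bullet> v = 0"
        and f': "(f has_derivative f') (at x)"
      have lin: "linear f'" using f' has_derivative_linear by blast
      have D: "((\<lambda>t. f (x + t *\<^sub>R v)) has_derivative (\<lambda>t. f' (t *\<^sub>R v))) (at 0)"
        by (rule has_derivative_compose[of "\<lambda>t. x + t *\<^sub>R v" "\<lambda>t. t *\<^sub>R v" 0 UNIV f f'])
          (use f' in \<open>auto intro!: derivative_eq_intros\<close>)
      then have "((\<lambda>t. f (x + t *\<^sub>R v)) has_real_derivative f' v) (at 0)"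
        by (simp add: has_field_derivative_def linear_scale[OF lin] mult.commute[of _ "f' v"])
      then have lim: "((\<lambda>t. (f (x + t *\<^sub>R v) - f x) / t) \<longlongrightarrow> f' v) (at_right 0)"
        unfolding has_field_derivative_iff by (auto intro: tendsto_mono[OF at_le])
      have "eventually (\<lambda>t. \<bar>(f (x + t *\<^sub>R v) - f x) / t\<bar> \<le> B * (B * M) * (norm v / \<rho>)) (at_right 0)"
      proof -
        have "eventually (\<lambda>t. 0 < t \<and> t * norm v < \<rho>) (at_right 0)"
        proof (rule eventually_conj)
          show "\<forall>\<^sub>F t in at_right 0. t * norm v < \<rho>"
            using \<rho> by (intro order_tendstoD(2)[where y=0] tendsto_eq_intros) auto
        qed (simp add: eventually_at_right_less)
        then show ?thesis
        proof eventually_elim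
          case (elim t)
          then have "\<bar>f (x + t *\<^sub>R v) - f x\<bar> \<le> B * (B * M) * (norm (t *\<^sub>R v) / \<rho>)"
            using x v by (intro lip') auto
          then show ?case using elim by (simp add: field_simps)
        qed
      qed
      moreover have "((\<lambda>t. \<bar>(f (x + t *\<^sub>R v) - f x) / t\<bar>) \<longlongrightarrow> \<bar>f' v\<bar>) (at_right 0)"
        using lim by (rule tendsto_rabs)
      ultimately have "\<bar>f' v\<bar> \<le> B * (B * M) * (norm v / \<rho>)"
        by (intro tendsto_upperbound[of _ _ "at_right 0"]) auto
      also have "\<dots> \<le> C * M * (norm v / \<rho>)"
        using M \<rho> B by (intro mult_right_mono) (auto simp: C_def)
      finally show "\<bar>f' v\<bar> \<le> C * \<bar>f x1\<bar> * norm v / \<rho>" by (simp add: M_def)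
    next
      fix x assume x: "N \<bullet> (x - x0) = 0" "dist x1 x \<le> \<rho> / C"
      have N: "N \<bullet> (x - x1) = 0" using x(1) x1A(1) by (simp add: inner_diff_right)
      have "norm (x - x1) \<le> \<rho> / C" using x(2) by (simp add: dist_norm norm_minus_commute)
      moreover have "\<rho> / C \<le> \<rho>" using C4 \<rho> by (simp add: divide_le_eq)
      ultimately have "\<bar>f (x1 + (x - x1)) - f x1\<bar> \<le> B * (B * M) * (norm (x - x1) / \<rho>)"
        using x1A \<rho> N by (intro lip') auto
      also have "\<dots> \<le> B * (B * M) * (1 / C)"
        using \<open>norm (x - x1) \<le> \<rho> / C\<close> \<rho> M B by (intro mult_left_mono) (auto simp: field_simps)
      also have "\<dots> = M / 4" using B by (simp add: C_def)
      finally have "\<bar>f x - f x1\<bar> \<le> \<bar>f x1\<bar> / 4" by (simp add: M_def)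
      then show "\<bar>f x1\<bar> / 2 \<le> \<bar>f x\<bar>" by linarith
    qed (use x1A in auto)
  qed
qed

section \<open>Smooth test functions\<close>

text \<open>The family \<open>P(1/t) * exp (- 1/t)\<close>, extended by zero, is closed under
  differentiation, with \<open>P\<close> replaced by \<open>X^2 * (P - P')\<close>. The member
  \<open>P = 1\<close> is the usual smooth function all of whose derivatives vanish at the
  origin.\<close>

definition flat :: "real poly \<Rightarrow> real \<Rightarrow> real" where
  "flat P t = (if t > 0 then poly P (1 / t) * exp (- (1 / t)) else 0)"

lemma tendsto_poly_exp_at_top: "((\<lambda>y::real. poly P y * exp (- y)) \<longlongrightarrow> 0) at_top"
proof -
  have "((\<lambda>y::real. \<Sum>i\<le>degree P. coeff P i * (y ^ i / exp y)) \<longlongrightarrow> (\<Sum>i\<le>degree P. coeff P i * 0)) at_top"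
    by (intro tendsto_sum tendsto_mult tendsto_const tendsto_power_div_exp_0)
  then show ?thesis
    by (simp add: poly_altdef sum_distrib_right exp_minus divide_inverse mult.assoc)
qed

lemma flat_has_derivative:
  "(flat P has_real_derivative flat (monom 1 2 * (P - pderiv P)) t) (at t)"
proof -
  consider "t > 0" | "t < 0" | "t = 0" by linarith
  then show ?thesis
  proof cases
    case 1
    have "((\<lambda>t. poly P (1 / t) * exp (- (1 / t))) has_real_derivative
        poly (pderiv P) (1 / t) * (- 1 / t\<^sup>2) * exp (- (1 / t)) + poly P (1 / t) * (exp (- (1 / t)) * (1 / t\<^sup>2))) (at t)"
      using 1 by (auto intro!: derivative_eq_intros DERIV_chain2[OF poly_DERIV] simp: power2_eq_square)
    also have "poly (pderiv P) (1 / t) * (- 1 / t\<^sup>2) * exp (- (1 / t)) + poly P (1 / t) * (exp (- (1 / t)) * (1 / t\<^sup>2))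
        = flat (monom 1 2 * (P - pderiv P)) t"
      using 1 by (simp add: flat_def poly_monom algebra_simps power_divide)
    finally have "((\<lambda>t. poly P (1 / t) * exp (- (1 / t))) has_real_derivative flat (monom 1 2 * (P - pderiv P)) t) (at t)" .
    then show ?thesis
      by (rule has_field_derivative_transform_within_open[where S="{0<..}"]) (use 1 in \<open>auto simp: flat_def\<close>)
  next
    case 2
    have "((\<lambda>t. 0) has_real_derivative flat (monom 1 2 * (P - pderiv P)) t) (at t)"
      using 2 by (simp add: flat_def)
    then show ?thesis
      by (rule has_field_derivative_transform_within_open[where S="{..<0}"]) (use 2 in \<open>auto simp: flat_def\<close>)
  next
    case 3
    have l: "((\<lambda>h. flat P h / h) \<longlongrightarrow> 0) (at_left 0)"
      by (rule tendsto_eventually) (auto simp: flat_def eventually_at_filter)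
    \<comment> \<open>With \<open>y = 1 / h\<close> the difference quotient
      \<open>flat P h / h\<close> is \<open>y * poly P y * exp (- y)\<close>, again a polynomial
      against a decaying exponential.\<close>
    have "((\<lambda>y. poly ([:0, 1:] * P) y * exp (- y)) \<longlongrightarrow> 0) at_top"
      by (rule tendsto_poly_exp_at_top)
    then have "((\<lambda>h. poly ([:0, 1:] * P) (inverse h) * exp (- (inverse h))) \<longlongrightarrow> 0) (at_right 0)"
      by (rule filterlim_compose[OF _ filterlim_inverse_at_top_right])
    then have r: "((\<lambda>h. flat P h / h) \<longlongrightarrow> 0) (at_right 0)"
      by (rule Lim_transform_eventually)
        (auto simp: flat_def eventually_at_filter field_simps intro!: always_eventually)
    have "((\<lambda>h. flat P h / h) \<longlongrightarrow> 0) (at 0)"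
      using l r by (simp add: filterlim_split_at)
    then show ?thesis using 3 by (simp add: has_field_derivative_iff flat_def)
  qed
qed

text \<open>The index is an upper bound of the degree, carried along by the generation. Restriction
  to lines, differentiation and projection onto a plane are then handled by induction, without a
  normal form of polynomials.\<close>

inductive polyfun :: "nat \<Rightarrow> (real^3 \<Rightarrow> real) \<Rightarrow> bool" where
  const: "polyfun 0 (\<lambda>x. c)"
| affine: "polyfun 1 (\<lambda>x. a \<bullet> x + c)"
| add: "polyfun m f \<Longrightarrow> polyfun m g \<Longrightarrow> polyfun m (\<lambda>x. f x + g x)"
| mult: "polyfun m f \<Longrightarrow> polyfun n g \<Longrightarrow> polyfun (m + n) (\<lambda>x. f x * g x)"
| mono: "polyfun m f \<Longrightarrow> m \<le> n \<Longrightarrow> polyfun n f"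

text \<open>Unlike for smooth functions in general, closure under partial derivatives and the symmetry of mixed
  partial derivatives follow for this algebra by induction.\<close>

inductive tame :: "(real^3 \<Rightarrow> real) \<Rightarrow> bool" where
  affine: "tame (\<lambda>x. a \<bullet> x + c)"
| add: "tame f \<Longrightarrow> tame g \<Longrightarrow> tame (\<lambda>x. f x + g x)"
| mult: "tame f \<Longrightarrow> tame g \<Longrightarrow> tame (\<lambda>x. f x * g x)"
| flat: "tame q \<Longrightarrow> tame (\<lambda>x. flat P (q x))"

lemma tame_const: "tame (\<lambda>x. c)"
  using tame.affine[of 0 c] by simp

lemma polyfun_imp_tame: "polyfun m f \<Longrightarrow> tame f"
  by (induction rule: polyfun.induct) (auto intro: tame.intros tame_const)

lemma tame_differentiable: "tame f \<Longrightarrow> f differentiable (at x)"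
proof (induction rule: tame.induct)
  case (flat q P)
  have "(\<lambda>y. flat P y) differentiable (at (q x))"
    using flat_has_derivative real_differentiable_def by blast
  then show ?case using flat.IH differentiable_chain_at[of q x "flat P"] by (simp add: o_def)
qed (auto intro: differentiable_add differentiable_mult)

lemma pderiv3_unique: "(f has_derivative f') (at x) \<Longrightarrow> pderiv3 i f x = f' (axis i 1)"
  unfolding pderiv3_def by (metis frechet_derivative_at)

lemma grad3_unique: "(f has_derivative (\<lambda>v. G \<bullet> v)) (at x) \<Longrightarrow> grad3 f x = G"
  by (simp add: grad3_def pderiv3_unique vec_eq_iff inner_axis)

lemma has_derivative_grad3:
  assumes "f differentiable (at x)"
  shows "(f has_derivative (\<lambda>v. grad3 f x \<bullet> v)) (at x)"
proof -
  let ?f' = "frechet_derivative f (at x)"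
  have f': "(f has_derivative ?f') (at x)" using assms frechet_derivative_works by blast
  then have lin: "linear ?f'" using has_derivative_linear by blast
  have "?f' v = grad3 f x \<bullet> v" for v
  proof -
    have "?f' v = ?f' (\<Sum>i\<in>UNIV. v $ i *\<^sub>R axis i 1)"
      by (simp only: basis_expansion[of v] flip: scalar_mult_eq_scaleR)
    also have "\<dots> = (\<Sum>i\<in>UNIV. v $ i * ?f' (axis i 1))"
      by (simp add: linear_sum[OF lin] linear_scale[OF lin])
    also have "\<dots> = grad3 f x \<bullet> v" by (simp add: grad3_def pderiv3_def inner_vec_def mult.commute)
    finally show ?thesis .
  qed
  then have "?f' = (\<lambda>v. grad3 f x \<bullet> v)" by auto
  then show ?thesis using f' by metis
qed

lemma pderiv3_affine: "pderiv3 i (\<lambda>x. a \<bullet> x + c) = (\<lambda>x. a $ i)"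
proof
  fix x
  have "((\<lambda>x. a \<bullet> x + c) has_derivative (\<lambda>v. a \<bullet> v)) (at x)" by (auto intro!: derivative_eq_intros)
  then show "pderiv3 i (\<lambda>x. a \<bullet> x + c) x = a $ i" by (simp add: pderiv3_unique inner_axis)
qed

lemma pderiv3_const: "pderiv3 i (\<lambda>x. c) = (\<lambda>x. 0)"
  using pderiv3_affine[of i 0 c] by simp

lemma pderiv3_add:
  assumes "\<And>x. f differentiable (at x)" "\<And>x. g differentiable (at x)"
  shows "pderiv3 i (\<lambda>x. f x + g x) = (\<lambda>x. pderiv3 i f x + pderiv3 i g x)"
proof
  fix x
  show "pderiv3 i (\<lambda>x. f x + g x) x = pderiv3 i f x + pderiv3 i g x"
    using has_derivative_add[OF has_derivative_grad3[OF assms(1)] has_derivative_grad3[OF assms(2)], of x]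
    by (auto dest!: pderiv3_unique[where i=i] simp: inner_axis grad3_def)
qed

lemma pderiv3_mult:
  assumes "\<And>x. f differentiable (at x)" "\<And>x. g differentiable (at x)"
  shows "pderiv3 i (\<lambda>x. f x * g x) = (\<lambda>x. f x * pderiv3 i g x + pderiv3 i f x * g x)"
proof
  fix x
  show "pderiv3 i (\<lambda>x. f x * g x) x = f x * pderiv3 i g x + pderiv3 i f x * g x"
    using has_derivative_mult[OF has_derivative_grad3[OF assms(1)] has_derivative_grad3[OF assms(2)], of x]
    by (auto dest!: pderiv3_unique[where i=i] simp: inner_axis grad3_def)
qed

lemma flat_comp_has_derivative:
  assumes "(q has_derivative q') (at x)"
  shows "((\<lambda>x. flat P (q x)) has_derivative (\<lambda>v. flat (monom 1 2 * (P - pderiv P)) (q x) * q' v)) (at x)"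
  using has_derivative_compose[OF assms flat_has_derivative[of P "q x", unfolded has_field_derivative_def]]
  by simp

lemma pderiv3_flat:
  assumes "\<And>x. q differentiable (at x)"
  shows "pderiv3 i (\<lambda>x. flat P (q x)) = (\<lambda>x. flat (monom 1 2 * (P - pderiv P)) (q x) * pderiv3 i q x)"
proof
  fix x
  show "pderiv3 i (\<lambda>x. flat P (q x)) x = flat (monom 1 2 * (P - pderiv P)) (q x) * pderiv3 i q x"
    using flat_comp_has_derivative[OF has_derivative_grad3[OF assms], of P x]
    by (auto dest!: pderiv3_unique[where i=i] simp: inner_axis grad3_def)
qed

lemmas pderiv3_rules = pderiv3_affine pderiv3_const pderiv3_add pderiv3_mult pderiv3_flat

lemma tame_pderiv3: "tame f \<Longrightarrow> tame (pderiv3 i f)"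
  by (induction rule: tame.induct)
    (auto simp: pderiv3_rules tame_differentiable intro!: tame.intros tame_const)

text \<open>The degree bound is merely kept, although it could be lowered: a field, its divergence
  and its normal jump can then share one \<open>m\<close> and therefore one constant.\<close>

lemma polyfun_pderiv3: "polyfun m f \<Longrightarrow> polyfun m (pderiv3 i f)"
proof (induction rule: polyfun.induct)
  case (const c)
  show ?case by (simp add: pderiv3_const polyfun.const)
next
  case (affine a c)
  show ?case unfolding pderiv3_affine by (rule polyfun.mono[OF polyfun.const]) simp
next
  case (add m f g)
  then show ?case
    by (simp add: pderiv3_add tame_differentiable[OF polyfun_imp_tame] polyfun.add)
next
  case (mult m f n g)
  then show ?case
    by (simp add: pderiv3_mult tame_differentiable[OF polyfun_imp_tame] polyfun.add polyfun.mult)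
qed (rule polyfun.mono)

lemma tame_continuous_on: "tame f \<Longrightarrow> continuous_on S f"
  by (meson continuous_at_imp_continuous_on differentiable_imp_continuous_within tame_differentiable)

lemma tame_pderiv3_commute: "tame f \<Longrightarrow> pderiv3 i (pderiv3 j f) = pderiv3 j (pderiv3 i f)"
proof (induction rule: tame.induct)
  case (affine a c)
  show ?case by (simp add: pderiv3_affine pderiv3_const)
next
  case (add f g)
  then show ?case by (simp add: pderiv3_add tame_differentiable tame_pderiv3)
next
  case (mult f g)
  then show ?case
    by (simp add: pderiv3_add pderiv3_mult tame_differentiable tame_pderiv3 tame.mult fun_eq_iff algebra_simps)
next
  case (flat q P)
  then show ?case
    by (simp add: pderiv3_mult pderiv3_flat tame_differentiable tame_pderiv3 tame.flat fun_eq_iff algebra_simps)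
qed

lemma polyfun_line_poly: "polyfun m f \<Longrightarrow> line_poly m f"
proof (induction rule: polyfun.induct)
  case (const c)
  have "degree [:c:] \<le> 0 \<and> (\<forall>t. c = poly [:c:] t)" for c :: real by simp
  then show ?case unfolding line_poly_def by blast
next
  case (affine a c)
  have "degree [:a \<bullet> x + c, a \<bullet> v:] \<le> 1 \<and> (\<forall>t. a \<bullet> (x + t *\<^sub>R v) + c = poly [:a \<bullet> x + c, a \<bullet> v:] t)" for x v
    by (auto simp: algebra_simps inner_add_right)
  then show ?case unfolding line_poly_def by blast
next
  case (add m f g)
  show ?case unfolding line_poly_def
  proof (intro allI)
    fix x v
    obtain P Q where "degree P \<le> m" "degree Q \<le> m" "\<forall>t. f (x + t *\<^sub>R v) = poly P t" "\<forall>t. g (x + t *\<^sub>R v) = poly Q t"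
      using add.IH unfolding line_poly_def by metis
    then show "\<exists>P. degree P \<le> m \<and> (\<forall>t. f (x + t *\<^sub>R v) + g (x + t *\<^sub>R v) = poly P t)"
      by (intro exI[of _ "P + Q"]) (auto simp: degree_add_le)
  qed
next
  case (mult m f n g)
  show ?case unfolding line_poly_def
  proof (intro allI)
    fix x v
    obtain P Q where "degree P \<le> m" "degree Q \<le> n" "\<forall>t. f (x + t *\<^sub>R v) = poly P t" "\<forall>t. g (x + t *\<^sub>R v) = poly Q t"
      using mult.IH unfolding line_poly_def by metis
    moreover from this have "degree (P * Q) \<le> m + n" using degree_mult_le[of P Q] by linarith
    ultimately show "\<exists>P. degree P \<le> m + n \<and> (\<forall>t. f (x + t *\<^sub>R v) * g (x + t *\<^sub>R v) = poly P t)"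
      by (intro exI[of _ "P * Q"]) auto
  qed
next
  case (mono m f n)
  then show ?case unfolding line_poly_def by (meson le_trans)
qed

text \<open>The substitution only changes the linear forms, from \<open>a\<close> to
  \<open>a - (a \<bullet> N) *\<^sub>R N\<close>. For a unit vector \<open>N\<close> it is the
  orthogonal projection onto the plane through \<open>y\<close>, so the result is the trace of
  \<open>f\<close> on that plane, extended constantly along \<open>N\<close>.\<close>

lemma polyfun_project:
  assumes "polyfun m f"
  shows "polyfun m (\<lambda>x. f (x - (N \<bullet> (x - y)) *\<^sub>R N))"
  using assms
proof (induction rule: polyfun.induct)
  case (affine a c)
  have "a \<bullet> (x - (N \<bullet> (x - y)) *\<^sub>R N) + c = (a - (a \<bullet> N) *\<^sub>R N) \<bullet> x + (c + (N \<bullet> y) * (a \<bullet> N))" for x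
    by (simp add: inner_diff_right inner_diff_left algebra_simps)
  then show ?case using polyfun.affine by presburger
qed (auto intro: polyfun.intros)

lemma polyfun_sum: "(\<And>i. i \<in> A \<Longrightarrow> polyfun m (f i)) \<Longrightarrow> polyfun m (\<lambda>x. \<Sum>i\<in>A. f i x)"
  by (induction A rule: infinite_finite_induct) (auto intro: polyfun.intros polyfun.mono[OF polyfun.const])

lemma polyfun_prod: "(\<And>i. i \<in> A \<Longrightarrow> polyfun (d i) (f i)) \<Longrightarrow> polyfun (sum d A) (\<lambda>x. \<Prod>i\<in>A. f i x)"
  by (induction A rule: infinite_finite_induct) (auto intro: polyfun.intros polyfun.mono[OF polyfun.const])

lemma polyfun_cmult: "polyfun m f \<Longrightarrow> polyfun m (\<lambda>x. c * f x)"
  using polyfun.mult[OF polyfun.const, of m f c] by simp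

lemma polyfun_nth: "polyfun 1 (\<lambda>x. x $ i)"
  using polyfun.affine[of "axis i 1" 0] by (simp add: inner_axis')

lemma polyfun_power: "polyfun m f \<Longrightarrow> polyfun (n * m) (\<lambda>x. f x ^ n)"
  by (induction n) (auto intro: polyfun.intros)

lemma polys_with_exponents_polyfun:
  assumes "p \<in> polys_with_exponents A" "\<And>\<alpha>. \<alpha> \<in> A \<Longrightarrow> sum \<alpha> UNIV \<le> k"
  shows "polyfun k p"
proof -
  obtain c where p: "p = (\<lambda>x. \<Sum>\<alpha>\<in>A. c \<alpha> * (\<Prod>i\<in>UNIV. (x $ i) ^ \<alpha> i))"
    using assms(1) unfolding polys_with_exponents_def by blast
  have "polyfun k (\<lambda>x. c \<alpha> * (\<Prod>i\<in>UNIV. (x $ i) ^ \<alpha> i))" if "\<alpha> \<in> A" for \<alpha>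
  proof (rule polyfun_cmult, rule polyfun.mono)
    show "polyfun (\<Sum>i\<in>UNIV. \<alpha> i) (\<lambda>x. \<Prod>i\<in>UNIV. (x $ i) ^ \<alpha> i)"
      using polyfun_power[OF polyfun_nth] by (intro polyfun_prod) auto
    show "(\<Sum>i\<in>UNIV. \<alpha> i) \<le> k" using assms(2)[OF that] .
  qed
  then show ?thesis unfolding p by (intro polyfun_sum) auto
qed

lemma polyfun_diff: "polyfun m f \<Longrightarrow> polyfun m g \<Longrightarrow> polyfun m (\<lambda>x. f x - g x)"
  using polyfun.add[of m f "\<lambda>x. -1 * g x"] polyfun_cmult[of m g "-1"] by simp

text \<open>The cross product with the position vector raises the degree \<open>k\<close> of the
  homogeneous part by one.\<close>

lemma nedelec_local_polyfun:
  assumes "v \<in> nedelec_local k"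
  shows "polyfun (Suc k) (\<lambda>x. v x $ i)"
proof -
  obtain p q where pq: "\<forall>i. (\<lambda>x. p x $ i) \<in> polys_with_exponents {\<alpha>. sum \<alpha> UNIV \<le> k}"
      "\<forall>i. (\<lambda>x. q x $ i) \<in> polys_with_exponents {\<alpha>. sum \<alpha> UNIV = k}"
    and v: "v = (\<lambda>x. p x + cross3 x (q x))"
    using assms unfolding nedelec_local_def polys_upto_def polys_homogeneous_def by blast
  have p: "polyfun k (\<lambda>x. p x $ i)" and q: "polyfun k (\<lambda>x. q x $ i)" for i
    using pq by (auto intro: polys_with_exponents_polyfun)
  have xq: "polyfun (Suc k) (\<lambda>x. x $ a * q x $ b)" for a b
    using polyfun.mult[OF polyfun_nth q] by simp
  then have qx: "polyfun (Suc k) (\<lambda>x. q x $ b * x $ a)" for a b by (simp add: mult.commute)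
  have "polyfun (Suc k) (\<lambda>x. cross3 x (q x) $ i)"
    using exhaust_3[of i] by (auto simp: cross3_simps intro!: polyfun_diff xq qx)
  then show ?thesis unfolding v by (auto intro!: polyfun.add polyfun.mono[OF p])
qed

text \<open>Taking the squared distance makes the argument of \<open>flat\<close> a polynomial in
  \<open>x\<close>, which keeps the bump inside the algebra \<open>tame\<close>.\<close>

definition bump :: "real^3 \<Rightarrow> real \<Rightarrow> real^3 \<Rightarrow> real" where
  "bump x0 \<rho> x = flat 1 (1 - (norm (x - x0))\<^sup>2 / \<rho>\<^sup>2)"

lemma tame_bump: "tame (bump x0 \<rho>)"
proof -
  have "polyfun 2 (\<lambda>x. (x $ i - x0 $ i)\<^sup>2)" for i
    using polyfun_power[OF polyfun_diff[OF polyfun_nth polyfun.mono[OF polyfun.const]], of 2] by simp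
  then have "polyfun 2 (\<lambda>x. 1 - (1 / \<rho>\<^sup>2) * (\<Sum>i\<in>UNIV. (x $ i - x0 $ i)\<^sup>2))"
    by (intro polyfun_diff polyfun_cmult polyfun_sum) (auto intro: polyfun.mono[OF polyfun.const])
  moreover have "(\<lambda>x. 1 - (1 / \<rho>\<^sup>2) * (\<Sum>i\<in>UNIV. (x $ i - x0 $ i)\<^sup>2)) = (\<lambda>x. 1 - (norm (x - x0))\<^sup>2 / \<rho>\<^sup>2)"
    by (simp add: norm_vec_def L2_set_def sum_nonneg)
  ultimately have "tame (\<lambda>x. 1 - (norm (x - x0))\<^sup>2 / \<rho>\<^sup>2)" using polyfun_imp_tame by metis
  then show ?thesis unfolding bump_def[abs_def] by (rule tame.flat)
qed

lemma bump_nonneg: "0 \<le> bump x0 \<rho> x"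
  by (simp add: bump_def flat_def)

lemma bump_le_1: "bump x0 \<rho> x \<le> 1"
  by (simp add: bump_def flat_def)

lemma bump_eq_0: "0 < \<rho> \<Longrightarrow> \<rho> \<le> dist x0 x \<Longrightarrow> bump x0 \<rho> x = 0"
  using power_mono[of \<rho> "norm (x - x0)" 2]
  by (simp add: bump_def flat_def dist_norm norm_minus_commute not_less)

text \<open>At distance \<open>3 / 4 * \<rho>\<close> the argument of \<open>flat\<close> is
  \<open>7 / 16\<close>, whose reciprocal is below \<open>3\<close>. The radius is the half in which
  \<open>x1\<close> is found plus the quarter allowed around it.\<close>

lemma bump_lower:
  assumes "0 < \<rho>" "dist x0 x \<le> 3 / 4 * \<rho>"
  shows "exp (- 3) \<le> bump x0 \<rho> x"
proof -
  have "(norm (x - x0))\<^sup>2 \<le> (3 / 4 * \<rho>)\<^sup>2"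
    using assms by (intro power_mono) (auto simp: dist_norm norm_minus_commute)
  then have "(norm (x - x0))\<^sup>2 / \<rho>\<^sup>2 \<le> 9 / 16" using assms by (simp add: power_mult_distrib power_divide field_simps)
  then have q: "7 / 16 \<le> 1 - (norm (x - x0))\<^sup>2 / \<rho>\<^sup>2" (is "_ \<le> ?q") by simp
  then have "1 / ?q \<le> 1 / (7/16)" by (intro divide_left_mono) auto
  then have "1 / ?q \<le> 3" by simp
  moreover have "0 < ?q" using q by linarith
  ultimately show ?thesis unfolding bump_def flat_def by simp
qed

text \<open>The outer derivative is \<open>y^2 * exp (- y)\<close> with \<open>y\<close> the
  reciprocal of the argument, at most \<open>2\<close> because \<open>y^2 / 2 \<le> exp y\<close>;
  the inner gradient has norm at most \<open>2 / \<rho>\<close> in the ball.\<close>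

lemma norm_grad3_bump_le:
  assumes "0 < \<rho>" "dist x0 x \<le> \<rho>"
  shows "norm (grad3 (bump x0 \<rho>) x) \<le> 4 / \<rho>"
proof -
  let ?q = "1 - (norm (x - x0))\<^sup>2 / \<rho>\<^sup>2"
  define s where "s = flat (monom 1 2) ?q"
  have s: "0 \<le> s" "s \<le> 2"
  proof -
    have "(1 / t)\<^sup>2 * exp (- (1 / t)) \<le> 2" if "t > 0" for t :: real
    proof -
      have "(1 / t)\<^sup>2 / 2 \<le> exp (1 / t)"
        using exp_lower_Taylor_quadratic[of "1 / t"] that
        by (smt (verit) zero_le_divide_1_iff)
      then have "(1 / t)\<^sup>2 * exp (- (1 / t)) \<le> (2 * exp (1 / t)) * exp (- (1 / t))"
        by (intro mult_right_mono) auto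
      also have "\<dots> = 2" by (simp flip: exp_add)
      finally show ?thesis .
    qed
    then show "s \<le> 2" "0 \<le> s" by (auto simp: s_def flat_def poly_monom)
  qed
  have "((\<lambda>x. 1 - (norm (x - x0))\<^sup>2 / \<rho>\<^sup>2) has_derivative (\<lambda>v. - (2 * ((x - x0) \<bullet> v)) / \<rho>\<^sup>2)) (at x)"
    unfolding power2_norm_eq_inner using assms(1)
    by (auto intro!: derivative_eq_intros simp: inner_commute field_simps power4_eq_xxxx power2_eq_square)
  from flat_comp_has_derivative[OF this, of 1]
  have "(bump x0 \<rho> has_derivative (\<lambda>v. (- (2 * s / \<rho>\<^sup>2) *\<^sub>R (x - x0)) \<bullet> v)) (at x)"
    unfolding bump_def[abs_def] s_def by (simp add: algebra_simps diff_divide_distrib)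
  then have "grad3 (bump x0 \<rho>) x = - (2 * s / \<rho>\<^sup>2) *\<^sub>R (x - x0)" by (rule grad3_unique)
  then have "norm (grad3 (bump x0 \<rho>) x) = 2 * s / \<rho>\<^sup>2 * norm (x - x0)" using s by simp
  also have "\<dots> \<le> 2 * 2 / \<rho>\<^sup>2 * \<rho>"
    using s assms by (intro mult_mono divide_right_mono) (auto simp: dist_norm norm_minus_commute)
  also have "\<dots> = 4 / \<rho>" using assms by (simp add: power2_eq_square)
  finally show ?thesis .
qed

section \<open>Integration by parts\<close>

text \<open>First-order regularity is what the Gauss formulas use, and it is available for the
  product of a test function with a component of an arbitrary smooth field.\<close>

definition C1c :: "(real^3 \<Rightarrow> real) \<Rightarrow> bool" where
  "C1c f \<longleftrightarrow> (\<forall>x. f differentiable (at x)) \<and> (\<forall>i. continuous_on UNIV (pderiv3 i f)) \<and> bounded {x. f x \<noteq> 0}"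

lemma grad3_cont: "C1c f \<Longrightarrow> continuous_on S (grad3 f)"
proof -
  assume "C1c f"
  then have "continuous_on UNIV (\<lambda>x. \<chi> i. pderiv3 i f x)"
    unfolding C1c_def by (intro continuous_on_vec_lambda) auto
  then show ?thesis unfolding grad3_def[abs_def] by (rule continuous_on_subset) simp
qed

lemma C1c_cont: "C1c f \<Longrightarrow> continuous_on S f"
  unfolding C1c_def by (meson continuous_at_imp_continuous_on differentiable_imp_continuous_within)

lemma grad3_eq_0:
  assumes "open U" "x \<in> U" "\<And>y. y \<in> U \<Longrightarrow> f y = 0"
  shows "grad3 f x = 0"
proof (rule grad3_unique)
  have "((\<lambda>y. 0::real) has_derivative (\<lambda>v. 0 \<bullet> v)) (at x)" by simp
  then show "(f has_derivative (\<lambda>v. 0 \<bullet> v)) (at x)"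
    by (rule has_derivative_transform_within_open[OF _ assms(1,2)]) (use assms(3) in simp)
qed

lemma C1c_support:
  assumes "C1c f"
  obtains R where "0 < R" "\<And>x. R < norm x \<Longrightarrow> f x = 0" "\<And>x. R < norm x \<Longrightarrow> grad3 f x = 0"
proof -
  obtain R where R: "0 < R" "\<And>x. f x \<noteq> 0 \<Longrightarrow> norm x \<le> R"
    using assms unfolding C1c_def bounded_pos by auto
  have "grad3 f x = 0" if "R < norm x" for x
  proof (rule grad3_eq_0)
    show "open (- cball (0::real^3) R)" by auto
  qed (use that R(2) in \<open>force simp: not_le\<close>)+
  then show ?thesis using that[of R] R by force
qed

lemma integrable_cont_bounded_support:
  fixes f :: "'a::euclidean_space \<Rightarrow> real"
  assumes "continuous_on UNIV f" "\<And>x. R < norm x \<Longrightarrow> f x = 0"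
  shows "integrable lborel f"
proof -
  have "integrable lborel (\<lambda>x. indicator (cball 0 R) x *\<^sub>R f x)"
    using assms(1) by (intro borel_integrable_compact) (auto intro: continuous_on_subset)
  moreover have "(\<lambda>x. indicator (cball 0 R) x *\<^sub>R f x) = f"
    using assms(2) by (auto simp: fun_eq_iff indicator_def not_le)
  ultimately show ?thesis by simp
qed

lemma C1c_integrable_grad:
  assumes "C1c f"
  shows "integrable lborel (\<lambda>x. grad3 f x \<bullet> v)"
proof -
  obtain R where "\<And>x. R < norm x \<Longrightarrow> grad3 f x = 0" using C1c_support[OF assms] by blast
  then show ?thesis
    by (intro integrable_cont_bounded_support[of _ R] continuous_intros grad3_cont assms) auto
qed

lemma C1c_integrable:
  assumes "C1c f"
  shows "integrable lborel f"
proof -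
  obtain R where "\<And>x. R < norm x \<Longrightarrow> f x = 0" using C1c_support[OF assms] by blast
  then show ?thesis by (intro integrable_cont_bounded_support[of _ R] C1c_cont assms)
qed

section \<open>Translations, line integrals and the Gauss formula on a half-space\<close>

lemma lborel_integral_translate:
  fixes f :: "'a::euclidean_space \<Rightarrow> real"
  assumes "f \<in> borel_measurable borel"
  shows "(LINT x|lborel. f (x + c)) = (LINT x|lborel. f x)"
proof -
  have "(LINT x|lborel. f x) = (LINT x|distr lborel borel ((+) c). f x)" by (simp add: lborel_distr_plus)
  also have "\<dots> = (LINT x|lborel. f (c + x))" using assms by (subst integral_distr) auto
  finally show ?thesis by (simp add: add.commute)
qed

lemma lborel_integrable_translate:
  fixes f :: "'a::euclidean_space \<Rightarrow> real"
  assumes "integrable lborel f"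
  shows "integrable lborel (\<lambda>x. f (x + c))"
proof -
  have "integrable (distr lborel borel ((+) c)) f" using assms by (simp add: lborel_distr_plus)
  then have "integrable lborel (\<lambda>x. f (c + x))"
    by (subst (asm) integrable_distr_eq) (use assms in auto)
  then show ?thesis by (simp add: add.commute)
qed

lemma FTC_line:
  assumes f: "C1c f" and "a \<le> b"
  shows "(LINT t|lborel. indicator {a..b} t * (grad3 f (x + t *\<^sub>R v) \<bullet> v)) = f (x + b *\<^sub>R v) - f (x + a *\<^sub>R v)"
proof -
  have "((\<lambda>t. f (x + t *\<^sub>R v)) has_real_derivative (grad3 f (x + t *\<^sub>R v) \<bullet> v)) (at t)" for t
  proof -
    have g: "((\<lambda>t. x + t *\<^sub>R v) has_derivative (\<lambda>h. h *\<^sub>R v)) (at t)" by (auto intro!: derivative_eq_intros)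
    have "f differentiable at (x + t *\<^sub>R v)" using f by (simp add: C1c_def)
    from has_derivative_compose[OF g has_derivative_grad3[OF this]]
    show ?thesis by (simp add: has_field_derivative_def mult.commute[of _ "_ \<bullet> _"])
  qed
  then have "(LINT t|lborel. (grad3 f (x + t *\<^sub>R v) \<bullet> v) * indicator {a..b} t) = f (x + b *\<^sub>R v) - f (x + a *\<^sub>R v)"
  proof (intro integral_FTC_Icc_real assms)
    have "continuous_on UNIV (\<lambda>t. grad3 f (x + t *\<^sub>R v) \<bullet> v)"
      by (intro continuous_intros continuous_on_compose2[OF grad3_cont[OF f, of UNIV]]) auto
    then show "isCont (\<lambda>t. grad3 f (x + t *\<^sub>R v) \<bullet> v) t" for t
      by (simp add: continuous_on_eq_continuous_at)
  qed
  then show ?thesis by (simp add: mult.commute)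
qed

text \<open>Shifting by \<open>t *\<^sub>R v\<close> does not change the integral, so it equals its
  average over \<open>t\<close> in the unit interval. By Fubini and the fundamental theorem the
  average is the integral of \<open>f\<close> over \<open>A\<close> subtracted from that of its
  translate, which is zero. Two cases matter: the whole space, and a half-space with
  \<open>v\<close> parallel to its boundary.\<close>

lemma integral_grad3_invariant:
  assumes f: "C1c f" and A: "A \<in> sets borel" and inv: "\<And>t x. x + t *\<^sub>R v \<in> A \<longleftrightarrow> x \<in> A"
  shows "(LINT x|lborel. indicator A x * (grad3 f x \<bullet> v)) = 0"
proof -
  obtain R where R: "0 < R" "\<And>x. R < norm x \<Longrightarrow> f x = 0" "\<And>x. R < norm x \<Longrightarrow> grad3 f x = 0"
    using C1c_support[OF f] by blast
  let ?G = "\<lambda>x. grad3 f x \<bullet> v"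
  \<comment> \<open>For \<open>t\<close> in the unit interval the shift moves the support of
    \<open>grad3 f\<close> by at most \<open>norm v\<close>. The product is compact, which yields
    the joint integrability for Fubini.\<close>
  let ?K = "cball (0::real^3) (R + norm v) \<times> {0..1::real}"
  let ?F = "\<lambda>x t. indicator A x * (indicator {0..1} t * ?G (x + t *\<^sub>R v))"
  have Gm: "?G \<in> borel_measurable borel"
    by (intro borel_measurable_continuous_onI continuous_intros grad3_cont[OF f])
  have fm: "f \<in> borel_measurable borel"
    by (intro borel_measurable_continuous_onI C1c_cont[OF f])
  have "compact ?K" by (intro compact_Times) auto
  then have "integrable lborel (\<lambda>z. indicator ?K z *\<^sub>R ?G (fst z + snd z *\<^sub>R v))"
    by (rule borel_integrable_compact)
      (auto intro!: continuous_intros continuous_on_compose2[OF grad3_cont[OF f, of UNIV]])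
  then have "integrable lborel (\<lambda>z. indicator (A \<times> UNIV) z *\<^sub>R (indicator ?K z *\<^sub>R ?G (fst z + snd z *\<^sub>R v)))"
    by (rule integrable_mult_indicator[rotated]) (use A in \<open>auto simp: lborel_prod[symmetric] intro!: pair_measureI\<close>)
  moreover have "indicator (A \<times> UNIV) z *\<^sub>R (indicator ?K z *\<^sub>R ?G (fst z + snd z *\<^sub>R v)) = case_prod ?F z" for z
  proof -
    obtain x t where z: "z = (x, t)" by (cases z)
    have "?G (x + t *\<^sub>R v) = 0" if "t \<in> {0..1}" "R + norm v < norm x"
    proof -
      have "norm x \<le> norm (x + t *\<^sub>R v) + norm (t *\<^sub>R v)" by (metis add_diff_cancel_right' norm_triangle_ineq4)
      moreover have "norm (t *\<^sub>R v) \<le> norm v" using that(1) by (simp add: mult_left_le_one_le)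
      ultimately show ?thesis using R(3) that(2) by simp
    qed
    then show ?thesis by (auto simp: z indicator_def not_le)
  qed
  ultimately have int: "integrable (lborel \<Otimes>\<^sub>M lborel) (case_prod ?F)"
    by (simp add: lborel_prod)
  have "(LINT x|lborel. indicator A x * ?G x) = (LINT t|lborel. indicator {0..1::real} t * (LINT x|lborel. indicator A x * ?G x))"
    by simp
  also have "\<dots> = (LINT t|lborel. (LINT x|lborel. ?F x t))"
  proof (rule Bochner_Integration.integral_cong[OF refl])
    fix t :: real
    have "(LINT x|lborel. indicator A x * ?G x) = (LINT x|lborel. indicator A (x + t *\<^sub>R v) * ?G (x + t *\<^sub>R v))"
      by (rule lborel_integral_translate[symmetric]) (use A Gm in measurable)
    also have "\<dots> = (LINT x|lborel. indicator A x * ?G (x + t *\<^sub>R v))"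
      by (simp add: indicator_def inv)
    finally show "indicator {0..1} t * (LINT x|lborel. indicator A x * ?G x) = (LINT x|lborel. ?F x t)"
      by (simp add: indicator_def)
  qed
  also have "\<dots> = (LINT x|lborel. (LINT t|lborel. ?F x t))"
    by (rule lborel_pair.Fubini_integral[OF int])
  also have "\<dots> = (LINT x|lborel. indicator A (x + v) * f (x + v) - indicator A x * f x)"
    using FTC_line[OF f, of 0 1 _ v] inv[of _ 1]
    by (intro Bochner_Integration.integral_cong[OF refl]) (auto simp: indicator_def)
  also have "\<dots> = 0"
  proof -
    have i: "integrable lborel (\<lambda>x. indicator A x * f x)"
      using integrable_mult_indicator[of A lborel f] A C1c_integrable[OF f] by simp
    show ?thesis
      using lborel_integral_translate[of "\<lambda>x. indicator A x * f x" v] i lborel_integrable_translate[OF i, of v]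
      by (subst Bochner_Integration.integral_diff) auto
  qed
  finally show ?thesis .
qed

text \<open>Lebesgue measure is determined by its values on boxes. The preimage of a box under
  \<open>T\<close> is its image under the inverse, whose volume carries the reciprocal of the
  determinant.\<close>

lemma lborel_linear_image:
  fixes T :: "real^3 \<Rightarrow> real^3"
  assumes T: "linear T" and det: "det (matrix T) \<noteq> 0"
  shows "lborel = density (distr lborel borel T) (\<lambda>_. ennreal \<bar>det (matrix T)\<bar>)"
proof (rule lborel_eqI)
  have bijT: "bij T"
    using det T by (meson det_nz_iff_inj eucl.linear_inj_imp_surj bij_def linear_injective_imp_surjective)
  define S where "S = inv T"
  have S: "linear S" unfolding S_def using bijT T by (simp add: bij_def inj_linear_imp_inv_linear)
  have TS: "T \<circ> S = id" "S \<circ> T = id" using bijT by (auto simp: S_def bij_is_surj surj_iff[symmetric] bij_is_inj)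
  have "matrix T ** matrix S = mat 1"
    using matrix_compose[OF S T] TS by (simp add: matrix_id_mat_1)
  then have dd: "det (matrix T) * det (matrix S) = 1" by (metis det_I det_mul)
  have Tm: "T \<in> borel_measurable borel"
    by (intro borel_measurable_continuous_onI linear_continuous_on linear_conv_bounded_linear[THEN iffD1] T)
  fix l u :: "real^3" assume lu: "\<And>b. b \<in> Basis \<Longrightarrow> l \<bullet> b \<le> u \<bullet> b"
  have pre: "T -` box l u = S ` box l u"
    using TS by (auto simp: fun_eq_iff image_iff) metis
  have "emeasure (density (distr lborel borel T) (\<lambda>_. ennreal \<bar>det (matrix T)\<bar>)) (box l u)
      = ennreal \<bar>det (matrix T)\<bar> * emeasure lborel (T -` box l u)"
    using Tm by (simp add: emeasure_density nn_integral_cmult_indicator emeasure_distr)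
  also have "emeasure lborel (T -` box l u) = emeasure lebesgue (S ` box l u)"
    using measurable_sets[OF Tm, of "box l u"] by (simp add: pre)
  also have "\<dots> = ennreal (measure lebesgue (S ` box l u))"
    using measurable_linear_image[OF S, of "box l u"] by (simp add: emeasure_eq_measure2 fmeasurableD2)
  also have "\<dots> = ennreal (\<bar>det (matrix S)\<bar> * measure lborel (box l u))"
    by (simp add: measure_linear_image[OF S])
  also have "ennreal \<bar>det (matrix T)\<bar> * \<dots> = ennreal (\<bar>det (matrix T) * det (matrix S)\<bar> * measure lborel (box l u))"
    by (simp add: ennreal_mult'[symmetric] abs_mult mult.assoc)
  also have "\<dots> = ennreal (\<Prod>b\<in>Basis. (u - l) \<bullet> b)"
    using lu by (simp add: dd measure_lborel_box)
  finally show "emeasure (density (distr lborel borel T) (\<lambda>_. ennreal \<bar>det (matrix T)\<bar>)) (box l u)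
      = ennreal (\<Prod>b\<in>Basis. (u - l) \<bullet> b)" .
qed simp

text \<open>The nesting of the pairs separates the two coordinates along a plane from the one across
  it, in the form in which Fubini will be applied.\<close>

lemma lborel_vec3:
  "lborel = distr lborel borel (\<lambda>z::(real \<times> real) \<times> real. vector [fst (fst z), snd (fst z), snd z] :: real^3)"
proof (rule lborel_eqI)
  let ?e = "\<lambda>z::(real \<times> real) \<times> real. vector [fst (fst z), snd (fst z), snd z] :: real^3"
  have "continuous_on UNIV (\<lambda>z::(real \<times> real) \<times> real. fst (fst z) *\<^sub>R axis 1 1 + snd (fst z) *\<^sub>R axis 2 1 + snd z *\<^sub>R (axis 3 1 :: real^3))"
    by (intro continuous_intros)
  also have "(\<lambda>z::(real \<times> real) \<times> real. fst (fst z) *\<^sub>R axis 1 1 + snd (fst z) *\<^sub>R axis 2 1 + snd z *\<^sub>R (axis 3 1 :: real^3)) = ?e"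
    by (auto simp: fun_eq_iff vec_eq_iff forall_3 axis_def)
  finally have "continuous_on UNIV ?e" .
  then have em: "?e \<in> borel_measurable borel" by (rule borel_measurable_continuous_onI)
  fix l u :: "real^3" assume lu: "\<And>b. b \<in> Basis \<Longrightarrow> l \<bullet> b \<le> u \<bullet> b"
  have lu': "l $ i \<le> u $ i" for i using lu[of "axis i 1"] by (auto simp: inner_axis axis_in_Basis_iff)
  have "?e -` box l u = ({l$1<..<u$1} \<times> {l$2<..<u$2}) \<times> {l$3<..<u$3}"
    by (auto simp: mem_box_cart forall_3)
  then have "emeasure (distr lborel borel ?e) (box l u) = emeasure lborel (({l$1<..<u$1} \<times> {l$2<..<u$2}) \<times> {l$3<..<u$3})"
    using em by (simp add: emeasure_distr)
  also have "\<dots> = ennreal (u$1 - l$1) * ennreal (u$2 - l$2) * ennreal (u$3 - l$3)"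
    using lu' by (simp add: lborel_prod[symmetric] lborel.emeasure_pair_measure_Times)
  also have "\<dots> = ennreal (\<Prod>i\<in>UNIV. (u - l) $ i)"
  proof -
    have "(\<Prod>i\<in>UNIV. (u - l) $ i) = (u$1 - l$1) * (u$2 - l$2) * (u$3 - l$3)"
      unfolding UNIV_3 by (simp add: mult.assoc)
    then show ?thesis using lu' by (simp only:) (simp add: ennreal_mult[symmetric])
  qed
  also have "(\<Prod>i\<in>UNIV. (u - l) $ i) = (\<Prod>b\<in>Basis. (u - l) \<bullet> b)"
  proof -
    have B: "Basis = range (\<lambda>i. axis i 1 :: real^3)"
      unfolding Basis_vec_def by (simp add: UNION_singleton_eq_range)
    have "inj (\<lambda>i. axis i 1 :: real^3)" by (simp add: inj_def axis_eq_axis)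
    from prod.reindex[OF this, of "\<lambda>b. (u - l) \<bullet> b"]
    have "(\<Prod>b\<in>Basis. (u - l) \<bullet> b) = (\<Prod>i\<in>UNIV. (u - l) \<bullet> axis i 1)"
      unfolding B comp_def .
    then show ?thesis by (simp add: inner_axis)
  qed
  finally show "emeasure (distr lborel borel ?e) (box l u) = ennreal (\<Prod>b\<in>Basis. (u - l) \<bullet> b)" .
qed simp

text \<open>By the Lagrange identity \<open>n\<close> has vanishing cross product with
  \<open>cross3 b c\<close>, so the Cauchy-Schwarz inequality between the two is an
  equality.\<close>

lemma norm_cross_normal:
  assumes "norm n = 1" "n \<bullet> b = 0" "n \<bullet> c = 0"
  shows "\<bar>n \<bullet> cross3 b c\<bar> = norm (cross3 b c)"
proof -
  have "cross3 n (cross3 b c) = 0" using assms by (simp add: Lagrange)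
  then have "(n \<bullet> cross3 b c)\<^sup>2 = (norm (cross3 b c))\<^sup>2"
    using norm_cross_dot[of n "cross3 b c"] assms(1) by simp
  then have "sqrt ((n \<bullet> cross3 b c)\<^sup>2) = sqrt ((norm (cross3 b c))\<^sup>2)" by (rule arg_cong)
  then show ?thesis by simp
qed

text \<open>The Jacobian of the coordinates is the triple product
  \<open>n \<bullet> cross3 b c\<close>. Since \<open>n\<close> is a unit normal, its modulus is the
  area factor that also occurs in \<open>face_integral\<close>.\<close>

lemma integral_slab_coordinates:
  fixes f :: "real^3 \<Rightarrow> real"
  assumes f: "integrable lborel f" and n: "norm n = 1" "n \<bullet> b = 0" "n \<bullet> c = 0" and bc: "cross3 b c \<noteq> 0"
  shows "(LINT x|lborel. f x) = norm (cross3 b c) *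
      (LINT z|lborel. LINT \<tau>|lborel. f (a + fst z *\<^sub>R b + snd z *\<^sub>R c + \<tau> *\<^sub>R n))" (is ?thesis1)
    and "integrable lborel (\<lambda>z. LINT \<tau>|lborel. f (a + fst z *\<^sub>R b + snd z *\<^sub>R c + \<tau> *\<^sub>R n))" (is ?thesis2)
proof -
  define T where "T = (\<lambda>x::real^3. x $ 1 *\<^sub>R b + x $ 2 *\<^sub>R c + x $ 3 *\<^sub>R n)"
  let ?e = "\<lambda>z::(real \<times> real) \<times> real. vector [fst (fst z), snd (fst z), snd z] :: real^3"
  have T: "linear T" unfolding T_def by (intro linearI) (auto simp: algebra_simps)
  have "det (matrix T) = n \<bullet> cross3 b c"
    by (simp add: det_3 matrix_def T_def axis_def cross3_def inner_vec_def sum_3 algebra_simps)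
  then have ad: "\<bar>det (matrix T)\<bar> = norm (cross3 b c)" using norm_cross_normal[OF n] by simp
  then have det: "det (matrix T) \<noteq> 0" using bc by auto
  have Tm: "T \<in> borel_measurable borel"
    by (intro borel_measurable_continuous_onI linear_continuous_on linear_conv_bounded_linear[THEN iffD1] T)
  have "continuous_on UNIV (\<lambda>z::(real \<times> real) \<times> real. fst (fst z) *\<^sub>R axis 1 1 + snd (fst z) *\<^sub>R axis 2 1 + snd z *\<^sub>R (axis 3 1 :: real^3))"
    by (intro continuous_intros)
  also have "(\<lambda>z::(real \<times> real) \<times> real. fst (fst z) *\<^sub>R axis 1 1 + snd (fst z) *\<^sub>R axis 2 1 + snd z *\<^sub>R (axis 3 1 :: real^3)) = ?e"
    by (auto simp: fun_eq_iff vec_eq_iff forall_3 axis_def)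
  finally have "continuous_on UNIV ?e" .
  then have em: "?e \<in> borel_measurable borel" by (rule borel_measurable_continuous_onI)
  let ?f = "\<lambda>x. f (x + a)"
  have fi: "integrable lborel ?f" by (rule lborel_integrable_translate[OF f])
  then have fm: "?f \<in> borel_measurable borel" by auto
  have "integrable (density (distr lborel borel T) (\<lambda>_. ennreal \<bar>det (matrix T)\<bar>)) ?f"
    using fi by (subst lborel_linear_image[OF T det, symmetric])
  then have "integrable (distr lborel borel T) (\<lambda>x. \<bar>det (matrix T)\<bar> *\<^sub>R ?f x)"
    using fm by (subst (asm) integrable_density) auto
  then have "integrable lborel (\<lambda>x. \<bar>det (matrix T)\<bar> *\<^sub>R ?f (T x))"
    by (subst (asm) integrable_distr_eq) (use fm Tm in auto)
  then have fT: "integrable lborel (\<lambda>x. ?f (T x))" using det by simp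
  then have "integrable (distr lborel borel ?e) (\<lambda>x. ?f (T x))"
    by (subst lborel_vec3[symmetric])
  then have "integrable lborel (\<lambda>z. ?f (T (?e z)))"
    by (subst (asm) integrable_distr_eq) (use fm Tm em in \<open>auto\<close>)
  then have "integrable (lborel \<Otimes>\<^sub>M lborel) (\<lambda>(z, \<tau>). ?f (T (?e (z, \<tau>))))"
    by (simp add: lborel_prod split_beta')
  moreover have eq: "?f (T (?e (z, \<tau>))) = f (a + fst z *\<^sub>R b + snd z *\<^sub>R c + \<tau> *\<^sub>R n)" for z \<tau>
    by (simp add: T_def algebra_simps)
  ultimately have int: "integrable (lborel \<Otimes>\<^sub>M lborel) (\<lambda>(z, \<tau>). f (a + fst z *\<^sub>R b + snd z *\<^sub>R c + \<tau> *\<^sub>R n))"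
    by simp
  show ?thesis2 using lborel_pair.integrable_fst[OF int] by simp
  have "(LINT x|lborel. f x) = (LINT x|lborel. ?f x)"
    using f by (intro lborel_integral_translate[symmetric]) auto
  also have "\<dots> = (LINT x|density (distr lborel borel T) (\<lambda>_. ennreal \<bar>det (matrix T)\<bar>). ?f x)"
    by (subst lborel_linear_image[OF T det, symmetric]) simp
  also have "\<dots> = \<bar>det (matrix T)\<bar> * (LINT x|distr lborel borel T. ?f x)"
    using fm by (subst integral_density) auto
  also have "(LINT x|distr lborel borel T. ?f x) = (LINT x|lborel. ?f (T x))"
    using fm Tm by (subst integral_distr) auto
  also have "\<dots> = (LINT x|distr lborel borel ?e. ?f (T x))"
    by (subst lborel_vec3[symmetric]) simp
  also have "\<dots> = (LINT z|lborel. ?f (T (?e z)))"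
    using fm Tm em by (subst integral_distr) auto
  also have "\<dots> = (LINT z|(lborel \<Otimes>\<^sub>M lborel). case_prod (\<lambda>z \<tau>. f (a + fst z *\<^sub>R b + snd z *\<^sub>R c + \<tau> *\<^sub>R n)) z)"
    unfolding lborel_prod by (rule Bochner_Integration.integral_cong) (auto simp: T_def algebra_simps)
  also have "\<dots> = (LINT z|lborel. LINT \<tau>|lborel. f (a + fst z *\<^sub>R b + snd z *\<^sub>R c + \<tau> *\<^sub>R n))"
    by (rule lborel_pair.integral_fst[OF int, symmetric])
  finally show ?thesis1 by (simp add: ad)
qed

text \<open>Only the normal part of \<open>w\<close> contributes, because the half-space is
  invariant under shifts along its boundary. The normal part is integrated along normal lines by the
  fundamental theorem.\<close>

lemma integral_grad3_halfspace:
  assumes f: "C1c f" and n: "norm n = 1" "n \<bullet> b = 0" "n \<bullet> c = 0" and bc: "cross3 b c \<noteq> 0"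
  shows "(LINT x|lborel. indicator {x. n \<bullet> (x - a) \<le> 0} x * (grad3 f x \<bullet> w)) =
      (n \<bullet> w) * (norm (cross3 b c) * (LINT z|lborel. f (a + fst z *\<^sub>R b + snd z *\<^sub>R c)))"
proof -
  let ?H = "{x. n \<bullet> (x - a) \<le> 0}"
  obtain R where R: "0 < R" "\<And>x. R < norm x \<Longrightarrow> f x = 0" "\<And>x. R < norm x \<Longrightarrow> grad3 f x = 0"
    using C1c_support[OF f] by blast
  have Hm: "?H \<in> sets borel"
    by (intro borel_closed closed_Collect_le continuous_intros)
  have nn: "n \<bullet> n = 1" using n(1) by (simp add: power2_norm_eq_inner[symmetric])
  have int: "integrable lborel (\<lambda>x. indicator ?H x * (grad3 f x \<bullet> v))" for v
    using integrable_mult_indicator[of ?H lborel "\<lambda>x. grad3 f x \<bullet> v"] Hm C1c_integrable_grad[OF f] by simp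
  \<comment> \<open>At depth \<open>L\<close> below the plane the normal component of a point is
    below \<open>- R\<close>, so the point is outside the support and the lower limit of the line
    integral contributes nothing.\<close>
  define L where "L = R + norm a + 1"
  have L: "0 \<le> L" using R(1) norm_ge_zero[of a] unfolding L_def by linarith
  have far: "R < norm (a + s *\<^sub>R b + r *\<^sub>R c + \<tau> *\<^sub>R n)" if "\<tau> \<le> - L" for s r \<tau>
  proof -
    have "\<bar>n \<bullet> (a + s *\<^sub>R b + r *\<^sub>R c + \<tau> *\<^sub>R n)\<bar> \<le> norm (a + s *\<^sub>R b + r *\<^sub>R c + \<tau> *\<^sub>R n)"
      using Cauchy_Schwarz_ineq2[of n] n(1) by (metis mult_1)
    moreover have "n \<bullet> (a + s *\<^sub>R b + r *\<^sub>R c + \<tau> *\<^sub>R n) = n \<bullet> a + \<tau>"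
      using n nn by (simp add: inner_add_right)
    moreover have "n \<bullet> a \<le> norm a" using norm_cauchy_schwarz[of n a] n(1) by simp
    ultimately show ?thesis using that unfolding L_def by linarith
  qed
  have N: "(LINT x|lborel. indicator ?H x * (grad3 f x \<bullet> n)) =
      norm (cross3 b c) * (LINT z|lborel. f (a + fst z *\<^sub>R b + snd z *\<^sub>R c))"
  proof -
    have "(LINT \<tau>|lborel. indicator ?H (a + s *\<^sub>R b + r *\<^sub>R c + \<tau> *\<^sub>R n) * (grad3 f (a + s *\<^sub>R b + r *\<^sub>R c + \<tau> *\<^sub>R n) \<bullet> n))
        = f (a + s *\<^sub>R b + r *\<^sub>R c)" (is "?lhs = _") for s r
    proof -
      have "indicator ?H (a + s *\<^sub>R b + r *\<^sub>R c + \<tau> *\<^sub>R n) * (grad3 f (a + s *\<^sub>R b + r *\<^sub>R c + \<tau> *\<^sub>R n) \<bullet> n)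
          = indicator {- L..0} \<tau> * (grad3 f (a + s *\<^sub>R b + r *\<^sub>R c + \<tau> *\<^sub>R n) \<bullet> n)" for \<tau>
      proof -
        have "n \<bullet> ((a + s *\<^sub>R b + r *\<^sub>R c + \<tau> *\<^sub>R n) - a) = \<tau>" using n nn by (simp add: inner_add_right inner_diff_right)
        then show ?thesis using R(3)[OF far[of \<tau> s r]] by (auto simp: indicator_def)
      qed
      then have "?lhs = (LINT \<tau>|lborel. indicator {- L..0} \<tau> * (grad3 f (a + s *\<^sub>R b + r *\<^sub>R c + \<tau> *\<^sub>R n) \<bullet> n))"
        by (rule Bochner_Integration.integral_cong[OF refl])
      also have "\<dots> = f (a + s *\<^sub>R b + r *\<^sub>R c + 0 *\<^sub>R n) - f (a + s *\<^sub>R b + r *\<^sub>R c + (- L) *\<^sub>R n)"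
        using L by (intro FTC_line[OF f]) auto
      also have "f (a + s *\<^sub>R b + r *\<^sub>R c + (- L) *\<^sub>R n) = 0" by (intro R(2) far) simp
      finally show ?thesis by simp
    qed
    then show ?thesis
      by (subst integral_slab_coordinates(1)[OF int n bc, where a=a]) simp
  qed
  define w' where "w' = w - (n \<bullet> w) *\<^sub>R n"
  have "n \<bullet> w' = 0" by (simp add: w'_def inner_diff_right nn)
  then have "x + t *\<^sub>R w' \<in> ?H \<longleftrightarrow> x \<in> ?H" for x t by (simp add: inner_diff_right inner_add_right)
  then have W: "(LINT x|lborel. indicator ?H x * (grad3 f x \<bullet> w')) = 0"
    by (intro integral_grad3_invariant[OF f Hm])
  have "indicator ?H x * (grad3 f x \<bullet> w) = indicator ?H x * (grad3 f x \<bullet> w') + (n \<bullet> w) * (indicator ?H x * (grad3 f x \<bullet> n))" for x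
    by (simp add: w'_def inner_diff_right algebra_simps)
  then show ?thesis using W N int by simp
qed

text \<open>The ball lies in the cylinder of height \<open>2 * \<delta>\<close> over its central
  disc. Read backwards, the known volume of the ball bounds the area of the disc from below by a
  multiple of \<open>\<delta>^2\<close>, without an integration in oblique plane
  coordinates.\<close>

lemma measure_ball_le_slab:
  assumes n: "norm n = 1" "n \<bullet> b = 0" "n \<bullet> c = 0" and bc: "cross3 b c \<noteq> 0"
    and \<delta>: "0 \<le> \<delta>" and x1: "n \<bullet> (x1 - a) = 0"
    and S: "S \<in> sets lborel" "emeasure lborel S < \<infinity>"
      "\<And>s r. dist x1 (a + s *\<^sub>R b + r *\<^sub>R c) \<le> \<delta> \<Longrightarrow> (s, r) \<in> S"
  shows "measure lborel (cball x1 \<delta>) \<le> norm (cross3 b c) * (2 * \<delta> * measure lborel S)"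
proof -
  let ?f = "indicator (cball x1 \<delta>) :: real^3 \<Rightarrow> real"
  have nn: "n \<bullet> n = 1" using n(1) by (simp add: power2_norm_eq_inner[symmetric])
  have f: "integrable lborel ?f"
    using emeasure_bounded_finite[of "cball x1 \<delta>"] by (simp add: integrable_indicator_iff)
  have Si: "integrable lborel (\<lambda>z. 2 * \<delta> * indicator S z :: real)"
    using S(1,2) by (intro integrable_mult_right) simp
  have le: "(LINT \<tau>|lborel. ?f (a + s *\<^sub>R b + r *\<^sub>R c + \<tau> *\<^sub>R n)) \<le> 2 * \<delta> * indicator S (s, r)" for s r
  proof -
    let ?p = "a + s *\<^sub>R b + r *\<^sub>R c"
    have orth: "n \<bullet> (x1 - ?p) = 0" using n x1 by (simp add: inner_diff_right inner_add_right)
    have dd: "(dist x1 (?p + \<tau> *\<^sub>R n))\<^sup>2 = (dist x1 ?p)\<^sup>2 + \<tau>\<^sup>2" for \<tau>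
    proof -
      have "x1 - (?p + \<tau> *\<^sub>R n) = (x1 - ?p) - \<tau> *\<^sub>R n" by simp
      then show ?thesis unfolding dist_norm power2_norm_eq_inner
        using orth nn by (simp add: inner_diff_left inner_diff_right inner_commute power2_eq_square algebra_simps)
    qed
    have le: "?f (?p + \<tau> *\<^sub>R n) \<le> indicator S (s, r) * indicator {- \<delta>..\<delta>} \<tau>" for \<tau>
    proof (cases "dist x1 (?p + \<tau> *\<^sub>R n) \<le> \<delta>")
      case True
      then have "(dist x1 ?p)\<^sup>2 + \<tau>\<^sup>2 \<le> \<delta>\<^sup>2" using dd[of \<tau>] power_mono[OF True, of 2] by simp
      then have "(dist x1 ?p)\<^sup>2 \<le> \<delta>\<^sup>2" "\<tau>\<^sup>2 \<le> \<delta>\<^sup>2" by (smt (verit) zero_le_power2)+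
      then have "dist x1 ?p \<le> \<delta>" "\<bar>\<tau>\<bar> \<le> \<delta>"
        using \<delta> by (auto intro: power2_le_imp_le simp: abs_le_square_iff[symmetric])
      then show ?thesis using S(3)[of s r] by (auto simp: indicator_def)
    qed (auto simp: indicator_def)
    have "(LINT \<tau>|lborel. ?f (?p + \<tau> *\<^sub>R n)) \<le> (LINT \<tau>|lborel. indicator S (s, r) * indicator {- \<delta>..\<delta>} \<tau>)"
    proof (rule integral_mono_AE')
      show "integrable lborel (\<lambda>\<tau>. indicator S (s, r) * indicator {- \<delta>..\<delta>} \<tau> :: real)"
        by (intro integrable_mult_right) (simp add: integrable_indicator_iff emeasure_lborel_Icc_eq)
    qed (use le in auto)
    also have "\<dots> = 2 * \<delta> * indicator S (s, r)" using \<delta> by simp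
    finally show ?thesis .
  qed
  have "measure lborel (cball x1 \<delta>) = (LINT x|lborel. ?f x)" by simp
  also have "\<dots> = norm (cross3 b c) * (LINT z|lborel. LINT \<tau>|lborel. ?f (a + fst z *\<^sub>R b + snd z *\<^sub>R c + \<tau> *\<^sub>R n))"
    by (rule integral_slab_coordinates(1)[OF f n bc])
  also have "\<dots> \<le> norm (cross3 b c) * (LINT z|lborel. 2 * \<delta> * indicator S z)"
    using integral_slab_coordinates(2)[OF f n bc, of a] Si le
    by (intro mult_left_mono integral_mono) auto
  also have "\<dots> = norm (cross3 b c) * (2 * \<delta> * measure lborel S)" using S by simp
  finally show ?thesis .
qed

section \<open>Tetrahedral meshes\<close>

text \<open>From a boundary point a small step along \<open>e\<close> leads strictly above the
  graph, where a whole neighbourhood misses \<open>\<Omega>\<close>. Slits are thereby excluded, and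
  open sets covered by the closed elements lie in \<open>\<Omega>\<close>.\<close>

lemma interior_closure_lipschitz:
  assumes "open \<Omega>" "lipschitz_boundary \<Omega>"
  shows "interior (closure \<Omega>) \<subseteq> \<Omega>"
proof
  fix x assume x: "x \<in> interior (closure \<Omega>)"
  show "x \<in> \<Omega>"
  proof (rule ccontr)
    assume "x \<notin> \<Omega>"
    then have "x \<in> frontier \<Omega>"
      using x assms(1) interior_subset by (auto simp: frontier_def interior_open)
    then obtain r e g L where r: "r > 0" "norm e = 1" "L-lipschitz_on UNIV (g :: real^3 \<Rightarrow> real)"
      and g: "\<And>y. y \<in> ball x r \<Longrightarrow> y \<in> \<Omega> \<longleftrightarrow> y \<bullet> e < g (y - (y \<bullet> e) *\<^sub>R e)"
      using assms(2) unfolding lipschitz_boundary_def by blast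
    have ee: "e \<bullet> e = 1" using r(2) by (simp add: power2_norm_eq_inner[symmetric])
    have cg: "continuous_on UNIV g" using r(3) lipschitz_on_continuous_on by blast
    obtain s where s: "s > 0" "ball x s \<subseteq> closure \<Omega>" using x by (meson mem_interior)
    define t where "t = min r s / 2"
    have t: "0 < t" "t < r" "t < s" using r(1) s(1) by (auto simp: t_def min_def)
    let ?z = "x + t *\<^sub>R e"
    let ?U = "ball x r \<inter> {y. g (y - (y \<bullet> e) *\<^sub>R e) < y \<bullet> e}"
    have "open ?U"
      by (intro open_Int open_ball open_Collect_less continuous_intros continuous_on_compose2[OF cg]) auto
    moreover have "?z \<in> ?U"
    proof -
      have "g (x - (x \<bullet> e) *\<^sub>R e) \<le> x \<bullet> e" using g[of x] \<open>x \<notin> \<Omega>\<close> r(1) by auto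
      moreover have "?z - (?z \<bullet> e) *\<^sub>R e = x - (x \<bullet> e) *\<^sub>R e" by (simp add: inner_add_left ee algebra_simps)
      moreover have "?z \<bullet> e = x \<bullet> e + t" by (simp add: inner_add_left ee)
      ultimately have "?z \<in> {y. g (y - (y \<bullet> e) *\<^sub>R e) < y \<bullet> e}"
        unfolding mem_Collect_eq using t(1) by (metis less_add_same_cancel1 order_le_less_trans)
      then show ?thesis using t r(2) by (simp add: dist_norm)
    qed
    moreover have "?U \<inter> \<Omega> = {}" using g by force
    ultimately have "?z \<notin> closure \<Omega>" by (meson open_Int_closure_eq_empty disjoint_iff)
    moreover have "?z \<in> ball x s" using t r(2) by (simp add: dist_norm)
    ultimately show False using s(2) by blast
  qed
qed

text \<open>Along the diameter in the direction of \<open>G\<close> the affine function varies by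
  \<open>2 * r * norm G\<close>. This is how the radius of an inscribed ball controls barycentric
  coordinates.\<close>

lemma gradient_bound_of_ball:
  fixes G x0 :: "'a::real_inner"
  assumes "0 < r" "\<And>x. x \<in> cball x0 r \<Longrightarrow> 0 \<le> G \<bullet> x + \<alpha> \<and> G \<bullet> x + \<alpha> \<le> 1"
  shows "2 * r * norm G \<le> 1"
proof (cases "G = 0")
  case False
  let ?u = "(r / norm G) *\<^sub>R G"
  have "norm ?u = r" using False assms(1) by simp
  then have "x0 + ?u \<in> cball x0 r" "x0 - ?u \<in> cball x0 r" by (auto simp: dist_norm)
  then have "G \<bullet> (x0 + ?u) - G \<bullet> (x0 - ?u) \<le> 1" using assms(2) by smt
  moreover have "G \<bullet> ?u = r * norm G" using False by (simp add: power2_norm_eq_inner[symmetric] power2_eq_square)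
  ultimately show ?thesis by (simp add: inner_add_right inner_diff_right)
qed simp

text \<open>\<open>G1\<close>, \<open>G2\<close>, \<open>G3\<close> are the gradients of the
  barycentric coordinates of \<open>b\<close>, \<open>c\<close>, \<open>d\<close>, and the negative
  of their sum is that of \<open>a\<close>. They form the basis dual to the edges at
  \<open>a\<close>, hence cross products of edges over the triple product. The ball enters twice: it
  excludes a flat tetrahedron, and it bounds the gradients.\<close>

lemma tetra_coordinates:
  fixes a b c d x0 :: "real^3"
  assumes K: "K = convex hull {a, b, c, d}" and r: "0 < r" "cball x0 r \<subseteq> K"
  obtains G1 G2 G3 where
    "G1 \<bullet> (b - a) = 1" "G1 \<bullet> (c - a) = 0" "G1 \<bullet> (d - a) = 0"
    "G2 \<bullet> (b - a) = 0" "G2 \<bullet> (c - a) = 1" "G2 \<bullet> (d - a) = 0"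
    "G3 \<bullet> (b - a) = 0" "G3 \<bullet> (c - a) = 0" "G3 \<bullet> (d - a) = 1"
    "\<And>x. x - a = (G1 \<bullet> (x - a)) *\<^sub>R (b - a) + (G2 \<bullet> (x - a)) *\<^sub>R (c - a) + (G3 \<bullet> (x - a)) *\<^sub>R (d - a)"
    "2 * r * norm G1 \<le> 1" "2 * r * norm G2 \<le> 1" "2 * r * norm G3 \<le> 1" "2 * r * norm (G1 + G2 + G3) \<le> 1"
    "cross3 (b - a) (c - a) \<noteq> 0"
    "\<And>x. x \<in> K \<longleftrightarrow> 0 \<le> G1 \<bullet> (x - a) \<and> 0 \<le> G2 \<bullet> (x - a) \<and> 0 \<le> G3 \<bullet> (x - a) \<and> (G1 + G2 + G3) \<bullet> (x - a) \<le> 1"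
proof -
  define p q s where "p = b - a" and "q = c - a" and "s = d - a"
  define t where "t = p \<bullet> cross3 q s"
  \<comment> \<open>Otherwise some \<open>w\<close> is orthogonal to all three edges and the
    tetrahedron lies in a plane, which contains no ball.\<close>
  have "t \<noteq> 0"
  proof
    assume "t = 0"
    then have "det (vector [p, q, s]) = 0" by (simp add: t_def dot_cross_det)
    then have "\<not> invertible (vector [p, q, s] :: real^3^3)" by (simp add: invertible_det_nz)
    then obtain w where w: "(vector [p, q, s] :: real^3^3) *v w = 0" "w \<noteq> 0"
      unfolding invertible_left_inverse matrix_left_invertible_ker by blast
    have "p \<bullet> w = 0 \<and> q \<bullet> w = 0 \<and> s \<bullet> w = 0"
      using w(1) by (simp add: vec_eq_iff forall_3 matrix_vector_mul_component)
    then have "{a, b, c, d} \<subseteq> {x. w \<bullet> (x - a) = 0}" by (auto simp: p_def q_def s_def inner_commute)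
    moreover have "convex {x. w \<bullet> (x - a) = 0}"
      using convex_hyperplane[of w "w \<bullet> a"] by (simp add: inner_diff_right)
    ultimately have sub: "K \<subseteq> {x. w \<bullet> (x - a) = 0}" unfolding K by (rule hull_minimal)
    have "x0 \<in> K" "x0 + (r / norm w) *\<^sub>R w \<in> K"
      using r w(2) by (auto intro!: subsetD[OF r(2)] simp: dist_norm)
    then have "w \<bullet> (x0 - a) = 0" "w \<bullet> (x0 + (r / norm w) *\<^sub>R w - a) = 0" using sub by blast+
    then have "(r / norm w) * (w \<bullet> w) = 0" by (simp add: inner_add_right inner_diff_right)
    then show False using w(2) r(1) by simp
  qed
  define G1 G2 G3 where "G1 = (1 / t) *\<^sub>R cross3 q s" and "G2 = (1 / t) *\<^sub>R cross3 s p" and "G3 = (1 / t) *\<^sub>R cross3 p q"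
  have cyc: "q \<bullet> cross3 s p = t" "s \<bullet> cross3 p q = t"
    by (auto simp: t_def cross3_simps)
  have dual: "G1 \<bullet> p = 1" "G1 \<bullet> q = 0" "G1 \<bullet> s = 0" "G2 \<bullet> p = 0" "G2 \<bullet> q = 1" "G2 \<bullet> s = 0"
      "G3 \<bullet> p = 0" "G3 \<bullet> q = 0" "G3 \<bullet> s = 1"
    using \<open>t \<noteq> 0\<close> cyc by (auto simp: G1_def G2_def G3_def t_def inner_commute dot_cross_self)
  have rep: "x - a = (G1 \<bullet> (x - a)) *\<^sub>R p + (G2 \<bullet> (x - a)) *\<^sub>R q + (G3 \<bullet> (x - a)) *\<^sub>R s" for x
  proof -
    define z where "z = x - a"
    \<comment> \<open>Cramer's rule, here a polynomial identity in the components.\<close>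
    have "t *\<^sub>R z = (cross3 q s \<bullet> z) *\<^sub>R p + (cross3 s p \<bullet> z) *\<^sub>R q + (cross3 p q \<bullet> z) *\<^sub>R s"
      unfolding t_def by (simp add: vec_eq_iff forall_3 cross3_def inner_vec_def sum_3 algebra_simps)
    then have "(1 / t) *\<^sub>R (t *\<^sub>R z) = (1 / t) *\<^sub>R ((cross3 q s \<bullet> z) *\<^sub>R p + (cross3 s p \<bullet> z) *\<^sub>R q + (cross3 p q \<bullet> z) *\<^sub>R s)"
      by simp
    then have "z = (1 / t) *\<^sub>R ((cross3 q s \<bullet> z) *\<^sub>R p + (cross3 s p \<bullet> z) *\<^sub>R q + (cross3 p q \<bullet> z) *\<^sub>R s)"
      using \<open>t \<noteq> 0\<close> by simp
    then show ?thesis unfolding z_def[symmetric] G1_def G2_def G3_def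
      by (simp add: scaleR_add_right mult.commute)
  qed
  have mem: "x \<in> K \<longleftrightarrow> 0 \<le> G1 \<bullet> (x - a) \<and> 0 \<le> G2 \<bullet> (x - a) \<and> 0 \<le> G3 \<bullet> (x - a) \<and> (G1 + G2 + G3) \<bullet> (x - a) \<le> 1" for x
  proof
    let ?S = "{x. 0 \<le> G1 \<bullet> (x - a) \<and> 0 \<le> G2 \<bullet> (x - a) \<and> 0 \<le> G3 \<bullet> (x - a) \<and> (G1 + G2 + G3) \<bullet> (x - a) \<le> 1}"
    have "?S = {x. G1 \<bullet> x \<ge> G1 \<bullet> a} \<inter> {x. G2 \<bullet> x \<ge> G2 \<bullet> a} \<inter> {x. G3 \<bullet> x \<ge> G3 \<bullet> a} \<inter> {x. (G1 + G2 + G3) \<bullet> x \<le> 1 + (G1 + G2 + G3) \<bullet> a}"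
      by (auto simp: inner_diff_right algebra_simps)
    then have "convex ?S" by (auto intro!: convex_Int convex_halfspace_ge convex_halfspace_le)
    moreover have "{a, b, c, d} \<subseteq> ?S"
      using dual by (auto simp: p_def q_def s_def inner_add_left)
    ultimately have "K \<subseteq> ?S" unfolding K by (intro hull_minimal)
    then show "x \<in> K \<Longrightarrow> 0 \<le> G1 \<bullet> (x - a) \<and> 0 \<le> G2 \<bullet> (x - a) \<and> 0 \<le> G3 \<bullet> (x - a) \<and> (G1 + G2 + G3) \<bullet> (x - a) \<le> 1"
      by blast
    assume l: "0 \<le> G1 \<bullet> (x - a) \<and> 0 \<le> G2 \<bullet> (x - a) \<and> 0 \<le> G3 \<bullet> (x - a) \<and> (G1 + G2 + G3) \<bullet> (x - a) \<le> 1"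
    define l1 l2 l3 where "l1 = G1 \<bullet> (x - a)" and "l2 = G2 \<bullet> (x - a)" and "l3 = G3 \<bullet> (x - a)"
    have "x - a = l1 *\<^sub>R p + l2 *\<^sub>R q + l3 *\<^sub>R s"
      unfolding l1_def l2_def l3_def by (rule rep)
    then have "x = a + l1 *\<^sub>R p + l2 *\<^sub>R q + l3 *\<^sub>R s" by (simp add: algebra_simps)
    then have "x = (1 - l1 - l2 - l3) *\<^sub>R a + l1 *\<^sub>R b + l2 *\<^sub>R c + l3 *\<^sub>R d"
      by (simp add: p_def q_def s_def algebra_simps)
    moreover have "0 \<le> l1" "0 \<le> l2" "0 \<le> l3" "0 \<le> 1 - l1 - l2 - l3"
      using l by (auto simp: l1_def l2_def l3_def inner_add_left)
    moreover have "(\<Sum>i<4. [1 - l1 - l2 - l3, l1, l2, l3] ! i *\<^sub>R [a, b, c, d] ! i) \<in> convex hull {a, b, c, d}"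
      if "0 \<le> l1" "0 \<le> l2" "0 \<le> l3" "0 \<le> 1 - l1 - l2 - l3"
      by (rule convex_sum)
        (use that in \<open>auto simp: eval_nat_numeral less_Suc_eq convex_convex_hull intro: hull_inc\<close>)
    ultimately show "x \<in> K" unfolding K by (simp add: eval_nat_numeral add.assoc)
  qed
  have le1: "G1 \<bullet> (x - a) \<le> 1 \<and> G2 \<bullet> (x - a) \<le> 1 \<and> G3 \<bullet> (x - a) \<le> 1 \<and> 0 \<le> (G1 + G2 + G3) \<bullet> (x - a)" if "x \<in> K" for x
    using mem[of x] that by (auto simp: inner_add_left)
  have grad: "2 * r * norm G \<le> 1" if "\<And>x. x \<in> K \<Longrightarrow> 0 \<le> G \<bullet> (x - a) \<and> G \<bullet> (x - a) \<le> 1" for G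
    using that r by (intro gradient_bound_of_ball[of r x0 G "- (G \<bullet> a)"]) (auto simp: inner_diff_right)
  have "cross3 p q \<noteq> 0" using cyc(2) \<open>t \<noteq> 0\<close> by auto
  note cross = this[unfolded p_def q_def]
  have "2 * r * norm G1 \<le> 1" "2 * r * norm G2 \<le> 1" "2 * r * norm G3 \<le> 1" "2 * r * norm (G1 + G2 + G3) \<le> 1"
    using mem le1 by (auto intro!: grad)
  note facts = this dual[unfolded p_def q_def s_def] cross mem rep[unfolded p_def q_def s_def]
  show ?thesis by (rule that[of G1 G2 G3]) (fact facts)+
qed

text \<open>The side of the face plane is the sign of one barycentric coordinate:
  \<open>n \<bullet> (x - a)\<close> equals \<open>G3 \<bullet> (x - a)\<close> times
  \<open>n \<bullet> (d - a)\<close>. The radius \<open>2 / 3 * r\<close> arises because the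
  coordinates of \<open>a\<close>, \<open>b\<close>, \<open>c\<close> are \<open>1 / 3\<close> at
  the barycentre of the face and change by at most \<open>1 / 3\<close> over that distance, so only
  the coordinate of \<open>d\<close> can become negative.\<close>

lemma tetra_near_face:
  fixes a b c d x0 n :: "real^3"
  assumes K: "K = convex hull {a, b, c, d}" and r: "0 < r" "cball x0 r \<subseteq> K"
    and n: "norm n = 1" "n \<bullet> (b - a) = 0" "n \<bullet> (c - a) = 0"
  shows "n \<bullet> (d - a) \<noteq> 0" "cross3 (b - a) (c - a) \<noteq> 0"
    and "\<And>x. x \<in> K \<Longrightarrow> 0 \<le> (n \<bullet> (x - a)) * (n \<bullet> (d - a))"
    and "\<And>x. dist ((1/3) *\<^sub>R (a + b + c)) x \<le> 2 / 3 * r \<Longrightarrow> 0 \<le> (n \<bullet> (x - a)) * (n \<bullet> (d - a)) \<Longrightarrow> x \<in> K"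
    and "\<And>x. x \<in> K \<Longrightarrow> n \<bullet> (x - a) = 0 \<Longrightarrow>
          \<exists>s t. x = a + s *\<^sub>R (b - a) + t *\<^sub>R (c - a) \<and> 0 \<le> s \<and> 0 \<le> t \<and> s + t \<le> 1"
    and "\<And>s t v. 0 < s \<Longrightarrow> 0 < t \<Longrightarrow> s + t < 1 \<Longrightarrow> 0 < (n \<bullet> v) * (n \<bullet> (d - a)) \<Longrightarrow>
          \<forall>\<^sub>F \<tau> in at_right 0. a + s *\<^sub>R (b - a) + t *\<^sub>R (c - a) + \<tau> *\<^sub>R v \<in> interior K"
    and "\<And>s t. a + s *\<^sub>R (b - a) + t *\<^sub>R (c - a) \<in> K \<Longrightarrow> 0 \<le> s \<and> 0 \<le> t \<and> s + t \<le> 1"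
proof -
  obtain G1 G2 G3 where
    dual: "G1 \<bullet> (b - a) = 1" "G1 \<bullet> (c - a) = 0" "G1 \<bullet> (d - a) = 0"
    "G2 \<bullet> (b - a) = 0" "G2 \<bullet> (c - a) = 1" "G2 \<bullet> (d - a) = 0"
    "G3 \<bullet> (b - a) = 0" "G3 \<bullet> (c - a) = 0" "G3 \<bullet> (d - a) = 1"
    and rep: "\<And>x. x - a = (G1 \<bullet> (x - a)) *\<^sub>R (b - a) + (G2 \<bullet> (x - a)) *\<^sub>R (c - a) + (G3 \<bullet> (x - a)) *\<^sub>R (d - a)"
    and gr: "2 * r * norm G1 \<le> 1" "2 * r * norm G2 \<le> 1" "2 * r * norm G3 \<le> 1" "2 * r * norm (G1 + G2 + G3) \<le> 1"
    and cr: "cross3 (b - a) (c - a) \<noteq> 0"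
    and mem: "\<And>x. x \<in> K \<longleftrightarrow> 0 \<le> G1 \<bullet> (x - a) \<and> 0 \<le> G2 \<bullet> (x - a) \<and> 0 \<le> G3 \<bullet> (x - a) \<and> (G1 + G2 + G3) \<bullet> (x - a) \<le> 1"
    by (rule tetra_coordinates[OF K r], rule that; assumption)
  define D where "D = n \<bullet> (d - a)"
  have nx: "n \<bullet> (x - a) = (G3 \<bullet> (x - a)) * D" for x
    by (subst rep[of x]) (simp add: inner_add_right n D_def)
  have D: "D \<noteq> 0"
  proof
    assume "D = 0"
    then have "n \<bullet> x = 0" for x using nx[of "x + a"] by simp
    then show False using n(1) by (metis inner_eq_zero_iff norm_zero zero_neq_one)
  qed
  then show "n \<bullet> (d - a) \<noteq> 0" by (simp add: D_def)
  show "cross3 (b - a) (c - a) \<noteq> 0" by (rule cr)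
  have sgn: "0 \<le> (n \<bullet> (x - a)) * (n \<bullet> (d - a)) \<longleftrightarrow> 0 \<le> G3 \<bullet> (x - a)" for x
    
  proof -
    have "(n \<bullet> (x - a)) * (n \<bullet> (d - a)) = (G3 \<bullet> (x - a)) * (D * D)" by (simp only: nx[of x] D_def mult.assoc)
    moreover have "0 < D * D" using D by (auto simp: zero_less_mult_iff)
    ultimately show ?thesis by (simp add: zero_le_mult_iff)
  qed
  show "0 \<le> (n \<bullet> (x - a)) * (n \<bullet> (d - a))" if "x \<in> K" for x
    using that sgn mem by blast
  show "x \<in> K" if x: "dist ((1/3) *\<^sub>R (a + b + c)) x \<le> 2 / 3 * r" "0 \<le> (n \<bullet> (x - a)) * (n \<bullet> (d - a))" for x
  proof -
    let ?y = "(1/3) *\<^sub>R (a + b + c)"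
    have ya: "?y - a = (1/3) *\<^sub>R (b - a) + (1/3) *\<^sub>R (c - a)"
      by (simp add: vec_eq_iff algebra_simps)
    have close: "\<bar>G \<bullet> (x - a) - G \<bullet> (?y - a)\<bar> \<le> 1 / 3" if "2 * r * norm G \<le> 1" for G
    proof -
      have "G \<bullet> (x - a) - G \<bullet> (?y - a) = G \<bullet> (x - ?y)" by (simp add: inner_diff_right)
      then have "\<bar>G \<bullet> (x - a) - G \<bullet> (?y - a)\<bar> \<le> norm G * norm (x - ?y)" using Cauchy_Schwarz_ineq2 by metis
      also have "\<dots> \<le> norm G * (2 / 3 * r)"
        using x(1) by (intro mult_left_mono) (auto simp: dist_norm norm_minus_commute)
      finally have "\<bar>G \<bullet> (x - a) - G \<bullet> (?y - a)\<bar> \<le> norm G * (2 / 3 * r)" .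
      moreover have "norm G * (2 / 3 * r) = (2 * r * norm G) / 3" by simp
      ultimately show ?thesis using that by linarith
    qed
    have "G1 \<bullet> (?y - a) = 1/3" "G2 \<bullet> (?y - a) = 1/3" "(G1 + G2 + G3) \<bullet> (?y - a) = 2/3"
      unfolding ya by (simp_all add: inner_add_right inner_add_left dual)
    then have "0 \<le> G1 \<bullet> (x - a)" "0 \<le> G2 \<bullet> (x - a)" "(G1 + G2 + G3) \<bullet> (x - a) \<le> 1"
      using close[OF gr(1)] close[OF gr(2)] close[OF gr(4)] by linarith+
    then show ?thesis unfolding mem using x(2) sgn by blast
  qed
  show "\<exists>s t. x = a + s *\<^sub>R (b - a) + t *\<^sub>R (c - a) \<and> 0 \<le> s \<and> 0 \<le> t \<and> s + t \<le> 1"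
    if x: "x \<in> K" "n \<bullet> (x - a) = 0" for x
  proof -
    have z: "G3 \<bullet> (x - a) = 0" using x(2) nx D by simp
    define l1 l2 where "l1 = G1 \<bullet> (x - a)" and "l2 = G2 \<bullet> (x - a)"
    have "x - a = l1 *\<^sub>R (b - a) + l2 *\<^sub>R (c - a)"
      unfolding l1_def l2_def using rep[of x] unfolding z by (simp only: scale_zero_left add_0_right)
    then have "x = a + l1 *\<^sub>R (b - a) + l2 *\<^sub>R (c - a)" by (simp add: algebra_simps)
    moreover have "0 \<le> l1" "0 \<le> l2" "l1 + l2 \<le> 1"
      using mem[of x] x(1) z unfolding l1_def l2_def inner_add_left by auto
    ultimately show ?thesis by blast
  qed
  show "\<forall>\<^sub>F \<tau> in at_right 0. a + s *\<^sub>R (b - a) + t *\<^sub>R (c - a) + \<tau> *\<^sub>R v \<in> interior K"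
    if st: "0 < s" "0 < t" "s + t < 1" and v: "0 < (n \<bullet> v) * (n \<bullet> (d - a))" for s t v
  proof -
    let ?x = "\<lambda>\<tau>. a + s *\<^sub>R (b - a) + t *\<^sub>R (c - a) + \<tau> *\<^sub>R v"
    let ?U = "{x. 0 < G1 \<bullet> (x - a)} \<inter> {x. 0 < G2 \<bullet> (x - a)} \<inter> {x. 0 < G3 \<bullet> (x - a)} \<inter> {x. (G1 + G2 + G3) \<bullet> (x - a) < 1}"
    have "open ?U" by (intro open_Int open_Collect_less continuous_intros)
    moreover have "?U \<subseteq> K" unfolding subset_iff mem by auto
    ultimately have U: "?U \<subseteq> interior K" by (rule interior_maximal[rotated])
    have e: "?x \<tau> - a = s *\<^sub>R (b - a) + t *\<^sub>R (c - a) + \<tau> *\<^sub>R v" for \<tau> by simp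
    have g: "G1 \<bullet> (?x \<tau> - a) = s + \<tau> * (G1 \<bullet> v)" "G2 \<bullet> (?x \<tau> - a) = t + \<tau> * (G2 \<bullet> v)"
      "G3 \<bullet> (?x \<tau> - a) = \<tau> * (G3 \<bullet> v)" "(G1 + G2 + G3) \<bullet> (?x \<tau> - a) = s + t + \<tau> * ((G1 + G2 + G3) \<bullet> v)" for \<tau>
      unfolding e inner_add_right inner_add_left inner_scaleR_right dual by (simp_all add: algebra_simps)
    have "n \<bullet> v = (G3 \<bullet> v) * D" using nx[of "v + a"] by simp
    then have "0 < (G3 \<bullet> v) * (D * D)" using v by (simp only: D_def mult.assoc)
    then have v3: "0 < G3 \<bullet> v" by (simp add: zero_less_mult_iff)
    have ev: "\<forall>\<^sub>F \<tau> in at_right 0. 0 < A + \<tau> * k" if "0 < A" for A k :: real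
    proof -
      have "((\<lambda>\<tau>. A + \<tau> * k) \<longlongrightarrow> A + 0 * k) (at_right 0)" by (intro tendsto_intros)
      then show ?thesis using that by (intro order_tendstoD(1)) auto
    qed
    have "\<forall>\<^sub>F \<tau> in at_right 0. 0 < s + \<tau> * (G1 \<bullet> v)" using st(1) by (rule ev)
    moreover have "\<forall>\<^sub>F \<tau> in at_right 0. 0 < t + \<tau> * (G2 \<bullet> v)" using st(2) by (rule ev)
    moreover have "\<forall>\<^sub>F \<tau> in at_right 0. 0 < (1 - s - t) + \<tau> * (- ((G1 + G2 + G3) \<bullet> v))" using st(3) by (intro ev) simp
    moreover have "\<forall>\<^sub>F \<tau> in at_right 0. (0::real) < \<tau>" by (simp add: eventually_at_right_less)
    ultimately show ?thesis
    proof eventually_elim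
      case (elim \<tau>)
      then have "?x \<tau> \<in> ?U" unfolding Int_iff mem_Collect_eq g using v3
        by (intro conjI) (auto simp: mult_pos_pos)
      then show ?case using U by blast
    qed
  qed
  show "0 \<le> s \<and> 0 \<le> t \<and> s + t \<le> 1" if "a + s *\<^sub>R (b - a) + t *\<^sub>R (c - a) \<in> K" for s t
  proof -
    have e: "a + s *\<^sub>R (b - a) + t *\<^sub>R (c - a) - a = s *\<^sub>R (b - a) + t *\<^sub>R (c - a)" by simp
    show ?thesis using that unfolding mem e by (simp add: inner_add_right inner_add_left dual)
  qed
qed

section \<open>Facets, conforming neighbours and inscribed balls\<close>

lemma facet_of_3_simplex:
  assumes "3 simplex K" "F facet_of K"
  obtains V d where "F = convex hull V" "card V = 3" "finite V" "K = convex hull (insert d V)" "aff_dim K = 3" "aff_dim F = 2"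
proof -
  obtain S where S: "\<not> affine_dependent S" "int (card S) = 3 + 1" "K = convex hull S"
    using assms(1) by (auto simp: simplex_def)
  have finS: "finite S" using S(2) by (intro card_ge_0_finite) linarith
  have aK: "aff_dim K = 3" using assms(1) aff_dim_simplex by blast
  have aF: "aff_dim F = 2" using assms(2) aK by (simp add: facet_of_def)
  have "F face_of convex hull S" using assms(2) S(3) by (simp add: facet_of_def)
  then obtain V where V: "V \<subseteq> S" "F = convex hull V" using face_of_convex_hull_affine_independent[OF S(1)] by blast
  have "\<not> affine_dependent V" using S(1) V(1) affine_dependent_subset by blast
  then have "int (card V) = 3" using aff_dim_affine_independent[of V] aF V(2) by (simp add: aff_dim_convex_hull)
  then have cV: "card V = 3" by simp
  then have "card (S - V) = 1" using S(2) V(1) finS by (simp add: card_Diff_subset finite_subset)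
  then obtain d where "S - V = {d}" by (rule card_1_singletonE)
  then have "S = insert d V" using V(1) by blast
  then show ?thesis using that V(2) cV S(3) aK aF finS V(1) finite_subset by blast
qed

text \<open>The points \<open>a\<close>, \<open>b\<close>, \<open>c\<close> may come from an
  arbitrary choice. The hull of a set with one more point depends only on the hull of that set, so
  they can replace the vertices inherited from the simplex.\<close>

lemma facet_of_3_simplex_vertices:
  assumes "3 simplex K" "F facet_of K" "F = convex hull {a, b, c}"
  obtains d where "K = convex hull {a, b, c, d}"
proof -
  obtain V d where "F = convex hull V" "K = convex hull (insert d V)" using facet_of_3_simplex[OF assms(1,2)] .
  then have "K = convex hull (insert d {a, b, c})" using assms(3) by (metis hull_insert)
  then show ?thesis using that[of d] by (simp add: insert_commute)
qed

text \<open>The intersection of two distinct elements is a proper face and has dimension at most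
  two. It has \<open>F\<close> as a face, already of dimension two, so the two coincide.\<close>

lemma shared_facet:
  assumes T: "triangulation T" and K: "K1 \<in> T" "K2 \<in> T" "K1 \<noteq> K2" and s: "3 simplex K1" "3 simplex K2"
    and F: "F facet_of K1" "F \<subseteq> K2"
  shows "F facet_of K2"
proof -
  have d: "aff_dim K1 = 3" "aff_dim K2 = 3" using s aff_dim_simplex by blast+
  have cv: "convex K1" "convex K2" using s convex_simplex by blast+
  have f: "(K1 \<inter> K2) face_of K1" "(K1 \<inter> K2) face_of K2"
    using T K unfolding triangulation_def by (metis Int_commute)+
  have "K1 \<inter> K2 \<noteq> K1"
  proof
    assume e: "K1 \<inter> K2 = K1"
    then have "K1 face_of K2" using f(2) by simp
    then show False using face_of_aff_dim_lt[OF cv(2), of K1] K(3) d by simp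
  qed
  then have "aff_dim (K1 \<inter> K2) < 3" using face_of_aff_dim_lt[OF cv(1) f(1)] d by simp
  moreover have aF: "aff_dim F = 2" using F(1) d by (simp add: facet_of_def)
  moreover have "F face_of (K1 \<inter> K2)"
    using F face_of_subset[of F K1 "K1 \<inter> K2"] by (auto simp: facet_of_def dest: face_of_imp_subset)
  ultimately have "F = K1 \<inter> K2"
    using face_of_aff_dim_lt[of "K1 \<inter> K2" F] cv by (auto simp: convex_Int)
  then show ?thesis using f(2) aF d F(1) by (simp add: facet_of_def)
qed

text \<open>Points just beyond a relative interior point \<open>y\<close> of \<open>F\<close> lie in
  \<open>\<Omega>\<close>, hence in elements. As there are finitely many of these, and they are
  closed, one of them contains \<open>y\<close> together with points beyond the plane. Its
  intersection with \<open>K1\<close> is a face of \<open>K1\<close> that meets the relative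
  interior of \<open>F\<close> and so contains \<open>F\<close>.\<close>

lemma opposite_element:
  assumes mesh: "tetrahedral_mesh \<Omega> T" and op: "open \<Omega>"
    and F: "F facet_of K1" "K1 \<in> T" "rel_interior F \<subseteq> \<Omega>"
    and a: "a \<in> F" "\<And>x. x \<in> F \<Longrightarrow> n \<bullet> (x - a) = 0" and n: "n \<noteq> 0"
    and side: "\<And>x. x \<in> K1 \<Longrightarrow> n \<bullet> (x - a) \<le> 0"
  obtains K2 where "K2 \<in> T" "F facet_of K2" "\<exists>x\<in>K2. 0 < n \<bullet> (x - a)"
proof -
  have tri: "triangulation T" and s: "\<And>K. K \<in> T \<Longrightarrow> 3 simplex K" and un: "\<Union>T = closure \<Omega>"
    using mesh by (auto simp: tetrahedral_mesh_def)
  have "convex F" using F(1) s[OF F(2)] face_of_imp_convex convex_simplex unfolding facet_of_def by blast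
  then have "rel_interior F \<noteq> {}" using a(1) rel_interior_eq_empty by blast
  then obtain y where y: "y \<in> rel_interior F" by blast
  have yF: "y \<in> F" using y rel_interior_subset by blast
  have fin: "finite T" using tri by (simp add: triangulation_def)
  let ?P = "{x. 0 < n \<bullet> (x - a)}"
  have "y \<in> closure (\<Union>((\<lambda>K. K \<inter> ?P) ` T))"
  proof -
    obtain e where e: "e > 0" "ball y e \<subseteq> \<Omega>" using op F(3) y by (meson open_contains_ball subsetD)
    show ?thesis unfolding closure_approachable
    proof (intro allI impI)
      fix \<epsilon> :: real assume \<epsilon>: "\<epsilon> > 0"
      define \<delta> where "\<delta> = min e \<epsilon> / 2"
      have \<delta>: "0 < \<delta>" "\<delta> < e" "\<delta> < \<epsilon>" using e(1) \<epsilon> by (auto simp: \<delta>_def min_def)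
      let ?x = "y + (\<delta> / norm n) *\<^sub>R n"
      have d: "dist ?x y = \<delta>" using \<delta> n by (simp add: dist_norm)
      have "?x \<in> \<Omega>" using d \<delta> e(2) by (auto simp: dist_commute)
      then obtain K where K: "K \<in> T" "?x \<in> K" using un closure_subset by blast
      have "n \<bullet> (?x - a) = n \<bullet> (y - a) + (\<delta> / norm n) * (n \<bullet> n)" by (simp add: inner_add_right inner_diff_right)
      then have "0 < n \<bullet> (?x - a)" using a(2)[OF yF] \<delta> n by simp
      then show "\<exists>x\<in>\<Union>((\<lambda>K. K \<inter> ?P) ` T). dist x y < \<epsilon>" using K d \<delta> by (intro bexI[of _ ?x]) auto
    qed
  qed
  moreover have "closure (\<Union>((\<lambda>K. K \<inter> ?P) ` T)) \<subseteq> (\<Union>K\<in>T. closure (K \<inter> ?P))"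
  proof (rule closure_minimal)
    show "\<Union>((\<lambda>K. K \<inter> ?P) ` T) \<subseteq> (\<Union>K\<in>T. closure (K \<inter> ?P))"
      by (rule UN_mono[OF subset_refl closure_subset])
    show "closed (\<Union>K\<in>T. closure (K \<inter> ?P))" by (intro closed_UN fin ballI closed_closure)
  qed
  ultimately have "y \<in> (\<Union>K\<in>T. closure (K \<inter> ?P))" by (rule rev_subsetD)
  then obtain K2 where K2: "K2 \<in> T" "y \<in> closure (K2 \<inter> ?P)" by auto
  have "closed K2" using s[OF K2(1)] closed_simplex by blast
  then have "closure (K2 \<inter> ?P) \<subseteq> K2" by (intro closure_minimal) auto
  then have "y \<in> K2" using K2(2) by (rule subsetD)
  have "K2 \<inter> ?P \<noteq> {}" using K2(2) by (metis closure_empty empty_iff)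
  then have ex: "\<exists>x\<in>K2. 0 < n \<bullet> (x - a)" by blast
  have ne: "K1 \<noteq> K2" using ex side by force
  have "(K1 \<inter> K2) face_of K1" using tri F(2) K2(1) by (auto simp: triangulation_def)
  moreover have "F \<subseteq> K1" using F(1) by (simp add: facet_of_imp_subset)
  ultimately have "F \<subseteq> K1 \<inter> K2"
    using subset_of_face_of[of "K1 \<inter> K2" K1 F] y yF \<open>y \<in> K2\<close> by blast
  then have "F facet_of K2" using shared_facet[OF tri F(2) K2(1) ne s[OF F(2)] s[OF K2(1)] F(1)] by simp
  then show ?thesis using that K2(1) ex by blast
qed

text \<open>All \<open>2 ^ 4\<close> subsets of the vertices are counted; any absolute bound will do
  for the sum over faces.\<close>

lemma facets_card_le:
  assumes "3 simplex K"
  shows "finite {F. F facet_of K}" "card {F. F facet_of K} \<le> 16"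
proof -
  obtain S where S: "\<not> affine_dependent S" "int (card S) = 3 + 1" "K = convex hull S"
    using assms by (auto simp: simplex_def)
  have finS: "finite S" using S(2) by (intro card_ge_0_finite) linarith
  have sub: "{F. F facet_of K} \<subseteq> (\<lambda>V. convex hull V) ` Pow S"
    unfolding facet_of_def S(3) using face_of_convex_hull_affine_independent[OF S(1)] by blast
  then show "finite {F. F facet_of K}" using finS finite_subset by blast
  have "card {F. F facet_of K} \<le> card ((\<lambda>V. convex hull V) ` Pow S)" using sub finS by (intro card_mono) auto
  also have "\<dots> \<le> card (Pow S)" using finS by (intro card_image_le) auto
  also have "\<dots> = 16" using S(2) finS by (simp add: card_Pow)
  finally show "card {F. F facet_of K} \<le> 16" .
qed

text \<open>Whether the supremum in \<open>inball_diameter\<close> is attained is left open: as it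
  is positive, some ball has more than half that diameter. This loss turns
  \<open>2 * \<kappa>\<close> into \<open>4 * \<kappa>\<close>.\<close>

lemma inball_exists:
  assumes K: "3 simplex K" and \<kappa>: "0 < \<kappa>" "diameter K \<le> \<kappa> * inball_diameter K"
  obtains x0 r where "0 < r" "cball x0 r \<subseteq> K" "diameter K \<le> 4 * \<kappa> * r"
proof -
  let ?S = "{2 * r | x r. 0 \<le> r \<and> cball x r \<subseteq> K}"
  have cK: "compact K" using K compact_simplex by blast
  then have bK: "bounded K" by (rule compact_imp_bounded)
  have aK: "aff_dim K = 3" using K aff_dim_simplex by blast
  have "K \<noteq> {}" using aK by auto
  then obtain x where "x \<in> K" by blast
  moreover have "K \<noteq> {x}" using aK by auto
  ultimately obtain y where xy: "x \<in> K" "y \<in> K" "x \<noteq> y" by blast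
  then have "dist x y \<le> diameter K" using diameter_bounded_bound[OF bK] by blast
  then have dK: "0 < diameter K" using xy(3) by (meson less_le_trans zero_less_dist_iff)
  have ne: "2 * 0 \<in> ?S" using xy(1) by (intro CollectI exI[of _ x] exI[of _ 0]) auto
  have "0 < inball_diameter K" using dK \<kappa> by (metis less_le_trans zero_less_mult_pos)
  then have "inball_diameter K / 2 < Sup ?S" unfolding inball_diameter_def by simp
  then obtain z where z: "z \<in> ?S" "inball_diameter K / 2 < z" using less_cSupE[of _ ?S] ne by blast
  then obtain x0 r where r: "z = 2 * r" "cball x0 r \<subseteq> K" by blast
  have "0 < r" using z(2) r(1) \<open>0 < inball_diameter K\<close> by simp
  have "\<kappa> * inball_diameter K \<le> \<kappa> * (4 * r)" using z(2) r(1) \<kappa> by (intro mult_left_mono) auto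
  then have "diameter K \<le> 4 * \<kappa> * r" using \<kappa>(2) by simp
  with \<open>0 < r\<close> r(2) show ?thesis by (rule that)
qed

section \<open>Square-integrable functions\<close>

text \<open>Extension by zero puts functions on different domains into one measure space, where they
  can be compared almost everywhere.\<close>

lemma L2_iff_UNIV:
  fixes f :: "real^3 \<Rightarrow> 'b::euclidean_space"
  assumes "S \<in> sets lebesgue"
  shows "f \<in> L2 S \<longleftrightarrow> (\<lambda>x. indicator S x *\<^sub>R f x) \<in> L2 UNIV"
    and "L2norm S f = L2norm UNIV (\<lambda>x. indicator S x *\<^sub>R f x)"
proof -
  have e: "(norm (indicator S x *\<^sub>R f x))\<^sup>2 = indicator S x *\<^sub>R (norm (f x))\<^sup>2" for x
    by (simp add: indicator_def)
  show "f \<in> L2 S \<longleftrightarrow> (\<lambda>x. indicator S x *\<^sub>R f x) \<in> L2 UNIV"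
    using assms unfolding L2_def mem_Collect_eq lebesgue_on_UNIV_eq e
    by (simp add: borel_measurable_restrict_space_iff integrable_restrict_space)
  show "L2norm S f = L2norm UNIV (\<lambda>x. indicator S x *\<^sub>R f x)"
    using assms unfolding L2norm_def lebesgue_on_UNIV_eq e
    by (simp add: integral_restrict_space)
qed

lemma L2_UNIV_iff: "f \<in> L2 UNIV \<longleftrightarrow> f \<in> borel_measurable lebesgue \<and> integrable lebesgue (\<lambda>x. (norm (f x))\<^sup>2)"
  by (simp add: L2_def lebesgue_on_UNIV_eq)

lemma L2_UNIV_AE_cong:
  fixes f g :: "real^3 \<Rightarrow> 'b::euclidean_space"
  assumes f: "f \<in> L2 UNIV" and ae: "AE x in lebesgue. f x = g x"
  shows "g \<in> L2 UNIV" "L2norm UNIV g = L2norm UNIV f"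
proof -
  have fm: "f \<in> borel_measurable lebesgue" using f by (simp add: L2_UNIV_iff)
  then have gm: "g \<in> borel_measurable lebesgue" using ae borel_measurable_AE by blast
  have ae': "AE x in lebesgue. (norm (f x))\<^sup>2 = (norm (g x))\<^sup>2" using ae by eventually_elim simp
  show "g \<in> L2 UNIV"
    using f gm integrable_cong_AE_imp[OF _ _ ae'] by (simp add: L2_UNIV_iff)
  have "(LINT x|lebesgue. (norm (f x))\<^sup>2) = (LINT x|lebesgue. (norm (g x))\<^sup>2)"
    using fm gm ae' by (intro integral_cong_AE) auto
  then show "L2norm UNIV g = L2norm UNIV f" by (simp add: L2norm_def lebesgue_on_UNIV_eq)
qed

text \<open>Functions and domains may both change on a null set. This covers closed elements against
  the open domain, and finite element functions against polynomials with which they agree only in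
  the interior of an element.\<close>

lemma L2_cong_negligible:
  fixes f g :: "real^3 \<Rightarrow> 'b::euclidean_space"
  assumes f: "f \<in> L2 S" and S: "S \<in> sets lebesgue" "S' \<in> sets lebesgue"
    and N: "negligible N" "S' - N \<subseteq> S" "S - N \<subseteq> S'" "\<And>x. x \<in> S' \<Longrightarrow> x \<notin> N \<Longrightarrow> g x = f x"
  shows "g \<in> L2 S'" "L2norm S' g = L2norm S f"
proof -
  have "AE x in lebesgue. x \<notin> N" using N(1) by (simp add: AE_not_in negligible_iff_null_sets)
  then have ae: "AE x in lebesgue. indicator S x *\<^sub>R f x = indicator S' x *\<^sub>R g x"
    by eventually_elim (use N in \<open>auto simp: indicator_def\<close>)
  have f': "(\<lambda>x. indicator S x *\<^sub>R f x) \<in> L2 UNIV" using f L2_iff_UNIV(1)[OF S(1)] by blast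
  show "g \<in> L2 S'" "L2norm S' g = L2norm S f"
    using L2_UNIV_AE_cong[OF f' ae] L2_iff_UNIV[OF S(2), of g] L2_iff_UNIV(2)[OF S(1), of f] by auto
qed

lemma L2_subset:
  fixes f :: "real^3 \<Rightarrow> 'b::euclidean_space"
  assumes f: "f \<in> L2 S" and S: "S \<in> sets lebesgue" "S' \<in> sets lebesgue" "S' \<subseteq> S"
  shows "f \<in> L2 S'" "L2norm S' f \<le> L2norm S f"
proof -
  have f': "(\<lambda>x. indicator S x *\<^sub>R f x) \<in> L2 UNIV" using f L2_iff_UNIV(1)[OF S(1)] by blast
  have m: "(\<lambda>x. indicator S' x *\<^sub>R f x) \<in> borel_measurable lebesgue"
  proof -
    have "(\<lambda>x. indicator S' x *\<^sub>R (indicator S x *\<^sub>R f x)) \<in> borel_measurable lebesgue"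
      using f' unfolding L2_UNIV_iff by (intro borel_measurable_scaleR[OF borel_measurable_indicator[OF S(2)]]) simp
    moreover have "(\<lambda>x. indicator S' x *\<^sub>R (indicator S x *\<^sub>R f x)) = (\<lambda>x. indicator S' x *\<^sub>R f x)"
      using S(3) by (auto simp: indicator_def fun_eq_iff)
    ultimately show ?thesis by simp
  qed
  have le: "(norm (indicator S' x *\<^sub>R f x))\<^sup>2 \<le> (norm (indicator S x *\<^sub>R f x))\<^sup>2" for x
    using S(3) by (auto simp: indicator_def)
  have i: "integrable lebesgue (\<lambda>x. (norm (indicator S x *\<^sub>R f x))\<^sup>2)" using f' by (simp add: L2_UNIV_iff)
  have i': "integrable lebesgue (\<lambda>x. (norm (indicator S' x *\<^sub>R f x))\<^sup>2)"
  proof (rule Bochner_Integration.integrable_bound[OF i])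
    show "(\<lambda>x. (norm (indicator S' x *\<^sub>R f x))\<^sup>2) \<in> borel_measurable lebesgue"
      by (intro borel_measurable_power measurable_compose[OF m borel_measurable_norm])
    show "AE x in lebesgue. norm ((norm (indicator S' x *\<^sub>R f x))\<^sup>2) \<le> norm ((norm (indicator S x *\<^sub>R f x))\<^sup>2)"
      using le by (intro AE_I2) (simp del: norm_scaleR)
  qed
  then show "f \<in> L2 S'" using m L2_iff_UNIV(1)[OF S(2), of f] by (simp add: L2_UNIV_iff)
  show "L2norm S' f \<le> L2norm S f"
    unfolding L2_iff_UNIV(2)[OF S(1), of f] L2_iff_UNIV(2)[OF S(2), of f] unfolding L2norm_def lebesgue_on_UNIV_eq
    using i i' le by (intro real_sqrt_le_mono integral_mono) auto
qed

lemma L2norm_nonneg: "0 \<le> L2norm S f"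
  by (simp add: L2norm_def)

lemma L2_diff:
  fixes f g :: "real^3 \<Rightarrow> 'b::euclidean_space"
  assumes "f \<in> L2 S" "g \<in> L2 S"
  shows "(\<lambda>x. f x - g x) \<in> L2 S"
proof -
  have m: "f \<in> borel_measurable (lebesgue_on S)" "g \<in> borel_measurable (lebesgue_on S)"
    and i: "integrable (lebesgue_on S) (\<lambda>x. (norm (f x))\<^sup>2)" "integrable (lebesgue_on S) (\<lambda>x. (norm (g x))\<^sup>2)"
    using assms by (auto simp: L2_def)
  have le: "(norm (a - b))\<^sup>2 \<le> 2 * (norm a)\<^sup>2 + 2 * (norm b)\<^sup>2" for a b :: 'b
  proof -
    have "(norm (a - b))\<^sup>2 \<le> (norm a + norm b)\<^sup>2" by (intro power_mono norm_triangle_ineq4) simp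
    also have "\<dots> \<le> 2 * (norm a)\<^sup>2 + 2 * (norm b)\<^sup>2" using sum_squares_bound[of "norm a" "norm b"] by (simp add: power2_sum)
    finally show ?thesis .
  qed
  have "integrable (lebesgue_on S) (\<lambda>x. 2 * (norm (f x))\<^sup>2 + 2 * (norm (g x))\<^sup>2)" using i by simp
  then have "integrable (lebesgue_on S) (\<lambda>x. (norm (f x - g x))\<^sup>2)"
    by (rule Bochner_Integration.integrable_bound) (use m le in auto)
  then show ?thesis using m by (simp add: L2_def)
qed

lemma borel_measurable_lebesgue_on:
  fixes f :: "real^3 \<Rightarrow> 'b::euclidean_space"
  assumes "f \<in> borel_measurable borel"
  shows "f \<in> borel_measurable (lebesgue_on S)"
  using assms by (intro measurable_restrict_space1 measurable_completion) simp

lemma L2_bounded: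
  fixes f :: "real^3 \<Rightarrow> 'b::euclidean_space"
  assumes f: "f \<in> borel_measurable borel" and S: "S \<in> lmeasurable" and le: "\<And>x. x \<in> S \<Longrightarrow> norm (f x) \<le> c"
  shows "f \<in> L2 S" "L2norm S f \<le> \<bar>c\<bar> * sqrt (measure lebesgue S)"
proof -
  have ci: "integrable (lebesgue_on S) (\<lambda>x. c\<^sup>2)"
    using finite_measure_lebesgue_on[OF S] by (rule finite_measure.integrable_const)
  have m: "f \<in> borel_measurable (lebesgue_on S)" using f by (rule borel_measurable_lebesgue_on)
  have le2: "(norm (f x))\<^sup>2 \<le> c\<^sup>2" if "x \<in> S" for x using le[OF that] by (intro power_mono) auto
  have i: "integrable (lebesgue_on S) (\<lambda>x. (norm (f x))\<^sup>2)"
    by (rule Bochner_Integration.integrable_bound[OF ci]) (use m le2 in \<open>auto simp: AE_restrict_space_iff intro!: AE_I2\<close>)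
  then show "f \<in> L2 S" using m by (simp add: L2_def)
  have "(LINT x|lebesgue_on S. (norm (f x))\<^sup>2) \<le> (LINT x|lebesgue_on S. c\<^sup>2)"
    using i ci le2 by (intro integral_mono) auto
  also have "\<dots> = c\<^sup>2 * measure lebesgue S"
    using S by (simp add: measure_restrict_space fmeasurableD mult.commute)
  finally have "L2norm S f \<le> sqrt (c\<^sup>2 * measure lebesgue S)"
    unfolding L2norm_def by (rule real_sqrt_le_mono)
  then show "L2norm S f \<le> \<bar>c\<bar> * sqrt (measure lebesgue S)" by (simp add: real_sqrt_mult)
qed

text \<open>The optimal parameter would be \<open>sqrt B / sqrt A\<close>. Adding
  \<open>\<epsilon>\<close> to both numbers keeps it defined and positive when one of them
  vanishes.\<close>

lemma le_sqrt_mult_of_AM_GM: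
  fixes x A B :: real
  assumes "0 \<le> A" "0 \<le> B" "\<And>\<mu>. 0 < \<mu> \<Longrightarrow> 2 * x \<le> \<mu> * A + B / \<mu>"
  shows "x \<le> sqrt A * sqrt B"
proof -
  have "x \<le> sqrt (A + \<epsilon>) * sqrt (B + \<epsilon>)" if "\<epsilon> > 0" for \<epsilon>
  proof -
    define \<mu> where "\<mu> = sqrt (B + \<epsilon>) / sqrt (A + \<epsilon>)"
    have p: "sqrt (A + \<epsilon>) > 0" "sqrt (B + \<epsilon>) > 0" using assms(1,2) that by auto
    have "2 * x \<le> \<mu> * A + B / \<mu>" using p by (intro assms) (simp add: \<mu>_def)
    also have "\<dots> \<le> \<mu> * (sqrt (A + \<epsilon>))\<^sup>2 + (sqrt (B + \<epsilon>))\<^sup>2 / \<mu>"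
      using assms(1,2) that p by (intro add_mono mult_left_mono divide_right_mono) (auto simp: \<mu>_def)
    also have "\<dots> = 2 * (sqrt (A + \<epsilon>) * sqrt (B + \<epsilon>))"
      using p unfolding \<mu>_def by (simp add: power2_eq_square field_simps)
    finally show ?thesis by simp
  qed
  then have "eventually (\<lambda>\<epsilon>. x \<le> sqrt (A + \<epsilon>) * sqrt (B + \<epsilon>)) (at_right 0)"
    by (simp add: eventually_at_filter)
  moreover have "((\<lambda>\<epsilon>. sqrt (A + \<epsilon>) * sqrt (B + \<epsilon>)) \<longlongrightarrow> sqrt (A + 0) * sqrt (B + 0)) (at_right 0)"
    by (intro tendsto_intros)
  ultimately show ?thesis
    using tendsto_lowerbound[of _ "sqrt A * sqrt B" "at_right (0::real)" x] by simp
qed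

text \<open>Young's inequality with a parameter is integrated pointwise and optimised afterwards;
  the parameter value one also gives integrability.\<close>

lemma L2_Cauchy_Schwarz:
  fixes f g :: "real^3 \<Rightarrow> 'b::euclidean_space"
  assumes f: "f \<in> L2 S" and g: "g \<in> L2 S"
  shows "integrable (lebesgue_on S) (\<lambda>x. f x \<bullet> g x)"
    and "\<bar>LINT x|lebesgue_on S. f x \<bullet> g x\<bar> \<le> L2norm S f * L2norm S g"
proof -
  have m: "f \<in> borel_measurable (lebesgue_on S)" "g \<in> borel_measurable (lebesgue_on S)"
    and i: "integrable (lebesgue_on S) (\<lambda>x. (norm (f x))\<^sup>2)" "integrable (lebesgue_on S) (\<lambda>x. (norm (g x))\<^sup>2)"
    using assms by (auto simp: L2_def)
  have le: "2 * \<bar>a \<bullet> b\<bar> \<le> \<mu> * (norm a)\<^sup>2 + (norm b)\<^sup>2 / \<mu>" if "\<mu> > 0" for a b :: 'b and \<mu> :: real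
  proof -
    have "2 * (sqrt \<mu> * norm a) * (norm b / sqrt \<mu>) \<le> (sqrt \<mu> * norm a)\<^sup>2 + (norm b / sqrt \<mu>)\<^sup>2"
      by (rule sum_squares_bound)
    then have "2 * (norm a * norm b) \<le> \<mu> * (norm a)\<^sup>2 + (norm b)\<^sup>2 / \<mu>"
      using that by (simp add: power_mult_distrib power_divide)
    then show ?thesis using Cauchy_Schwarz_ineq2[of a b] by linarith
  qed
  have "integrable (lebesgue_on S) (\<lambda>x. 1 * (norm (f x))\<^sup>2 + (norm (g x))\<^sup>2 / 1)" using i by simp
  then show int: "integrable (lebesgue_on S) (\<lambda>x. f x \<bullet> g x)"
  proof (rule Bochner_Integration.integrable_bound)
    show "AE x in lebesgue_on S. norm (f x \<bullet> g x) \<le> norm (1 * (norm (f x))\<^sup>2 + (norm (g x))\<^sup>2 / 1)"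
      using le[of 1] by (intro AE_I2) (smt (verit) abs_ge_zero real_norm_def zero_less_one)
  qed (use m in auto)
  show "\<bar>LINT x|lebesgue_on S. f x \<bullet> g x\<bar> \<le> L2norm S f * L2norm S g"
    unfolding L2norm_def
  proof (rule le_sqrt_mult_of_AM_GM)
    fix \<mu> :: real assume "\<mu> > 0"
    have "\<bar>LINT x|lebesgue_on S. f x \<bullet> g x\<bar> \<le> (LINT x|lebesgue_on S. \<bar>f x \<bullet> g x\<bar>)" by (rule integral_abs_bound)
    then have "2 * \<bar>LINT x|lebesgue_on S. f x \<bullet> g x\<bar> \<le> (LINT x|lebesgue_on S. 2 * \<bar>f x \<bullet> g x\<bar>)" by simp
    also have "\<dots> \<le> (LINT x|lebesgue_on S. \<mu> * (norm (f x))\<^sup>2 + (norm (g x))\<^sup>2 / \<mu>)"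
      using i int le[OF \<open>\<mu> > 0\<close>] by (intro integral_mono) auto
    also have "\<dots> = \<mu> * (LINT x|lebesgue_on S. (norm (f x))\<^sup>2) + (LINT x|lebesgue_on S. (norm (g x))\<^sup>2) / \<mu>"
      using i by simp
    finally show "2 * \<bar>LINT x|lebesgue_on S. f x \<bullet> g x\<bar>
        \<le> \<mu> * (LINT x|lebesgue_on S. (norm (f x))\<^sup>2) + (LINT x|lebesgue_on S. (norm (g x))\<^sup>2) / \<mu>" .
  qed auto
qed

text \<open>The definitions integrate over restricted Lebesgue measure, the Gauss formulas over
  \<open>lborel\<close>; for Borel functions the completion makes no difference.\<close>

lemma lebesgue_on_integral_borel:
  fixes f :: "real^3 \<Rightarrow> real"
  assumes "f \<in> borel_measurable borel" "S \<in> sets borel"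
  shows "(LINT x|lebesgue_on S. f x) = (LINT x|lborel. indicator S x * f x)"
proof -
  have "(LINT x|lebesgue_on S. f x) = (LINT x|lebesgue. indicator S x * f x)"
    using assms(2) by (subst integral_restrict_space) auto
  also have "\<dots> = (LINT x|lborel. indicator S x * f x)"
    using assms by (intro integral_completion) auto
  finally show ?thesis .
qed

section \<open>Continuously differentiable functions and gradients against curls\<close>

definition C1 :: "(real^3 \<Rightarrow> real) \<Rightarrow> bool" where
  "C1 f \<longleftrightarrow> (\<forall>x. f differentiable (at x)) \<and> (\<forall>i. continuous_on UNIV (pderiv3 i f))"

lemma C1_continuous: "C1 f \<Longrightarrow> continuous_on S f"
  unfolding C1_def by (meson continuous_at_imp_continuous_on differentiable_imp_continuous_within)

lemma tame_C1: "tame f \<Longrightarrow> C1 f"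
  by (simp add: C1_def tame_differentiable tame_continuous_on tame_pderiv3)

lemma smooth3_C1: "smooth3 f \<Longrightarrow> C1 f"
proof -
  assume "smooth3 f"
  then have "cont_diff3 (Suc 0) f" unfolding smooth3_def by blast
  then show ?thesis by (simp add: C1_def differentiable_on_def)
qed

lemma C1_mult_C1c:
  assumes f: "C1 f" and g: "C1 g" and b: "bounded {x. f x \<noteq> 0}"
  shows "C1c (\<lambda>x. f x * g x)"
proof -
  have "pderiv3 i (\<lambda>x. f x * g x) = (\<lambda>x. f x * pderiv3 i g x + pderiv3 i f x * g x)" for i
    using f g by (intro pderiv3_mult) (auto simp: C1_def)
  moreover have "continuous_on UNIV (\<lambda>x. f x * pderiv3 i g x + pderiv3 i f x * g x)" for i
    using C1_continuous[OF f] C1_continuous[OF g] f g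
    by (intro continuous_on_add continuous_on_mult) (auto simp: C1_def)
  moreover have "bounded {x. f x * g x \<noteq> 0}" by (rule bounded_subset[OF b]) auto
  ultimately show ?thesis using f g by (auto simp: C1c_def C1_def intro: differentiable_mult)
qed

lemma C1c_integral_pderiv3: "C1c f \<Longrightarrow> (LINT x|lborel. pderiv3 i f x) = 0"
  using integral_grad3_invariant[of f UNIV "axis i 1"] by (simp add: inner_axis grad3_def)

lemma C1c_integrable_pderiv3: "C1c f \<Longrightarrow> integrable lborel (pderiv3 i f)"
  using C1c_integrable_grad[of f "axis i 1"] by (simp add: inner_axis grad3_def)

lemma grad3_measurable: "C1 f \<Longrightarrow> grad3 f \<in> borel_measurable borel"
proof (rule borel_measurable_continuous_onI)
  assume "C1 f"
  then show "continuous_on UNIV (grad3 f)"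
    unfolding grad3_def[abs_def] by (intro continuous_on_vec_lambda) (simp add: C1_def)
qed

text \<open>The gradient of a test function is curl-free with vanishing tangential trace, so it may be
  inserted into the first equation of the eigenvalue problem.\<close>

lemma integral_grad3_curl3:
  assumes f: "tame f" and b: "bounded {x. f x \<noteq> 0}" and \<psi>: "smooth_field3 \<psi>"
  shows "(LINT x|lborel. grad3 f x \<bullet> curl3 \<psi> x) = 0"
proof -
  have s: "C1 (\<lambda>x. \<psi> x $ i)" for i using \<psi> by (simp add: smooth_field3_def smooth3_C1)
  have bi: "bounded {x. pderiv3 i f x \<noteq> 0}" for i
  proof -
    have "pderiv3 i f x = 0" if "x \<notin> closure {x. f x \<noteq> 0}" for x
    proof -
      have "grad3 f x = 0"
        by (rule grad3_eq_0[of "- closure {x. f x \<noteq> 0}"]) (use that closure_subset[of "{x. f x \<noteq> 0}"] in auto)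
      then show ?thesis by (simp add: grad3_def vec_eq_iff)
    qed
    then have "{x. pderiv3 i f x \<noteq> 0} \<subseteq> closure {x. f x \<noteq> 0}" by blast
    then show ?thesis using b bounded_closure bounded_subset by blast
  qed
  let ?X = "\<lambda>i k x. pderiv3 i f x * \<psi> x $ k"
  have c: "C1c (?X i k)" for i k
    by (intro C1_mult_C1c bi s tame_C1 tame_pderiv3 f)
  have dX: "pderiv3 j (?X i k) x = pderiv3 i f x * pderiv3 j (\<lambda>x. \<psi> x $ k) x + pderiv3 j (pderiv3 i f) x * \<psi> x $ k" for i j k x
    using s[of k] tame_C1[OF tame_pderiv3[OF f]] by (subst pderiv3_mult) (auto simp: C1_def)
  \<comment> \<open>The right-hand side is the divergence of \<open>cross3\<close> of
    \<open>\<psi>\<close> and the gradient of \<open>f\<close>. Its second derivatives of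
    \<open>f\<close> cancel in pairs by symmetry, and each term is a derivative of a compactly
    supported product, so it integrates to zero.\<close>
  have "grad3 f x \<bullet> curl3 \<psi> x = pderiv3 2 (?X 1 3) x - pderiv3 3 (?X 1 2) x + pderiv3 3 (?X 2 1) x
      - pderiv3 1 (?X 2 3) x + pderiv3 1 (?X 3 2) x - pderiv3 2 (?X 3 1) x" for x
    unfolding dX grad3_def curl3_def inner_vec_def sum_3
      tame_pderiv3_commute[OF f, of 2 1] tame_pderiv3_commute[OF f, of 3 1] tame_pderiv3_commute[OF f, of 3 2]
    by (simp add: algebra_simps)
  then show ?thesis by (simp add: C1c_integral_pderiv3 C1c_integrable_pderiv3 c)
qed

section \<open>The element estimate\<close>

lemma norm_le_of_inner:
  fixes G :: "'a::real_inner"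
  assumes "0 \<le> B" "\<And>v. \<bar>G \<bullet> v\<bar> \<le> B * norm v"
  shows "norm G \<le> B"
proof (cases "G = 0")
  case False
  have "norm G * norm G \<le> B * norm G" using assms(2)[of G] by (simp add: power2_norm_eq_inner[symmetric] power2_eq_square)
  then show ?thesis using False by simp
qed (use assms in simp)

lemma L2_continuous:
  fixes f :: "real^3 \<Rightarrow> 'b::euclidean_space"
  assumes "continuous_on UNIV f" "compact K"
  shows "f \<in> L2 K"
proof -
  have "compact (f ` K)" using assms by (intro compact_continuous_image) (auto intro: continuous_on_subset)
  then obtain c where "\<And>x. x \<in> K \<Longrightarrow> norm (f x) \<le> c"
    using compact_imp_bounded bounded_iff by (metis imageI)
  then show ?thesis
    using assms by (intro L2_bounded(1)) (auto intro: borel_measurable_continuous_onI lmeasurable_compact)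
qed

lemma grad3_mult:
  assumes "C1 f" "C1 g"
  shows "grad3 (\<lambda>x. f x * g x) x = f x *\<^sub>R grad3 g x + g x *\<^sub>R grad3 f x"
  using assms by (simp add: grad3_def vec_eq_iff pderiv3_mult C1_def mult.commute)

text \<open>The product rule gives \<open>B / \<rho>\<close> from the gradient of \<open>f\<close>
  and \<open>4 * B / \<rho>\<close> from that of the bump; the factor \<open>5\<close> of both
  estimates originates here.\<close>

lemma norm_grad3_bump_mult_le:
  assumes f: "tame f" and \<rho>: "0 < \<rho>"
    and b: "\<And>x. dist x0 x \<le> \<rho> \<Longrightarrow> \<bar>f x\<bar> \<le> B" "\<And>x. dist x0 x \<le> \<rho> \<Longrightarrow> norm (grad3 f x) \<le> B / \<rho>"
  shows "norm (grad3 (\<lambda>x. bump x0 \<rho> x * f x) x) \<le> 5 * B / \<rho>"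
    and "\<rho> < dist x0 x \<Longrightarrow> grad3 (\<lambda>x. bump x0 \<rho> x * f x) x = 0"
proof -
  have out: "grad3 (\<lambda>x. bump x0 \<rho> x * f x) x = 0" if "\<rho> < dist x0 x"
    by (rule grad3_eq_0[of "- cball x0 \<rho>"]) (use that \<rho> in \<open>auto simp: bump_eq_0\<close>)
  show "\<rho> < dist x0 x \<Longrightarrow> grad3 (\<lambda>x. bump x0 \<rho> x * f x) x = 0" by (rule out)
  have B: "0 \<le> B" using b(1)[of x0] \<rho> by simp
  show "norm (grad3 (\<lambda>x. bump x0 \<rho> x * f x) x) \<le> 5 * B / \<rho>"
  proof (cases "dist x0 x \<le> \<rho>")
    case True
    have "norm (grad3 (\<lambda>x. bump x0 \<rho> x * f x) x) \<le> norm (bump x0 \<rho> x *\<^sub>R grad3 f x) + norm (f x *\<^sub>R grad3 (bump x0 \<rho>) x)"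
      unfolding grad3_mult[OF tame_C1[OF tame_bump] tame_C1[OF f]] by (rule norm_triangle_ineq)
    also have "\<dots> \<le> 1 * (B / \<rho>) + B * (4 / \<rho>)"
      unfolding norm_scaleR using b[OF True] bump_nonneg[of x0 \<rho> x] bump_le_1[of x0 \<rho> x] norm_grad3_bump_le[OF \<rho> True] B
      by (intro add_mono mult_mono) auto
    also have "\<dots> = 5 * B / \<rho>" by (simp add: field_simps)
    finally show ?thesis .
  next
    case False
    then show ?thesis using out B \<rho> by simp
  qed
qed

text \<open>The divergence of the product stays a sum of partial derivatives, so that it can be
  integrated term by term over the whole space or over a half-space.\<close>

lemma inner_grad3:
  assumes q: "\<And>i. C1 (\<lambda>x. q x $ i)" and f: "C1 f"
  shows "q x \<bullet> grad3 f x = (\<Sum>i\<in>UNIV. pderiv3 i (\<lambda>x. f x * q x $ i) x) - f x * div3 q x"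
proof -
  have "pderiv3 i (\<lambda>x. f x * q x $ i) x = f x * pderiv3 i (\<lambda>x. q x $ i) x + pderiv3 i f x * q x $ i" for i
    using q[of i] f by (subst pderiv3_mult) (auto simp: C1_def)
  then show ?thesis
    by (simp add: div3_def grad3_def inner_vec_def sum.distrib sum_distrib_left mult.commute)
qed

lemma integrable_bounded_support:
  fixes f g :: "real^3 \<Rightarrow> real"
  assumes "continuous_on UNIV f" "continuous_on UNIV g" "bounded {x. f x \<noteq> 0}"
  shows "integrable lborel (\<lambda>x. f x * g x)"
proof -
  obtain R where "\<And>x. f x \<noteq> 0 \<Longrightarrow> norm x \<le> R" using assms(3) unfolding bounded_iff by auto
  then have "f x * g x = 0" if "R < norm x" for x using that by force
  then show ?thesis using assms(1,2)
    by (intro integrable_cont_bounded_support[of _ R] continuous_intros) auto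
qed

lemma integral_inner_grad3:
  assumes q: "\<And>i. C1 (\<lambda>x. q x $ i)" and f: "C1 f" and b: "bounded {x. f x \<noteq> 0}"
  shows "(LINT x|lborel. q x \<bullet> grad3 f x) = - (LINT x|lborel. f x * div3 q x)"
    and "integrable lborel (\<lambda>x. q x \<bullet> grad3 f x)" "integrable lborel (\<lambda>x. f x * div3 q x)"
proof -
  have c: "C1c (\<lambda>x. f x * q x $ i)" for i using C1_mult_C1c[OF f q b] .
  have "continuous_on UNIV (div3 q)"
    unfolding div3_def[abs_def] using q by (intro continuous_on_sum) (auto simp: C1_def)
  then show i: "integrable lborel (\<lambda>x. f x * div3 q x)"
    using C1_continuous[OF f] b by (intro integrable_bounded_support)
  show "integrable lborel (\<lambda>x. q x \<bullet> grad3 f x)"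
    unfolding inner_grad3[OF q f] using i C1c_integrable_pderiv3[OF c] by auto
  show "(LINT x|lborel. q x \<bullet> grad3 f x) = - (LINT x|lborel. f x * div3 q x)"
    unfolding inner_grad3[OF q f] using i C1c_integrable_pderiv3[OF c]
    by (simp add: C1c_integral_pderiv3[OF c])
qed

text \<open>With \<open>d = div3 p\<close> the test function \<open>bump * d\<close> turns
  \<open>(U - p, grad \<phi>)\<close> into the integral of \<open>bump * d^2\<close>. The latter is
  at least \<open>A * M^2 * r^3\<close>; the former is at most \<open>5 * C * M / r * V\<close>
  times the norm of the error, where \<open>V^2\<close> is the volume of the outer ball. The norm of
  \<open>d\<close> itself is at most \<open>C * M * V\<close>.\<close>

lemma element_estimate:
  assumes "1 \<le> \<kappa>"
  obtains C where "0 < C"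
    "\<And>K x0 r p U. 0 < r \<Longrightarrow> cball x0 r \<subseteq> K \<Longrightarrow> K \<subseteq> cball x0 (\<kappa> * r) \<Longrightarrow> compact K \<Longrightarrow>
      (\<And>i. polyfun m (\<lambda>x. p x $ i)) \<Longrightarrow> U \<in> L2 K \<Longrightarrow>
      (\<And>\<phi>. tame \<phi> \<Longrightarrow> (\<And>x. r \<le> dist x0 x \<Longrightarrow> \<phi> x = 0) \<Longrightarrow> L2inner K U (grad3 \<phi>) = 0) \<Longrightarrow>
      r * L2norm K (div3 p) \<le> C * L2norm K (\<lambda>x. U x - p x)"
proof -
  obtain C where C4: "4 \<le> C" and core: "\<And>f N x0 \<rho>. line_poly m f \<Longrightarrow> continuous_on UNIV f \<Longrightarrow> 0 < \<rho> \<Longrightarrow>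
       \<exists>x1::real^3. N \<bullet> (x1 - x0) = 0 \<and> dist x0 x1 \<le> \<rho> / 2 \<and>
        (\<forall>x. N \<bullet> (x - x0) = 0 \<longrightarrow> dist x0 x \<le> \<kappa> * \<rho> \<longrightarrow> \<bar>f x\<bar> \<le> C * \<bar>f x1\<bar>) \<and>
        (\<forall>x v f'. N \<bullet> (x - x0) = 0 \<longrightarrow> dist x0 x \<le> \<rho> \<longrightarrow> N \<bullet> v = 0 \<longrightarrow> (f has_derivative f') (at x)
            \<longrightarrow> \<bar>f' v\<bar> \<le> C * \<bar>f x1\<bar> * norm v / \<rho>) \<and>
        (\<forall>x. N \<bullet> (x - x0) = 0 \<longrightarrow> dist x1 x \<le> \<rho> / C \<longrightarrow> \<bar>f x1\<bar> / 2 \<le> \<bar>f x\<bar>)"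
    using line_poly_core[OF assms, where m=m and 'a="real^3"] by metis
  define c3 where "c3 = unit_ball_vol 3"
  have c3: "0 < c3" by (simp add: c3_def)
  \<comment> \<open>The lower bound \<open>exp (- 3)\<close> of the bump, the factor
    \<open>1 / 4\<close> from \<open>(M / 2)^2\<close>, and the volume
    \<open>c3 * (r / C) ^ 3\<close> of the ball around \<open>x1\<close>.\<close>
  define A where "A = exp (- 3) * c3 / (4 * C ^ 3)"
  have A: "0 < A" using C4 c3 by (simp add: A_def)
  \<comment> \<open>The product of \<open>5 * C * V\<close> from testing and \<open>C * V\<close>
    from the norm of \<open>d\<close>, with \<open>V^2 = c3 * (\<kappa> * r) ^ 3\<close>, divided by
    \<open>A * r ^ 3\<close>.\<close>
  define C' where "C' = 5 * C\<^sup>2 * c3 * \<kappa> ^ 3 / A"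
  have "0 < C'" using A C4 c3 assms by (simp add: C'_def)
  then show ?thesis
  proof (rule that)
    fix K x0 r and p U :: "real^3 \<Rightarrow> real^3"
    assume r: "0 < r" and ball: "cball x0 r \<subseteq> K" and sub: "K \<subseteq> cball x0 (\<kappa> * r)" and K: "compact K"
      and p: "\<And>i. polyfun m (\<lambda>x. p x $ i)" and U: "U \<in> L2 K"
      and orth: "\<And>\<phi>. tame \<phi> \<Longrightarrow> (\<And>x. r \<le> dist x0 x \<Longrightarrow> \<phi> x = 0) \<Longrightarrow> L2inner K U (grad3 \<phi>) = 0"
    define d where "d = div3 p"
    have pd: "polyfun m d" unfolding d_def div3_def[abs_def] by (intro polyfun_sum polyfun_pderiv3 p)
    have td: "tame d" using pd by (rule polyfun_imp_tame)
    have cd: "continuous_on S d" for S using td by (rule tame_continuous_on)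
    from core[OF polyfun_line_poly[OF pd] cd r, of 0 x0] obtain x1 where
      x1: "dist x0 x1 \<le> r / 2" and up: "\<And>x. dist x0 x \<le> \<kappa> * r \<Longrightarrow> \<bar>d x\<bar> \<le> C * \<bar>d x1\<bar>"
      and dr: "\<And>x v f'. dist x0 x \<le> r \<Longrightarrow> (d has_derivative f') (at x) \<Longrightarrow> \<bar>f' v\<bar> \<le> C * \<bar>d x1\<bar> * norm v / r"
      and low: "\<And>x. dist x1 x \<le> r / C \<Longrightarrow> \<bar>d x1\<bar> / 2 \<le> \<bar>d x\<bar>"
      by auto
    define M where "M = \<bar>d x1\<bar>"
    have M: "0 \<le> M" by (simp add: M_def)
    define \<phi> where "\<phi> = (\<lambda>x. bump x0 r x * d x)"
    have t\<phi>: "tame \<phi>" unfolding \<phi>_def by (rule tame.mult[OF tame_bump td])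
    have \<phi>0: "\<phi> x = 0" if "r \<le> dist x0 x" for x using that r by (simp add: \<phi>_def bump_eq_0)
    have b\<phi>: "bounded {x. \<phi> x \<noteq> 0}"
    proof (rule bounded_subset[OF bounded_cball])
      show "{x. \<phi> x \<noteq> 0} \<subseteq> cball x0 r" using \<phi>0 by (force simp: not_le)
    qed
    have d1: "\<bar>d x\<bar> \<le> C * M" if "dist x0 x \<le> r" for x
    proof -
      have "r \<le> \<kappa> * r" using assms r by simp
      then show ?thesis using up[of x] that by (simp add: M_def)
    qed
    have d2: "norm (grad3 d x) \<le> C * M / r" if "dist x0 x \<le> r" for x
      using dr[OF that has_derivative_grad3[OF tame_differentiable[OF td]]]
      using C4 r by (intro norm_le_of_inner) (simp_all add: M_def)
    have g: "norm (grad3 \<phi> x) \<le> 5 * (C * M) / r" "r < dist x0 x \<Longrightarrow> grad3 \<phi> x = 0" for x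
      unfolding \<phi>_def using norm_grad3_bump_mult_le[OF td r, of x0 "C * M"] d1 d2 by auto
    define V where "V = sqrt (c3 * (\<kappa> * r) ^ 3)"
    have mK: "sqrt (measure lebesgue K) \<le> V"
    proof -
      have "measure lebesgue K \<le> measure lebesgue (cball x0 (\<kappa> * r))"
        using sub K by (intro measure_mono_fmeasurable) (auto intro: fmeasurableD lmeasurable_compact)
      also have "\<dots> = c3 * (\<kappa> * r) ^ 3" using assms r by (simp add: content_cball c3_def)
      finally show ?thesis unfolding V_def by (rule real_sqrt_le_mono)
    qed
    have V: "0 \<le> V" "V\<^sup>2 = c3 * (\<kappa> * r) ^ 3" using c3 assms r by (auto simp: V_def)
    have lmK: "K \<in> lmeasurable" using K by (rule lmeasurable_compact)
    have pL2: "p \<in> L2 K"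
    proof (rule L2_continuous[OF _ K])
      show "continuous_on UNIV p"
        using tame_continuous_on[OF polyfun_imp_tame[OF p]] continuous_on_vec_lambda[of UNIV "\<lambda>i x. p x $ i"] by simp
    qed
    define e where "e = (\<lambda>x. U x - p x)"
    have eL2: "e \<in> L2 K" unfolding e_def by (rule L2_diff[OF U pL2])
    have gm: "grad3 \<phi> \<in> borel_measurable borel" by (rule grad3_measurable[OF tame_C1[OF t\<phi>]])
    have "norm (grad3 \<phi> x) \<le> 5 * (C * M) / r" for x using g by simp
    note gL2 = L2_bounded[OF gm lmK this]
    have C1p: "C1 (\<lambda>x. p x $ i)" for i by (rule tame_C1[OF polyfun_imp_tame[OF p]])
    note ibp = integral_inner_grad3[OF C1p tame_C1[OF t\<phi>] b\<phi>]
    have "L2inner K p (grad3 \<phi>) = - (LINT x|lborel. \<phi> x * d x)"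
    proof -
      have "L2inner K p (grad3 \<phi>) = (LINT x|lborel. indicator K x * (p x \<bullet> grad3 \<phi> x))"
        unfolding L2inner_def
        using ibp(2) K by (intro lebesgue_on_integral_borel) (auto intro: borel_compact)
      also have "\<dots> = (LINT x|lborel. p x \<bullet> grad3 \<phi> x)"
        using g(2) ball by (intro Bochner_Integration.integral_cong) (force simp: indicator_def not_le)+
      finally show ?thesis using ibp(1) by (simp add: d_def)
    qed
    moreover have "L2inner K U (grad3 \<phi>) = 0" by (rule orth[OF t\<phi> \<phi>0])
    moreover have "L2inner K e (grad3 \<phi>) = L2inner K U (grad3 \<phi>) - L2inner K p (grad3 \<phi>)"
      unfolding L2inner_def e_def inner_diff_left
      by (rule Bochner_Integration.integral_diff[OF L2_Cauchy_Schwarz(1)[OF U gL2(1)] L2_Cauchy_Schwarz(1)[OF pL2 gL2(1)]])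
    ultimately have "(LINT x|lborel. \<phi> x * d x) = L2inner K e (grad3 \<phi>)" by simp
    also have "\<dots> \<le> L2norm K e * L2norm K (grad3 \<phi>)"
      using L2_Cauchy_Schwarz(2)[OF eL2 gL2(1)] unfolding L2inner_def by linarith
    also have "\<dots> \<le> L2norm K e * (5 * (C * M) / r * V)"
    proof (rule mult_left_mono[OF _ L2norm_nonneg])
      have "\<bar>5 * (C * M) / r\<bar> = 5 * (C * M) / r" using C4 M r by simp
      then have "L2norm K (grad3 \<phi>) \<le> 5 * (C * M) / r * sqrt (measure lebesgue K)" using gL2(2) by simp
      also have "\<dots> \<le> 5 * (C * M) / r * V" using mK C4 M r by (intro mult_left_mono) auto
      finally show "L2norm K (grad3 \<phi>) \<le> 5 * (C * M) / r * V" .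
    qed
    finally have upper: "(LINT x|lborel. \<phi> x * d x) \<le> L2norm K e * (5 * (C * M) / r * V)" .
    have lower: "A * M\<^sup>2 * r ^ 3 \<le> (LINT x|lborel. \<phi> x * d x)"
    proof -
      let ?B = "cball x1 (r / C)"
      have le: "exp (- 3) * (M / 2)\<^sup>2 * indicator ?B x \<le> \<phi> x * d x" for x
      proof (cases "dist x1 x \<le> r / C")
        case True
        have "r / C \<le> r / 4" using C4 r by (intro divide_left_mono) auto
        then have "dist x0 x \<le> 3 / 4 * r" using True x1 dist_triangle[of x0 x x1] by linarith
        then have "exp (- 3) \<le> bump x0 r x" using r by (intro bump_lower) auto
        moreover have "(M / 2)\<^sup>2 \<le> (d x)\<^sup>2"
          using low[OF True] M unfolding M_def by (metis abs_le_square_iff abs_divide abs_idempotent abs_numeral)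
        ultimately have "exp (- 3) * (M / 2)\<^sup>2 \<le> bump x0 r x * (d x)\<^sup>2"
          by (intro mult_mono bump_nonneg) auto
        then show ?thesis using True by (simp add: \<phi>_def power2_eq_square)
      next
        case False
        then show ?thesis using bump_nonneg[of x0 r x] by (simp add: \<phi>_def mult.assoc)
      qed
      have "A * M\<^sup>2 * r ^ 3 = exp (- 3) * (M / 2)\<^sup>2 * measure lborel ?B"
        using C4 r by (simp add: content_cball A_def c3_def power_divide)
      also have "\<dots> = (LINT x|lborel. exp (- 3) * (M / 2)\<^sup>2 * indicator ?B x)" by simp
      also have "\<dots> \<le> (LINT x|lborel. \<phi> x * d x)"
        using ibp(3) le emeasure_bounded_finite[of ?B]
        by (intro integral_mono) (auto simp: d_def integrable_indicator_iff)
      finally show ?thesis .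
    qed
    \<comment> \<open>The two bounds are multiplied by \<open>r\<close>, and one factor
      \<open>M\<close> is cancelled.\<close>
    have main: "A * M * r ^ 4 \<le> 5 * C * V * L2norm K e"
    proof (cases "M = 0")
      case True
      then show ?thesis using C4 V L2norm_nonneg[of K e] by simp
    next
      case False
      have "A * M\<^sup>2 * r ^ 3 \<le> L2norm K e * (5 * (C * M) / r * V)" using lower upper by linarith
      then have "A * M\<^sup>2 * r ^ 3 * r \<le> L2norm K e * (5 * (C * M) / r * V) * r" using r by (intro mult_right_mono) auto
      also have "L2norm K e * (5 * (C * M) / r * V) * r = (5 * C * V * L2norm K e) * M" using r by (simp add: field_simps)
      also have "A * M\<^sup>2 * r ^ 3 * r = (A * M * r ^ 4) * M" by (simp add: power2_eq_square eval_nat_numeral)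
      finally show ?thesis by (rule mult_right_le_imp_le) (use False M in simp)
    qed
    have dm: "d \<in> borel_measurable borel" by (rule borel_measurable_continuous_onI[OF cd])
    have "norm (d x) \<le> C * M" if "x \<in> K" for x using up[of x] sub that by (auto simp: M_def)
    from L2_bounded(2)[OF dm lmK this] have "L2norm K d \<le> C * M * sqrt (measure lebesgue K)" using C4 M by simp
    also have "\<dots> \<le> C * M * V" using mK C4 M by (intro mult_left_mono) auto
    finally have dn: "L2norm K d \<le> C * M * V" .
    have "A * r ^ 3 * (r * (C * M * V)) = C * V * (A * M * r ^ 4)" by (simp add: eval_nat_numeral)
    also have "\<dots> \<le> C * V * (5 * C * V * L2norm K e)" using main C4 V by (intro mult_left_mono) auto
    also have "\<dots> = 5 * C\<^sup>2 * V\<^sup>2 * L2norm K e" by (simp add: power2_eq_square)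
    also have "\<dots> = A * r ^ 3 * (C' * L2norm K e)"
      using A unfolding V(2) C'_def by (simp add: power_mult_distrib)
    finally have "r * (C * M * V) \<le> C' * L2norm K e" using A r by (simp add: mult_le_cancel_left_pos)
    moreover have "r * L2norm K d \<le> r * (C * M * V)" using dn r by (intro mult_left_mono) auto
    ultimately show "r * L2norm K (div3 p) \<le> C' * L2norm K (\<lambda>x. U x - p x)"
      unfolding d_def e_def by linarith
  qed
qed

section \<open>The face estimate\<close>

lemma reference_triangle_compact: "compact reference_triangle"
proof -
  have "closed reference_triangle"
    unfolding reference_triangle_def case_prod_beta'
    by (intro closed_Collect_conj closed_Collect_le continuous_intros)
  moreover have "reference_triangle \<subseteq> {0..1} \<times> {0..1}"
    by (auto simp: reference_triangle_def)
  then have "bounded reference_triangle"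
    by (rule bounded_subset[rotated]) (intro bounded_Times bounded_closed_interval)
  ultimately show ?thesis by (simp add: compact_eq_bounded_closed)
qed

text \<open>The enclosing unit square is enough; the exact area would only improve a
  constant.\<close>

lemma measure_reference_triangle_le: "measure lebesgue reference_triangle \<le> 1"
proof -
  have sub: "reference_triangle \<subseteq> cbox (0, 0) (1, 1)"
    by (auto simp: reference_triangle_def cbox_Pair_eq)
  have "measure lebesgue reference_triangle \<le> measure lebesgue (cbox (0::real, 0::real) (1, 1))"
    using sub reference_triangle_compact lmeasurable_compact
    by (intro measure_mono_fmeasurable) (auto intro: fmeasurableD)
  also have "\<dots> = measure lborel (cbox (0::real, 0::real) (1, 1))" by (intro measure_completion) auto
  also have "\<dots> = 1" unfolding content_Pair by simp
  finally show ?thesis .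
qed

text \<open>The piecewise field is \<open>p2\<close> plus \<open>p1 - p2\<close> cut off to the
  half-space below the face. After testing, \<open>p2\<close> leaves only a divergence, and the
  cut-off part leaves in addition the surface integral of \<open>bump * J^2\<close>, with
  \<open>J\<close> the normal component of \<open>p1 - p2\<close>. So this integral equals an error
  term plus one divergence term for each half-ball, and \<open>\<Delta>\<close> bounds all
  three.\<close>

lemma face_estimate:
  assumes R: "1 \<le> R"
  obtains C where "0 < C"
    "\<And>a b c n y \<rho> p1 p2 U \<Delta>.
      0 < \<rho> \<Longrightarrow> norm n = 1 \<Longrightarrow> n \<bullet> b = 0 \<Longrightarrow> n \<bullet> c = 0 \<Longrightarrow> cross3 b c \<noteq> 0 \<Longrightarrow> n \<bullet> (y - a) = 0 \<Longrightarrow>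
      (\<And>s t. dist y (a + s *\<^sub>R b + t *\<^sub>R c) \<le> \<rho> \<Longrightarrow> 0 \<le> s \<and> 0 \<le> t \<and> s + t \<le> 1) \<Longrightarrow>
      (\<And>s t. 0 \<le> s \<Longrightarrow> 0 \<le> t \<Longrightarrow> s + t \<le> 1 \<Longrightarrow> dist y (a + s *\<^sub>R b + t *\<^sub>R c) \<le> R * \<rho>) \<Longrightarrow>
      (\<And>i. polyfun m (\<lambda>x. p1 x $ i)) \<Longrightarrow> (\<And>i. polyfun m (\<lambda>x. p2 x $ i)) \<Longrightarrow> U \<in> L2 (cball y \<rho>) \<Longrightarrow>
      (\<And>\<phi>. tame \<phi> \<Longrightarrow> (\<And>x. \<rho> \<le> dist y x \<Longrightarrow> \<phi> x = 0) \<Longrightarrow> L2inner (cball y \<rho>) U (grad3 \<phi>) = 0) \<Longrightarrow>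
      L2norm (cball y \<rho>) (\<lambda>x. U x - (if n \<bullet> (x - a) \<le> 0 then p1 x else p2 x)) \<le> \<Delta> \<Longrightarrow>
      \<rho> * L2norm (cball y \<rho> \<inter> {x. n \<bullet> (x - a) \<le> 0}) (div3 p1) \<le> \<Delta> \<Longrightarrow>
      \<rho> * L2norm (cball y \<rho> \<inter> {x. 0 \<le> n \<bullet> (x - a)}) (div3 p2) \<le> \<Delta> \<Longrightarrow>
      sqrt \<rho> * sqrt (norm (cross3 b c) * (LINT z|lebesgue_on reference_triangle.
         (n \<bullet> (p1 (a + fst z *\<^sub>R b + snd z *\<^sub>R c) - p2 (a + fst z *\<^sub>R b + snd z *\<^sub>R c)))\<^sup>2)) \<le> C * \<Delta>"
proof -
  obtain C where C4: "4 \<le> C" and core: "\<And>f N x0 \<rho>. line_poly m f \<Longrightarrow> continuous_on UNIV f \<Longrightarrow> 0 < \<rho> \<Longrightarrow>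
       \<exists>x1::real^3. N \<bullet> (x1 - x0) = 0 \<and> dist x0 x1 \<le> \<rho> / 2 \<and>
        (\<forall>x. N \<bullet> (x - x0) = 0 \<longrightarrow> dist x0 x \<le> R * \<rho> \<longrightarrow> \<bar>f x\<bar> \<le> C * \<bar>f x1\<bar>) \<and>
        (\<forall>x v f'. N \<bullet> (x - x0) = 0 \<longrightarrow> dist x0 x \<le> \<rho> \<longrightarrow> N \<bullet> v = 0 \<longrightarrow> (f has_derivative f') (at x)
            \<longrightarrow> \<bar>f' v\<bar> \<le> C * \<bar>f x1\<bar> * norm v / \<rho>) \<and>
        (\<forall>x. N \<bullet> (x - x0) = 0 \<longrightarrow> dist x1 x \<le> \<rho> / C \<longrightarrow> \<bar>f x1\<bar> / 2 \<le> \<bar>f x\<bar>)"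
    using line_poly_core[OF R, where m=m and 'a="real^3"] by metis
  define c3 where "c3 = unit_ball_vol 3"
  have c3: "0 < c3" by (simp add: c3_def)
  \<comment> \<open>The lower bound \<open>exp (- 3)\<close> of the bump, the factor
    \<open>1 / 4\<close> from \<open>(M / 2)^2\<close>, and \<open>c3 * (\<rho> / C)^2 / 2\<close>
    as a lower bound for the area of a disc of radius \<open>\<rho> / C\<close>.\<close>
  define A where "A = exp (- 3) * c3 / (8 * C\<^sup>2)"
  have A: "0 < A" using C4 c3 by (simp add: A_def)
  \<comment> \<open>Here \<open>14 = 2 * 7\<close>: seven is \<open>5\<close> for the error term
    plus one for each half-ball, and \<open>2 * R\<close> is the bound for the edge lengths in units
    of \<open>\<rho>\<close>.\<close>
  define C' where "C' = 14 * C\<^sup>2 * R * sqrt c3 / A"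
  have "0 < C'" using A C4 c3 R by (simp add: C'_def)
  then show ?thesis
  proof (rule that)
    fix a b c n y :: "real^3" and \<rho> \<Delta> :: real and p1 p2 U :: "real^3 \<Rightarrow> real^3"
    assume \<rho>: "0 < \<rho>" and n: "norm n = 1" "n \<bullet> b = 0" "n \<bullet> c = 0" and bc: "cross3 b c \<noteq> 0" and ya: "n \<bullet> (y - a) = 0"
      and inn: "\<And>s t. dist y (a + s *\<^sub>R b + t *\<^sub>R c) \<le> \<rho> \<Longrightarrow> 0 \<le> s \<and> 0 \<le> t \<and> s + t \<le> 1"
      and out: "\<And>s t. 0 \<le> s \<Longrightarrow> 0 \<le> t \<Longrightarrow> s + t \<le> 1 \<Longrightarrow> dist y (a + s *\<^sub>R b + t *\<^sub>R c) \<le> R * \<rho>"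
      and p1: "\<And>i. polyfun m (\<lambda>x. p1 x $ i)" and p2: "\<And>i. polyfun m (\<lambda>x. p2 x $ i)" and U: "U \<in> L2 (cball y \<rho>)"
      and orth: "\<And>\<phi>. tame \<phi> \<Longrightarrow> (\<And>x. \<rho> \<le> dist y x \<Longrightarrow> \<phi> x = 0) \<Longrightarrow> L2inner (cball y \<rho>) U (grad3 \<phi>) = 0"
      and eD: "L2norm (cball y \<rho>) (\<lambda>x. U x - (if n \<bullet> (x - a) \<le> 0 then p1 x else p2 x)) \<le> \<Delta>"
      and d1: "\<rho> * L2norm (cball y \<rho> \<inter> {x. n \<bullet> (x - a) \<le> 0}) (div3 p1) \<le> \<Delta>"
      and d2: "\<rho> * L2norm (cball y \<rho> \<inter> {x. 0 \<le> n \<bullet> (x - a)}) (div3 p2) \<le> \<Delta>"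
    have nn: "n \<bullet> n = 1" using n(1) by (simp add: power2_norm_eq_inner[symmetric])
    let ?B = "cball y \<rho>" and ?H = "{x. n \<bullet> (x - a) \<le> 0}" and ?H' = "{x. 0 \<le> n \<bullet> (x - a)}"
    let ?x = "\<lambda>z::real \<times> real. a + fst z *\<^sub>R b + snd z *\<^sub>R c"
    have Hm: "closed ?H" "closed ?H'" by (intro closed_Collect_le continuous_intros)+
    have \<Delta>: "0 \<le> \<Delta>" using eD L2norm_nonneg by (rule order_trans[rotated])
    define w where "w = (\<lambda>x. p1 x - p2 x)"
    have w: "polyfun m (\<lambda>x. w x $ i)" for i unfolding w_def by (simp add: polyfun_diff p1 p2)
    define J where "J = (\<lambda>x. n \<bullet> w x)"
    have pJ: "polyfun m J" unfolding J_def inner_vec_def by (auto intro!: polyfun_sum polyfun_cmult w)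
    \<comment> \<open>\<open>J\<close> may grow in the normal direction. Its extension from the
      plane is bounded by values on the plane, where the bounds along lines apply, and it does not
      change the surface integral.\<close>
    define J0 where "J0 = (\<lambda>x. J (x - (n \<bullet> (x - y)) *\<^sub>R n))"
    have pJ0: "polyfun m J0" unfolding J0_def by (rule polyfun_project[OF pJ])
    have tJ0: "tame J0" by (rule polyfun_imp_tame[OF pJ0])
    have J0J: "J0 x = J x" if "n \<bullet> (x - y) = 0" for x using that by (simp add: J0_def)
    have px: "n \<bullet> (?x z - y) = 0" for z
      using ya n by (simp add: inner_diff_right inner_add_right)
    from core[OF polyfun_line_poly[OF pJ0] tame_continuous_on[OF tJ0] \<rho>, of n y] obtain x1 where
      nx1: "n \<bullet> (x1 - y) = 0" and x1: "dist y x1 \<le> \<rho> / 2"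
      and up: "\<And>x. n \<bullet> (x - y) = 0 \<Longrightarrow> dist y x \<le> R * \<rho> \<Longrightarrow> \<bar>J0 x\<bar> \<le> C * \<bar>J0 x1\<bar>"
      and dr: "\<And>x v f'. n \<bullet> (x - y) = 0 \<Longrightarrow> dist y x \<le> \<rho> \<Longrightarrow> n \<bullet> v = 0 \<Longrightarrow> (J0 has_derivative f') (at x) \<Longrightarrow> \<bar>f' v\<bar> \<le> C * \<bar>J0 x1\<bar> * norm v / \<rho>"
      and low: "\<And>x. n \<bullet> (x - y) = 0 \<Longrightarrow> dist x1 x \<le> \<rho> / C \<Longrightarrow> \<bar>J0 x1\<bar> / 2 \<le> \<bar>J0 x\<bar>"
      by auto
    define M where "M = \<bar>J0 x1\<bar>"
    have M: "0 \<le> M" by (simp add: M_def)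
    define \<phi> where "\<phi> = (\<lambda>x. bump y \<rho> x * J0 x)"
    have t\<phi>: "tame \<phi>" unfolding \<phi>_def by (rule tame.mult[OF tame_bump tJ0])
    have \<phi>0: "\<phi> x = 0" if "\<rho> \<le> dist y x" for x using that \<rho> by (simp add: \<phi>_def bump_eq_0)
    have b\<phi>: "bounded {x. \<phi> x \<noteq> 0}"
    proof (rule bounded_subset[OF bounded_cball])
      show "{x. \<phi> x \<noteq> 0} \<subseteq> cball y \<rho>" using \<phi>0 by (force simp: not_le)
    qed
    \<comment> \<open>\<open>P\<close> is the projection onto the face plane and \<open>Q\<close>
      its derivative. Since \<open>J0\<close> is unchanged by \<open>P\<close>, the chain rule turns
      every derivative of \<open>J0\<close> into a tangential one at a point of the plane.\<close>
    define P where "P = (\<lambda>x. x - (n \<bullet> (x - y)) *\<^sub>R n)"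
    define Q where "Q = (\<lambda>v. v - (n \<bullet> v) *\<^sub>R n)"
    have nQ: "n \<bullet> Q v = 0" "norm (Q v) \<le> norm v" for v
    proof -
      show "n \<bullet> Q v = 0" by (simp add: Q_def inner_diff_right nn)
      have "(norm (Q v))\<^sup>2 = (norm v)\<^sup>2 - (n \<bullet> v)\<^sup>2"
        unfolding power2_norm_eq_inner Q_def
        by (simp add: inner_diff_left inner_diff_right inner_commute nn power2_eq_square)
      then have "(norm (Q v))\<^sup>2 \<le> (norm v)\<^sup>2" by simp
      then show "norm (Q v) \<le> norm v" by (rule power2_le_imp_le) simp
    qed
    have Pe: "P x - y = Q (x - y)" for x by (simp add: P_def Q_def)
    have nP: "n \<bullet> (P x - y) = 0" "dist y (P x) \<le> dist y x" for x
    proof -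
      have d: "dist y z = norm (z - y)" for z by (simp add: dist_norm norm_minus_commute)
      show "n \<bullet> (P x - y) = 0" "dist y (P x) \<le> dist y x" unfolding d Pe using nQ by auto
    qed
    have JP: "J0 (P x) = J0 x" for x
      using J0J[OF nP(1)] by (simp add: J0_def P_def)
    have b1: "\<bar>J0 x\<bar> \<le> C * M" if "dist y x \<le> \<rho>" for x
    proof -
      have "dist y (P x) \<le> R * \<rho>" using nP(2)[of x] that R \<rho> mult_right_mono[OF R, of \<rho>] by linarith
      then show ?thesis using up[OF nP(1)] JP M_def by metis
    qed
    have b2: "norm (grad3 J0 x) \<le> C * M / \<rho>" if "dist y x \<le> \<rho>" for x
    proof (rule norm_le_of_inner)
      fix v
      have D: "(J0 has_derivative (\<lambda>v. grad3 J0 z \<bullet> v)) (at z)" for z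
        by (rule has_derivative_grad3[OF tame_differentiable[OF tJ0]])
      have "(P has_derivative Q) (at x)"
        unfolding P_def Q_def by (auto intro!: derivative_eq_intros)
      from has_derivative_compose[OF this D]
      have "(J0 has_derivative (\<lambda>v. grad3 J0 (P x) \<bullet> Q v)) (at x)" by (simp add: JP)
      from has_derivative_unique[OF this D] have "grad3 J0 x \<bullet> v = grad3 J0 (P x) \<bullet> Q v" by metis
      also have "\<bar>\<dots>\<bar> \<le> C * M * norm (Q v) / \<rho>"
        unfolding M_def using nP[of x] that by (intro dr[OF _ _ _ D] nQ) auto
      also have "\<dots> \<le> C * M * norm v / \<rho>"
        using nQ(2)[of v] C4 M \<rho> by (intro divide_right_mono mult_left_mono) auto
      finally show "\<bar>grad3 J0 x \<bullet> v\<bar> \<le> C * M / \<rho> * norm v" by simp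
    qed (use C4 M \<rho> in simp)
    have g: "norm (grad3 \<phi> x) \<le> 5 * (C * M) / \<rho>" "\<rho> < dist y x \<Longrightarrow> grad3 \<phi> x = 0" for x
      unfolding \<phi>_def using norm_grad3_bump_mult_le[OF tJ0 \<rho>, of y "C * M"] b1 b2 by auto
    define V where "V = sqrt (c3 * \<rho> ^ 3)"
    have V: "0 \<le> V" "V\<^sup>2 = c3 * \<rho> ^ 3" using c3 \<rho> by (auto simp: V_def)
    have mB: "sqrt (measure lebesgue ?B) = V"
      using \<rho> by (simp add: content_cball c3_def V_def)
    define ph where "ph = (\<lambda>x. if n \<bullet> (x - a) \<le> 0 then p1 x else p2 x)"
    define e where "e = (\<lambda>x. U x - ph x)"
    have cp: "continuous_on S p1" "continuous_on S p2" for S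
      using tame_continuous_on[OF polyfun_imp_tame[OF p1]] continuous_on_vec_lambda[of S "\<lambda>i x. p1 x $ i"]
        tame_continuous_on[OF polyfun_imp_tame[OF p2]] continuous_on_vec_lambda[of S "\<lambda>i x. p2 x $ i"] by auto
    have pm: "p1 \<in> borel_measurable borel" "p2 \<in> borel_measurable borel"
      using cp by (auto intro: borel_measurable_continuous_onI)
    have phm: "ph \<in> borel_measurable borel"
      unfolding ph_def using pm Hm(1) by (intro measurable_If) (auto simp: space_borel dest: borel_closed)
    obtain c1 where c1: "\<And>x. x \<in> ?B \<Longrightarrow> norm (ph x) \<le> c1"
    proof -
      have "bounded (p1 ` ?B \<union> p2 ` ?B)"
        using cp by (intro bounded_Un[THEN iffD2] conjI compact_imp_bounded compact_continuous_image) auto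
      then obtain k where "\<And>v. v \<in> p1 ` ?B \<union> p2 ` ?B \<Longrightarrow> norm v \<le> k" unfolding bounded_iff by blast
      then have "\<And>x. x \<in> ?B \<Longrightarrow> norm (ph x) \<le> k" by (simp add: ph_def)
      then show ?thesis by (rule that)
    qed
    have phL2: "ph \<in> L2 ?B" using phm c1 by (intro L2_bounded(1)) auto
    have eL2: "e \<in> L2 ?B" unfolding e_def by (rule L2_diff[OF U phL2])
    have eD': "L2norm ?B e \<le> \<Delta>" using eD by (simp add: e_def ph_def)
    have gm: "grad3 \<phi> \<in> borel_measurable borel" by (rule grad3_measurable[OF tame_C1[OF t\<phi>]])
    have g': "norm (grad3 \<phi> x) \<le> 5 * (C * M) / \<rho>" for x using g by simp
    note gL2 = L2_bounded[OF gm lmeasurable_cball g', of y \<rho>]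
    have gn: "L2norm ?B (grad3 \<phi>) \<le> 5 * C * M / \<rho> * V"
      using gL2(2) C4 M \<rho> unfolding mB by (simp add: mult.assoc)
    have C1p: "C1 (\<lambda>x. p1 x $ i)" "C1 (\<lambda>x. p2 x $ i)" "C1 (\<lambda>x. w x $ i)" for i
      by (rule tame_C1[OF polyfun_imp_tame[OF p1]], rule tame_C1[OF polyfun_imp_tame[OF p2]], rule tame_C1[OF polyfun_imp_tame[OF w]])
    note C1\<phi> = tame_C1[OF t\<phi>]
    note ibp2 = integral_inner_grad3[OF C1p(2) C1\<phi> b\<phi>]
    have intH: "integrable lborel (\<lambda>x. indicator ?H x * f x)" if "integrable lborel f" for f :: "real^3 \<Rightarrow> real"
      using integrable_mult_indicator[of ?H lborel f] that Hm by simp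
    have intH': "integrable lborel (\<lambda>x. indicator ?H' x * f x)" if "integrable lborel f" for f :: "real^3 \<Rightarrow> real"
      using integrable_mult_indicator[of ?H' lborel f] that Hm by simp
    note ibpw = integral_inner_grad3(2,3)[OF C1p(3) C1\<phi> b\<phi>]
    \<comment> \<open>The surface integral in face coordinates. The bump vanishes outside the ball,
      whose trace on the plane lies in the triangle, so integrating over all parameters is the same
      as integrating over the face.\<close>
    define S0 where "S0 = norm (cross3 b c) * (LINT z|lborel. bump y \<rho> (?x z) * (J (?x z))\<^sup>2)"
    \<comment> \<open>The half-space formula is applied to each component
      \<open>\<phi> * w $ i\<close>; the factors \<open>n $ i\<close> gather the components to
      \<open>\<phi> * J\<close>, and on the plane \<open>J0\<close> is \<open>J\<close>.\<close>
    have half: "(LINT x|lborel. indicator ?H x * (w x \<bullet> grad3 \<phi> x)) = S0 - (LINT x|lborel. indicator ?H x * (\<phi> x * div3 w x))"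
    proof -
      have c: "C1c (\<lambda>x. \<phi> x * w x $ i)" for i using C1_mult_C1c[OF C1\<phi> C1p(3) b\<phi>] .
      have s: "(LINT x|lborel. indicator ?H x * pderiv3 i (\<lambda>x. \<phi> x * w x $ i) x)
          = n $ i * (norm (cross3 b c) * (LINT z|lborel. \<phi> (?x z) * w (?x z) $ i))" for i
        using integral_grad3_halfspace[OF c n bc, of a i "axis i 1"]
        by (simp add: grad3_def inner_axis)
      have i1: "integrable lborel (\<lambda>x. indicator ?H x * pderiv3 i (\<lambda>x. \<phi> x * w x $ i) x)" for i
        by (rule intH[OF C1c_integrable_pderiv3[OF c]])
      have tri: "?x z \<notin> ?B" if "z \<notin> reference_triangle" for z
        using inn[of "fst z" "snd z"] that by (auto simp: reference_triangle_def case_prod_beta')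
      have i2: "integrable lborel (\<lambda>z. \<phi> (?x z) * w (?x z) $ i)" for i
      proof -
        have "integrable lborel (\<lambda>z. indicator reference_triangle z *\<^sub>R (\<phi> (?x z) * w (?x z) $ i))"
          by (intro borel_integrable_compact reference_triangle_compact continuous_intros
              continuous_on_compose2[OF C1_continuous[OF C1\<phi>, of UNIV]] continuous_on_compose2[OF C1_continuous[OF C1p(3), of UNIV]]) auto
        moreover have "indicator reference_triangle z *\<^sub>R (\<phi> (?x z) * w (?x z) $ i) = \<phi> (?x z) * w (?x z) $ i" for z
          using tri[of z] \<phi>0[of "?x z"] by (auto simp: indicator_def)
        ultimately show ?thesis by (simp only:)
      qed
      let ?F = "\<lambda>i x. indicator ?H x * pderiv3 i (\<lambda>x. \<phi> x * w x $ i) x"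
      have "indicator ?H x * (w x \<bullet> grad3 \<phi> x) = (\<Sum>i\<in>UNIV. ?F i x) - indicator ?H x * (\<phi> x * div3 w x)" for x
        unfolding inner_grad3[OF C1p(3) C1\<phi>] right_diff_distrib sum_distrib_left ..
      then have "(LINT x|lborel. indicator ?H x * (w x \<bullet> grad3 \<phi> x)) =
          (LINT x|lborel. (\<Sum>i\<in>UNIV. ?F i x) - indicator ?H x * (\<phi> x * div3 w x))" by (simp only:)
      also have "\<dots> = (LINT x|lborel. (\<Sum>i\<in>UNIV. ?F i x)) - (LINT x|lborel. indicator ?H x * (\<phi> x * div3 w x))"
        by (rule Bochner_Integration.integral_diff[OF Bochner_Integration.integrable_sum[OF i1] intH[OF ibpw(2)]])
      also have "(LINT x|lborel. (\<Sum>i\<in>UNIV. ?F i x)) = (\<Sum>i\<in>UNIV. LINT x|lborel. ?F i x)"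
        by (rule Bochner_Integration.integral_sum[OF i1])
      also have "\<dots> = norm (cross3 b c) * (\<Sum>i\<in>UNIV. LINT z|lborel. n $ i * (\<phi> (?x z) * w (?x z) $ i))"
        by (simp only: s integral_mult_right_zero sum_distrib_left mult.left_commute[of "norm (cross3 b c)"])
      also have "(\<Sum>i\<in>UNIV. LINT z|lborel. n $ i * (\<phi> (?x z) * w (?x z) $ i)) = (LINT z|lborel. (\<Sum>i\<in>UNIV. n $ i * (\<phi> (?x z) * w (?x z) $ i)))"
        by (rule Bochner_Integration.integral_sum[symmetric]) (intro integrable_mult_right i2)
      also have "\<dots> = (LINT z|lborel. bump y \<rho> (?x z) * (J (?x z))\<^sup>2)"
      proof (rule Bochner_Integration.integral_cong[OF refl])
        fix z
        have "(\<Sum>i\<in>UNIV. n $ i * (\<phi> (?x z) * w (?x z) $ i)) = \<phi> (?x z) * J (?x z)"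
          by (simp add: J_def inner_vec_def sum_distrib_left mult.left_commute)
        then show "(\<Sum>i\<in>UNIV. n $ i * (\<phi> (?x z) * w (?x z) $ i)) = bump y \<rho> (?x z) * (J (?x z))\<^sup>2"
          by (simp add: \<phi>_def J0J[OF px] power2_eq_square)
      qed
      finally show ?thesis unfolding S0_def .
    qed
    have \<phi>m: "\<phi> \<in> borel_measurable borel"
      by (rule borel_measurable_continuous_onI[OF C1_continuous[OF C1\<phi>]])
    have cdiv: "continuous_on UNIV (div3 q)" if "\<And>i. C1 (\<lambda>x. q x $ i)" for q
      unfolding div3_def[abs_def] using that by (intro continuous_on_sum) (auto simp: C1_def)
    have \<phi>b: "norm (\<phi> x) \<le> C * M" if "x \<in> ?B" for x
    proof -
      have "norm (\<phi> x) = bump y \<rho> x * \<bar>J0 x\<bar>" using bump_nonneg by (simp add: \<phi>_def abs_mult)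
      also have "\<dots> \<le> 1 * (C * M)" using b1[of x] that bump_le_1 bump_nonneg by (intro mult_mono) auto
      finally show ?thesis by simp
    qed
    \<comment> \<open>As \<open>\<phi>\<close> is supported in the ball, the closed set
      \<open>HH\<close> may be replaced by its part in the ball, where Cauchy-Schwarz meets the
      assumed bound on the divergence.\<close>
    have divb: "\<bar>LINT x|lborel. indicator HH x * (\<phi> x * div3 q x)\<bar> \<le> C * M * V * (\<Delta> / \<rho>)"
      if HH: "closed HH" and q: "\<And>i. C1 (\<lambda>x. q x $ i)" and dq: "\<rho> * L2norm (?B \<inter> HH) (div3 q) \<le> \<Delta>" for HH q
    proof -
      have cpt: "compact (?B \<inter> HH)" using HH by (rule compact_Int_closed[OF compact_cball])
      have lm: "?B \<inter> HH \<in> lmeasurable" using cpt by (rule lmeasurable_compact)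
      have f2: "\<phi> \<in> L2 (?B \<inter> HH)" "L2norm (?B \<inter> HH) \<phi> \<le> C * M * V"
      proof -
        have fb: "norm (\<phi> x) \<le> C * M" if "x \<in> ?B \<inter> HH" for x using \<phi>b that by blast
        show "\<phi> \<in> L2 (?B \<inter> HH)" by (rule L2_bounded(1)[OF \<phi>m lm fb])
        have "L2norm (?B \<inter> HH) \<phi> \<le> \<bar>C * M\<bar> * sqrt (measure lebesgue (?B \<inter> HH))"
          by (rule L2_bounded(2)[OF \<phi>m lm fb])
        also have "\<dots> \<le> \<bar>C * M\<bar> * V"
          unfolding mB[symmetric] using lm
          by (intro mult_left_mono real_sqrt_le_mono measure_mono_fmeasurable) (auto intro: fmeasurableD)
        finally show "L2norm (?B \<inter> HH) \<phi> \<le> C * M * V" using C4 M by simp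
      qed
      have dL2: "div3 q \<in> L2 (?B \<inter> HH)" by (rule L2_continuous[OF cdiv[OF q] cpt])
      have "(LINT x|lebesgue_on (?B \<inter> HH). \<phi> x \<bullet> div3 q x) = (LINT x|lborel. indicator (?B \<inter> HH) x * (\<phi> x * div3 q x))"
        using \<phi>m borel_measurable_continuous_onI[OF cdiv[OF q]] borel_compact[OF cpt]
        by (subst lebesgue_on_integral_borel) auto
      also have "\<dots> = (LINT x|lborel. indicator HH x * (\<phi> x * div3 q x))"
        using \<phi>0 by (intro Bochner_Integration.integral_cong) (force simp: indicator_def not_le)+
      finally have "\<bar>LINT x|lborel. indicator HH x * (\<phi> x * div3 q x)\<bar> \<le> L2norm (?B \<inter> HH) \<phi> * L2norm (?B \<inter> HH) (div3 q)"
        using L2_Cauchy_Schwarz(2)[OF f2(1) dL2] by simp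
      also have "\<dots> \<le> (C * M * V) * (\<Delta> / \<rho>)"
        using f2(2) dq \<rho> C4 M V L2norm_nonneg by (intro mult_mono) (auto simp: field_simps)
      finally show ?thesis .
    qed
    have plane: "negligible {x. n \<bullet> (x - a) = 0}"
    proof -
      have "n \<noteq> 0" using n(1) by auto
      then show ?thesis using negligible_hyperplane[of n "n \<bullet> a"] by (simp add: inner_diff_right)
    qed
    \<comment> \<open>The divergence terms are regrouped by sides. The plane belongs to both closed
      half-spaces, but it is a null set.\<close>
    have split: "(LINT x|lborel. \<phi> x * div3 p2 x) + (LINT x|lborel. indicator ?H x * (\<phi> x * div3 w x))
        = (LINT x|lborel. indicator ?H x * (\<phi> x * div3 p1 x)) + (LINT x|lborel. indicator ?H' x * (\<phi> x * div3 p2 x))"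
    proof -
      have dw: "div3 w x = div3 p1 x - div3 p2 x" for x
      proof -
        have "pderiv3 i (\<lambda>x. w x $ i) x = pderiv3 i (\<lambda>x. p1 x $ i) x - pderiv3 i (\<lambda>x. p2 x $ i) x" for i
        proof -
          have "((\<lambda>x. p1 x $ i - p2 x $ i) has_derivative
              (\<lambda>v. grad3 (\<lambda>x. p1 x $ i) x \<bullet> v - grad3 (\<lambda>x. p2 x $ i) x \<bullet> v)) (at x)"
            by (intro has_derivative_diff has_derivative_grad3) (use C1p in \<open>auto simp: C1_def\<close>)
          from pderiv3_unique[OF this, of i] show ?thesis by (simp add: w_def inner_axis grad3_def)
        qed
        then show ?thesis by (simp add: div3_def sum_subtractf)
      qed
      note ibp1 = integral_inner_grad3(3)[OF C1p(1) C1\<phi> b\<phi>]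
      have ae: "AE x in lborel. \<phi> x * div3 p2 x + indicator ?H x * (\<phi> x * div3 w x)
          = indicator ?H x * (\<phi> x * div3 p1 x) + indicator ?H' x * (\<phi> x * div3 p2 x)"
      proof -
        have "AE x in lebesgue. x \<notin> {x. n \<bullet> (x - a) = 0}"
          using plane by (simp only: AE_not_in negligible_iff_null_sets)
        moreover have "{x. n \<bullet> (x - a) = 0} \<in> sets borel"
          by (intro borel_closed closed_Collect_eq continuous_intros)
        ultimately have "AE x in lborel. x \<notin> {x. n \<bullet> (x - a) = 0}"
          by (simp add: AE_completion_iff)
        then show ?thesis by eventually_elim (auto simp: indicator_def dw algebra_simps)
      qed
      have "(LINT x|lborel. \<phi> x * div3 p2 x + indicator ?H x * (\<phi> x * div3 w x))
          = (LINT x|lborel. indicator ?H x * (\<phi> x * div3 p1 x) + indicator ?H' x * (\<phi> x * div3 p2 x))"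
        by (rule integral_cong_AE[OF _ _ ae])
          (use ibp2(3) intH[OF ibpw(2)] intH[OF ibp1] intH'[OF ibp2(3)] in auto)
      then show ?thesis using ibp2(3) intH[OF ibpw(2)] intH[OF ibp1] intH'[OF ibp2(3)] by simp
    qed
    have "L2inner ?B ph (grad3 \<phi>) = (LINT x|lborel. p2 x \<bullet> grad3 \<phi> x) + (LINT x|lborel. indicator ?H x * (w x \<bullet> grad3 \<phi> x))"
    proof -
      have "L2inner ?B ph (grad3 \<phi>) = (LINT x|lborel. indicator ?B x * (ph x \<bullet> grad3 \<phi> x))"
        unfolding L2inner_def using phm gm by (intro lebesgue_on_integral_borel) auto
      also have "\<dots> = (LINT x|lborel. p2 x \<bullet> grad3 \<phi> x + indicator ?H x * (w x \<bullet> grad3 \<phi> x))"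
        using g(2) by (intro Bochner_Integration.integral_cong) (auto simp: indicator_def ph_def w_def not_le inner_diff_left)
      also have "\<dots> = (LINT x|lborel. p2 x \<bullet> grad3 \<phi> x) + (LINT x|lborel. indicator ?H x * (w x \<bullet> grad3 \<phi> x))"
        by (rule Bochner_Integration.integral_add[OF ibp2(2) intH[OF ibpw(1)]])
      finally show ?thesis .
    qed
    then have S0: "S0 = L2inner ?B ph (grad3 \<phi>)
        + ((LINT x|lborel. indicator ?H x * (\<phi> x * div3 p1 x)) + (LINT x|lborel. indicator ?H' x * (\<phi> x * div3 p2 x)))"
      using ibp2(1) half split by linarith
    have "L2inner ?B e (grad3 \<phi>) = L2inner ?B U (grad3 \<phi>) - L2inner ?B ph (grad3 \<phi>)"
      unfolding L2inner_def e_def inner_diff_left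
      by (rule Bochner_Integration.integral_diff[OF L2_Cauchy_Schwarz(1)[OF U gL2(1)] L2_Cauchy_Schwarz(1)[OF phL2 gL2(1)]])
    moreover have "L2inner ?B U (grad3 \<phi>) = 0" by (rule orth[OF t\<phi> \<phi>0])
    moreover have "\<bar>L2inner ?B e (grad3 \<phi>)\<bar> \<le> \<Delta> * (5 * C * M / \<rho> * V)"
    proof -
      have "\<bar>L2inner ?B e (grad3 \<phi>)\<bar> \<le> L2norm ?B e * L2norm ?B (grad3 \<phi>)"
        using L2_Cauchy_Schwarz(2)[OF eL2 gL2(1)] by (simp add: L2inner_def)
      also have "\<dots> \<le> \<Delta> * (5 * C * M / \<rho> * V)" using eD' gn \<Delta> L2norm_nonneg by (intro mult_mono) auto
      finally show ?thesis .
    qed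
    ultimately have "S0 \<le> \<Delta> * (5 * C * M / \<rho> * V) + C * M * V * (\<Delta> / \<rho>) + C * M * V * (\<Delta> / \<rho>)"
      using S0 divb[OF Hm(1) C1p(1) d1] divb[OF Hm(2) C1p(2) d2] by linarith
    also have "\<dots> = 7 * C * V * \<Delta> * M / \<rho>" by (simp add: field_simps)
    finally have upper: "S0 \<le> 7 * C * V * \<Delta> * M / \<rho>" .
    let ?S = "{z. dist x1 (?x z) \<le> \<rho> / C}"
    have Sc: "closed ?S" by (intro closed_Collect_le continuous_intros)
    have \<rho>C: "\<rho> / C \<le> \<rho> / 4" using C4 \<rho> by (intro divide_left_mono) auto
    have Sn: "dist y (?x z) \<le> 3 / 4 * \<rho>" if "z \<in> ?S" for z
      using that x1 \<rho>C dist_triangle[of y "?x z" x1] unfolding mem_Collect_eq by linarith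
    have "?S \<subseteq> reference_triangle"
    proof
      fix z assume z: "z \<in> ?S"
      have "dist y (a + fst z *\<^sub>R b + snd z *\<^sub>R c) \<le> \<rho>" using Sn[OF z] \<rho> by linarith
      then show "z \<in> reference_triangle" using inn[of "fst z" "snd z"]
        by (auto simp: reference_triangle_def case_prod_beta')
    qed
    then have Sb: "bounded ?S" using reference_triangle_compact compact_imp_bounded bounded_subset by blast
    have SS: "?S \<in> sets lborel" "emeasure lborel ?S < \<infinity>"
      using Sc Sb emeasure_bounded_finite by auto
    \<comment> \<open>The disc of radius \<open>\<rho> / C\<close> around \<open>x1\<close> carries
      enough of the integral, and its area is bounded below through the volume of the ball with the
      same centre and radius.\<close>
    have lower: "A * M\<^sup>2 * \<rho>\<^sup>2 \<le> S0"
    proof -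
      have nx1a: "n \<bullet> (x1 - a) = 0" using nx1 ya by (simp add: inner_diff_right)
      have "c3 * (\<rho> / C) ^ 3 \<le> norm (cross3 b c) * (2 * (\<rho> / C) * measure lborel ?S)"
        using measure_ball_le_slab[OF n bc _ nx1a SS, of "\<rho> / C"] \<rho> C4 by (simp add: content_cball c3_def)
      then have "c3 * (\<rho> / C)\<^sup>2 * (\<rho> / C) \<le> (2 * (norm (cross3 b c) * measure lborel ?S)) * (\<rho> / C)"
        by (simp add: power2_eq_square power3_eq_cube mult_ac)
      then have "c3 * (\<rho> / C)\<^sup>2 \<le> 2 * (norm (cross3 b c) * measure lborel ?S)"
        using \<rho> C4 by (subst (asm) mult_le_cancel_right_pos) auto
      then have "(exp (- 3) * (M / 2)\<^sup>2 / 2) * (c3 * (\<rho> / C)\<^sup>2) \<le> (exp (- 3) * (M / 2)\<^sup>2 / 2) * (2 * (norm (cross3 b c) * measure lborel ?S))"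
        by (rule mult_left_mono) simp
      moreover have "(exp (- 3) * (M / 2)\<^sup>2 / 2) * (c3 * (\<rho> / C)\<^sup>2) = A * M\<^sup>2 * \<rho>\<^sup>2"
        by (simp add: A_def power_divide)
      moreover have "(exp (- 3) * (M / 2)\<^sup>2 / 2) * (2 * (norm (cross3 b c) * measure lborel ?S))
          = norm (cross3 b c) * (exp (- 3) * (M / 2)\<^sup>2 * measure lborel ?S)" by simp
      ultimately have "A * M\<^sup>2 * \<rho>\<^sup>2 \<le> norm (cross3 b c) * (exp (- 3) * (M / 2)\<^sup>2 * measure lborel ?S)" by (simp only:)
      also have "exp (- 3) * (M / 2)\<^sup>2 * measure lborel ?S = (LINT z|lborel. exp (- 3) * (M / 2)\<^sup>2 * indicator ?S z)"
        using SS by simp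
      also have "\<dots> \<le> (LINT z|lborel. bump y \<rho> (?x z) * (J (?x z))\<^sup>2)"
      proof (rule integral_mono)
        show "integrable lborel (\<lambda>z. exp (- 3) * (M / 2)\<^sup>2 * indicator ?S z)" using SS by simp
        have "integrable lborel (\<lambda>z. indicator reference_triangle z *\<^sub>R (bump y \<rho> (?x z) * (J (?x z))\<^sup>2))"
          by (intro borel_integrable_compact reference_triangle_compact continuous_intros
              continuous_on_compose2[OF tame_continuous_on[OF tame_bump, of UNIV]]
              continuous_on_compose2[OF tame_continuous_on[OF polyfun_imp_tame[OF pJ], of UNIV]]) auto
        moreover have "indicator reference_triangle z *\<^sub>R (bump y \<rho> (?x z) * (J (?x z))\<^sup>2) = bump y \<rho> (?x z) * (J (?x z))\<^sup>2" for z
          using inn[of "fst z" "snd z"] bump_eq_0[OF \<rho>, of y "?x z"]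
          by (cases "dist y (?x z) \<le> \<rho>") (auto simp: indicator_def reference_triangle_def case_prod_beta')
        ultimately show "integrable lborel (\<lambda>z. bump y \<rho> (?x z) * (J (?x z))\<^sup>2)" by (simp only:)
        show "exp (- 3) * (M / 2)\<^sup>2 * indicator ?S z \<le> bump y \<rho> (?x z) * (J (?x z))\<^sup>2" for z
        proof (cases "z \<in> ?S")
          case True
          have "exp (- 3) \<le> bump y \<rho> (?x z)" by (rule bump_lower[OF \<rho> Sn[OF True]])
          moreover have "(M / 2)\<^sup>2 \<le> (J (?x z))\<^sup>2"
          proof (rule iffD1[OF abs_le_square_iff])
            show "\<bar>M / 2\<bar> \<le> \<bar>J (?x z)\<bar>" using low[OF px, of z] True M J0J[OF px] by (simp add: M_def)
          qed
          ultimately have "exp (- 3) * (M / 2)\<^sup>2 \<le> bump y \<rho> (?x z) * (J (?x z))\<^sup>2" by (intro mult_mono bump_nonneg) auto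
          then show ?thesis using True by simp
        qed (simp add: bump_nonneg)
      qed
      finally show ?thesis unfolding S0_def by (simp add: mult_left_mono)
    qed
    have main: "A * M * \<rho> ^ 3 \<le> 7 * C * V * \<Delta>"
    proof (cases "M = 0")
      case True
      then show ?thesis using C4 V \<Delta> by simp
    next
      case False
      have "A * M\<^sup>2 * \<rho>\<^sup>2 * \<rho> \<le> 7 * C * V * \<Delta> * M / \<rho> * \<rho>" using upper lower \<rho> by (intro mult_right_mono) auto
      then have "(A * M * \<rho> ^ 3) * M \<le> (7 * C * V * \<Delta>) * M" using \<rho> by (simp add: power2_eq_square power3_eq_cube mult_ac)
      then show ?thesis by (rule mult_right_le_imp_le) (use False M in simp)
    qed
    define I where "I = (LINT z|lebesgue_on reference_triangle. (n \<bullet> (p1 (?x z) - p2 (?x z)))\<^sup>2)"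
    have I: "0 \<le> I" "I \<le> (C * M)\<^sup>2"
    proof -
      show "0 \<le> I" by (simp add: I_def)
      have lt: "reference_triangle \<in> lmeasurable" by (rule lmeasurable_compact[OF reference_triangle_compact])
      have "I \<le> (LINT z|lebesgue_on reference_triangle. (C * M)\<^sup>2)"
        unfolding I_def
      proof (rule integral_mono')
        show "integrable (lebesgue_on reference_triangle) (\<lambda>z. (C * M)\<^sup>2)"
          using finite_measure_lebesgue_on[OF lt] by (rule finite_measure.integrable_const)
        fix z assume "z \<in> space (lebesgue_on reference_triangle)"
        then have z: "z \<in> reference_triangle" by simp
        have "dist y (?x z) \<le> R * \<rho>" using z by (intro out) (auto simp: reference_triangle_def)
        then have "\<bar>J (?x z)\<bar> \<le> C * M" using up[OF px, of z] J0J[OF px] by (simp add: M_def)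
        then have "\<bar>J (?x z)\<bar>\<^sup>2 \<le> (C * M)\<^sup>2" by (rule power_mono) simp
        then show "(n \<bullet> (p1 (?x z) - p2 (?x z)))\<^sup>2 \<le> (C * M)\<^sup>2" by (simp add: J_def w_def)
      qed simp
      also have "\<dots> = (C * M)\<^sup>2 * measure lebesgue reference_triangle"
        using lt by (simp add: measure_restrict_space fmeasurableD)
      also have "\<dots> \<le> (C * M)\<^sup>2 * 1" by (rule mult_left_mono[OF measure_reference_triangle_le]) simp
      finally show "I \<le> (C * M)\<^sup>2" by simp
    qed
    \<comment> \<open>The parameters \<open>(0, 0)\<close>, \<open>(1, 0)\<close>,
      \<open>(0, 1)\<close> give the vertices, each within \<open>R * \<rho>\<close> of
      \<open>y\<close>; the edges are their differences.\<close>
    have nb: "norm b \<le> 2 * R * \<rho>" "norm c \<le> 2 * R * \<rho>"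
    proof -
      have "norm b = dist (a + 0 *\<^sub>R b + 0 *\<^sub>R c) (a + 1 *\<^sub>R b + 0 *\<^sub>R c)" by (simp add: dist_norm)
      also have "\<dots> \<le> dist y (a + 0 *\<^sub>R b + 0 *\<^sub>R c) + dist y (a + 1 *\<^sub>R b + 0 *\<^sub>R c)" by (metis dist_commute dist_triangle)
      also have "\<dots> \<le> R * \<rho> + R * \<rho>" by (intro add_mono out) auto
      finally show "norm b \<le> 2 * R * \<rho>" by simp
      have "norm c = dist (a + 0 *\<^sub>R b + 0 *\<^sub>R c) (a + 0 *\<^sub>R b + 1 *\<^sub>R c)" by (simp add: dist_norm)
      also have "\<dots> \<le> dist y (a + 0 *\<^sub>R b + 0 *\<^sub>R c) + dist y (a + 0 *\<^sub>R b + 1 *\<^sub>R c)" by (metis dist_commute dist_triangle)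
      also have "\<dots> \<le> R * \<rho> + R * \<rho>" by (intro add_mono out) auto
      finally show "norm c \<le> 2 * R * \<rho>" by simp
    qed
    have "(norm (cross3 b c))\<^sup>2 \<le> (norm b * norm c)\<^sup>2" using norm_cross[of b c] by (simp add: power_mult_distrib)
    then have "norm (cross3 b c) \<le> norm b * norm c" by (rule power2_le_imp_le) simp
    also have "\<dots> \<le> (2 * R * \<rho>) * (2 * R * \<rho>)" using nb R \<rho> by (intro mult_mono) auto
    finally have "norm (cross3 b c) \<le> (2 * R * \<rho>)\<^sup>2" by (simp only: power2_eq_square)
    then have "norm (cross3 b c) * I \<le> (2 * R * \<rho>)\<^sup>2 * (C * M)\<^sup>2"
      using I by (intro mult_mono) auto
    then have "sqrt (norm (cross3 b c) * I) \<le> sqrt ((2 * R * \<rho> * (C * M))\<^sup>2)"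
      by (intro real_sqrt_le_mono) (simp add: power_mult_distrib)
    then have sI: "sqrt (norm (cross3 b c) * I) \<le> 2 * R * \<rho> * (C * M)" using R \<rho> C4 M by simp
    have Vs: "sqrt \<rho> * \<rho> * sqrt c3 = V"
    proof -
      have "\<rho> ^ 3 = \<rho> * \<rho>\<^sup>2" by (simp add: power2_eq_square power3_eq_cube)
      then show ?thesis using \<rho> unfolding V_def by (simp add: real_sqrt_mult mult_ac)
    qed
    have "sqrt \<rho> * sqrt (norm (cross3 b c) * I) \<le> sqrt \<rho> * (2 * R * \<rho> * (C * M))"
      using sI \<rho> by (intro mult_left_mono) auto
    also have "\<dots> \<le> C' * \<Delta>"
    proof -
      have "(A * \<rho> ^ 3 * sqrt c3) * (sqrt \<rho> * (2 * R * \<rho> * (C * M))) = 2 * R * C * (sqrt \<rho> * \<rho> * sqrt c3) * (A * M * \<rho> ^ 3)"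
        by (simp add: mult_ac)
      also have "\<dots> = 2 * R * C * V * (A * M * \<rho> ^ 3)" by (simp only: Vs)
      also have "\<dots> \<le> 2 * R * C * V * (7 * C * V * \<Delta>)" using main R C4 V by (intro mult_left_mono) auto
      also have "\<dots> = 14 * C\<^sup>2 * R * V\<^sup>2 * \<Delta>" by (simp add: power2_eq_square)
      also have "\<dots> = (A * \<rho> ^ 3 * sqrt c3) * (C' * \<Delta>)"
      proof -
        have "sqrt c3 * sqrt c3 = c3" using c3 by simp
        then have "V\<^sup>2 = \<rho> ^ 3 * (sqrt c3 * sqrt c3)" unfolding V(2) by simp
        then show ?thesis using A unfolding C'_def by (simp add: mult_ac)
      qed
      finally show ?thesis using A \<rho> c3 by (simp add: mult_le_cancel_left_pos)
    qed
    finally show "sqrt \<rho> * sqrt (norm (cross3 b c) * (LINT z|lebesgue_on reference_triangle.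
         (n \<bullet> (p1 (?x z) - p2 (?x z)))\<^sup>2)) \<le> C' * \<Delta>"
      unfolding I_def .
  qed
qed

section \<open>Piecewise polynomial approximations of a divergence-free field\<close>

text \<open>Vanishing of the weak curl and of the tangential trace is one identity here: the
  gradient of \<open>\<phi>\<close> is orthogonal to the curl of every smooth field, whether that
  field is supported in \<open>\<Omega>\<close> or not.\<close>

lemma eigenpair_div_free:
  assumes ep: "mixed_eigenpair \<Omega> (H0curl \<Omega>) lam u \<sigma>" and op: "open \<Omega>" and bd: "bounded \<Omega>"
    and \<phi>: "tame \<phi>" and supp: "supported_in \<Omega> \<phi>"
  shows "L2inner \<Omega> u (grad3 \<phi>) = 0"
proof -
  have C1\<phi>: "C1 \<phi>" by (rule tame_C1[OF \<phi>])
  have gm: "grad3 \<phi> \<in> borel_measurable borel" by (rule grad3_measurable[OF C1\<phi>])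
  have b\<phi>: "bounded {x. \<phi> x \<noteq> 0}"
    using supp unfolding supported_in_def by (meson bounded_subset closure_subset compact_imp_bounded)
  have g0: "grad3 \<phi> x = 0" if "x \<notin> \<Omega>" for x
  proof (rule grad3_eq_0)
    show "open (- closure {x. \<phi> x \<noteq> 0})" by (rule open_Compl[OF closed_closure])
    show "x \<in> - closure {x. \<phi> x \<noteq> 0}" using supp that unfolding supported_in_def by blast
    show "\<phi> y = 0" if "y \<in> - closure {x. \<phi> x \<noteq> 0}" for y
      using that closure_subset[of "{x. \<phi> x \<noteq> 0}"] by blast
  qed
  have cg: "continuous_on UNIV (grad3 \<phi>)"
    unfolding grad3_def[abs_def] using C1\<phi> by (intro continuous_on_vec_lambda) (simp add: C1_def)
  have "grad3 \<phi> \<in> L2 (closure \<Omega>)" using bd by (intro L2_continuous[OF cg]) (simp add: compact_closure)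
  then have gL2: "grad3 \<phi> \<in> L2 \<Omega>"
    by (rule L2_subset(1)) (use op closure_subset in auto)
  have zL2: "(\<lambda>x. 0) \<in> L2 \<Omega>" by (simp add: L2_def)
  have curl0: "L2inner \<Omega> (grad3 \<phi>) (curl3 \<psi>) = 0" if \<psi>: "smooth_field3 \<psi>" for \<psi>
  proof -
    have s: "C1 (\<lambda>x. \<psi> x $ i)" for i using \<psi> by (simp add: smooth_field3_def smooth3_C1)
    have "continuous_on UNIV (\<lambda>x. grad3 \<phi> x \<bullet> curl3 \<psi> x)"
      using s C1\<phi> unfolding inner_vec_def sum_3 grad3_def curl3_def vector_3 vec_lambda_beta inner_real_def C1_def
      by (intro continuous_intros) auto
    then have "(LINT x|lebesgue_on \<Omega>. grad3 \<phi> x \<bullet> curl3 \<psi> x) = (LINT x|lborel. indicator \<Omega> x * (grad3 \<phi> x \<bullet> curl3 \<psi> x))"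
      using op by (intro lebesgue_on_integral_borel borel_measurable_continuous_onI) auto
    also have "\<dots> = (LINT x|lborel. grad3 \<phi> x \<bullet> curl3 \<psi> x)"
      using g0 by (intro Bochner_Integration.integral_cong) (auto simp: indicator_def)
    also have "\<dots> = 0" by (rule integral_grad3_curl3[OF \<phi> b\<phi> \<psi>])
    finally show ?thesis by (simp add: L2inner_def)
  qed
  have wc: "has_weak_curl \<Omega> (grad3 \<phi>) (\<lambda>x. 0)"
    using gL2 zL2 curl0 by (simp add: has_weak_curl_def L2inner_def)
  then have "grad3 \<phi> \<in> H0curl \<Omega>"
    using curl0 unfolding H0curl_def by (auto simp: L2inner_def intro!: exI[of _ "\<lambda>x. 0"])
  then have "L2inner \<Omega> u (grad3 \<phi>) - L2inner \<Omega> (\<lambda>x. 0) \<sigma> = 0"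
    using ep wc unfolding mixed_eigenpair_def by blast
  then show ?thesis by (simp add: L2inner_def)
qed

text \<open>Measurability is asked of \<open>f\<close> alone. The other function will be a jump,
  given by limits at each point, and completeness of the measure transfers measurability to
  it.\<close>

lemma integral_lebesgue_on_cong_negligible:
  fixes f g :: "'a::euclidean_space \<Rightarrow> real"
  assumes f: "f \<in> borel_measurable borel" and S: "S \<in> sets lebesgue"
    and N: "negligible N" "\<And>x. x \<in> S \<Longrightarrow> x \<notin> N \<Longrightarrow> g x = f x"
  shows "(LINT x|lebesgue_on S. g x) = (LINT x|lebesgue_on S. f x)"
proof -
  have "AE x in lebesgue. x \<notin> N" using N(1) by (simp add: AE_not_in negligible_iff_null_sets)
  then have ae: "AE x in lebesgue. indicator S x *\<^sub>R f x = indicator S x *\<^sub>R g x"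
    by eventually_elim (use N in \<open>auto simp: indicator_def\<close>)
  have "f \<in> borel_measurable lebesgue" using f by (intro measurable_completion) simp
  then have fm: "(\<lambda>x. indicator S x *\<^sub>R f x) \<in> borel_measurable lebesgue"
    using borel_measurable_indicator[OF S] by (intro borel_measurable_scaleR)
  have gm: "(\<lambda>x. indicator S x *\<^sub>R g x) \<in> borel_measurable lebesgue"
    by (rule borel_measurable_AE[OF fm ae])
  have "(LINT x|lebesgue. indicator S x *\<^sub>R f x) = (LINT x|lebesgue. indicator S x *\<^sub>R g x)"
    by (rule integral_cong_AE[OF fm gm ae])
  then show ?thesis using S by (simp add: integral_restrict_space)
qed

text \<open>Collects the setting of both estimates for one mesh. Constants may depend on
  \<open>\<kappa>\<close> and \<open>m\<close> only, so the estimates that produce them are stated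
  outside the locale, with its predicate as a premise: the constant is then chosen before domain,
  mesh and fields.\<close>

locale piecewise_approximation =
  fixes \<Omega> :: "(real^3) set" and T :: "(real^3) set set" and \<kappa> :: real and m :: nat
    and u w :: "real^3 \<Rightarrow> real^3"
  assumes op: "open \<Omega>" and int_closure: "interior (closure \<Omega>) \<subseteq> \<Omega>"
    and mesh: "tetrahedral_mesh \<Omega> T"
    and \<kappa>: "1 \<le> \<kappa>" and shape: "\<And>K. K \<in> T \<Longrightarrow> diameter K \<le> \<kappa> * inball_diameter K"
    and u: "u \<in> L2 \<Omega>" and div_free: "\<And>\<phi>. tame \<phi> \<Longrightarrow> supported_in \<Omega> \<phi> \<Longrightarrow> L2inner \<Omega> u (grad3 \<phi>) = 0"
    and w: "w \<in> L2 \<Omega>"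
    and loc: "\<And>K. K \<in> T \<Longrightarrow> \<exists>p. (\<forall>i. polyfun m (\<lambda>x. p x $ i)) \<and> (\<forall>x\<in>interior K. w x = p x)"
begin

definition err :: "real^3 \<Rightarrow> real^3" where "err = (\<lambda>x. u x - w x)"

lemma tri: "triangulation T" and simp3: "K \<in> T \<Longrightarrow> 3 simplex K" and Un: "\<Union>T = closure \<Omega>"
  and fin: "finite T"
  using mesh by (auto simp: tetrahedral_mesh_def triangulation_def)

lemma compact_el: "K \<in> T \<Longrightarrow> compact K"
  using simp3 compact_simplex by blast

lemma convex_el: "K \<in> T \<Longrightarrow> convex K"
  using simp3 convex_simplex by blast

lemma interior_el: "K \<in> T \<Longrightarrow> interior K \<subseteq> \<Omega>"
  using interior_mono[of K "closure \<Omega>"] int_closure Un by blast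

lemma negl_frontier: "K \<in> T \<Longrightarrow> negligible (frontier K)"
  using convex_el negligible_convex_frontier by blast

text \<open>Closed elements and patches may touch the boundary of \<open>\<Omega>\<close>. Up to the
  boundaries of the elements they are contained in it, which is enough to transfer square-integrable
  fields.\<close>

lemma union_elements:
  assumes "S \<subseteq> T"
  shows "\<Union>S \<in> sets lebesgue" "negligible (\<Union>(frontier ` S))" "\<Union>S - \<Union>(frontier ` S) \<subseteq> \<Omega>"
proof -
  have fS: "finite S" using fin assms finite_subset by blast
  have "compact (\<Union>S)" using fS assms compact_el by (intro compact_Union) auto
  then show "\<Union>S \<in> sets lebesgue" using lmeasurable_compact fmeasurableD by blast
  show "negligible (\<Union>(frontier ` S))" using fS assms negl_frontier by (intro negligible_Union) auto
  show "\<Union>S - \<Union>(frontier ` S) \<subseteq> \<Omega>"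
  proof
    fix x assume "x \<in> \<Union>S - \<Union>(frontier ` S)"
    then obtain K where "K \<in> S" "x \<in> K" "x \<notin> frontier K" by blast
    then have "x \<in> interior K" using closure_subset by (auto simp: frontier_def)
    then show "x \<in> \<Omega>" using interior_el \<open>K \<in> S\<close> assms by blast
  qed
qed

lemma L2_union:
  assumes f: "(f :: real^3 \<Rightarrow> real^3) \<in> L2 \<Omega>" and S: "S \<subseteq> T"
  shows "f \<in> L2 (\<Union>S)"
proof (rule L2_cong_negligible(1))
  note un = union_elements[OF S]
  show "f \<in> L2 (\<Union>S \<inter> \<Omega>)" by (rule L2_subset(1)[OF f]) (use op un(1) in auto)
  show "\<Union>S \<inter> \<Omega> \<in> sets lebesgue" using op un(1) by auto
  show "\<Union>S \<in> sets lebesgue" by (rule un(1))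
  show "negligible (\<Union>(frontier ` S))" by (rule un(2))
  show "\<Union>S - \<Union>(frontier ` S) \<subseteq> \<Union>S \<inter> \<Omega>" using un(3) by blast
qed auto

lemma L2_element: "f \<in> L2 \<Omega> \<Longrightarrow> K \<in> T \<Longrightarrow> (f :: real^3 \<Rightarrow> real^3) \<in> L2 K"
  using L2_union[of f "{K}"] by simp

lemma err: "err \<in> L2 \<Omega>"
  unfolding err_def by (rule L2_diff[OF u w])

lemma err_mono:
  assumes "S \<subseteq> T" "A \<subseteq> \<Union>S" "A \<in> sets lebesgue"
  shows "L2norm A err \<le> L2norm (\<Union>S) err"
  using assms by (intro L2_subset(2)[OF L2_union[OF err]] union_elements(1))

text \<open>A test function supported in a ball does not see the domain of integration: every
  \<open>S\<close> around the ball gives the same integral as \<open>\<Omega>\<close>.\<close>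

lemma orthogonal:
  assumes ball: "cball x0 r \<subseteq> \<Omega>" "cball x0 r \<subseteq> S" and S: "S \<in> sets lebesgue"
    and \<phi>: "tame \<phi>" "\<And>x. r \<le> dist x0 x \<Longrightarrow> \<phi> x = 0"
  shows "L2inner S u (grad3 \<phi>) = 0"
proof -
  have "{x. \<phi> x \<noteq> 0} \<subseteq> cball x0 r" using \<phi>(2) by (force simp: not_le)
  then have sub: "closure {x. \<phi> x \<noteq> 0} \<subseteq> cball x0 r" by (rule closure_minimal) simp
  then have supp: "supported_in \<Omega> \<phi>"
    unfolding supported_in_def using ball(1) bounded_subset[OF bounded_cball] by (auto simp: compact_eq_bounded_closed)
  have g0: "grad3 \<phi> x = 0" if "x \<notin> cball x0 r" for x
    by (rule grad3_eq_0[of "- cball x0 r"]) (use that \<phi>(2) in auto)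
  have "L2inner S u (grad3 \<phi>) = (LINT x|lebesgue. indicator S x *\<^sub>R (u x \<bullet> grad3 \<phi> x))"
    unfolding L2inner_def using S by (simp add: integral_restrict_space)
  also have "\<dots> = (LINT x|lebesgue. indicator \<Omega> x *\<^sub>R (u x \<bullet> grad3 \<phi> x))"
    using g0 ball by (intro Bochner_Integration.integral_cong) (force simp: indicator_def)+
  also have "\<dots> = L2inner \<Omega> u (grad3 \<phi>)"
    unfolding L2inner_def using op by (simp add: integral_restrict_space)
  finally show ?thesis using div_free[OF \<phi>(1) supp] by simp
qed

text \<open>At an interior point \<open>w\<close> agrees with \<open>p\<close> in a neighbourhood,
  so the classical derivatives agree too; the frontier of \<open>K\<close>, where they may not
  exist, is a null set.\<close>

lemma local_polynomial:
  assumes K: "K \<in> T"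
  obtains p where "\<And>i. polyfun m (\<lambda>x. p x $ i)" "\<And>x. x \<in> interior K \<Longrightarrow> w x = p x"
    "L2norm K (div3 w) = L2norm K (div3 p)"
proof -
  obtain p where p: "\<And>i. polyfun m (\<lambda>x. p x $ i)" "\<And>x. x \<in> interior K \<Longrightarrow> w x = p x"
    using loc[OF K] by blast
  have "pderiv3 i (\<lambda>y. w y $ i) x = pderiv3 i (\<lambda>y. p y $ i) x" if "x \<in> interior K" for x i
  proof -
    have "((\<lambda>y. p y $ i) has_derivative (\<lambda>v. grad3 (\<lambda>y. p y $ i) x \<bullet> v)) (at x)"
      by (rule has_derivative_grad3[OF tame_differentiable[OF polyfun_imp_tame[OF p(1)]]])
    then have "((\<lambda>y. w y $ i) has_derivative (\<lambda>v. grad3 (\<lambda>y. p y $ i) x \<bullet> v)) (at x)"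
      by (rule has_derivative_transform_within_open[OF _ open_interior that]) (simp add: p(2))
    from pderiv3_unique[OF this, of i] show ?thesis by (simp add: inner_axis grad3_def)
  qed
  then have d: "div3 w x = div3 p x" if "x \<in> interior K" for x
    using that by (simp add: div3_def)
  have "continuous_on UNIV (div3 p)"
    unfolding div3_def[abs_def] by (intro continuous_on_sum tame_continuous_on[OF polyfun_imp_tame[OF polyfun_pderiv3[OF p(1)]]])
  then have "div3 p \<in> L2 K" using compact_el[OF K] by (rule L2_continuous)
  then have "L2norm K (div3 w) = L2norm K (div3 p)"
  proof (rule L2_cong_negligible(2))
    show "K \<in> sets lebesgue" "K \<in> sets lebesgue" using union_elements(1)[of "{K}"] K by auto
    show "negligible (frontier K)" by (rule negl_frontier[OF K])
    show "div3 w x = div3 p x" if "x \<in> K" "x \<notin> frontier K" for x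
      using that closure_subset[of K] by (intro d) (auto simp: frontier_def)
  qed auto
  then show ?thesis using that p by blast
qed

end

text \<open>The inscribed ball may touch the boundary of \<open>K\<close>, so testing uses half its
  radius, whose closed ball lies in the interior of \<open>K\<close> and hence in
  \<open>\<Omega>\<close>. This explains \<open>8 * \<kappa>\<close>: the diameter is at most
  \<open>4 * \<kappa> * r = 8 * \<kappa> * (r / 2)\<close>.\<close>

lemma element_indicator_estimate:
  assumes "1 \<le> \<kappa>"
  obtains C where "0 < C"
    "\<And>\<Omega> T u w K. piecewise_approximation \<Omega> T \<kappa> m u w \<Longrightarrow> K \<in> T \<Longrightarrow>
      diameter K * L2norm K (div3 w) \<le> C * L2norm K (\<lambda>x. u x - w x)"
proof -
  have "1 \<le> 8 * \<kappa>" using assms by simp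
  from element_estimate[OF this, of m] obtain C where C: "0 < C" and est: "\<And>K x0 r p U. 0 < r \<Longrightarrow> cball x0 r \<subseteq> K \<Longrightarrow> K \<subseteq> cball x0 (8 * \<kappa> * r) \<Longrightarrow> compact K \<Longrightarrow>
      (\<And>i. polyfun m (\<lambda>x. p x $ i)) \<Longrightarrow> U \<in> L2 K \<Longrightarrow>
      (\<And>\<phi>. tame \<phi> \<Longrightarrow> (\<And>x. r \<le> dist x0 x \<Longrightarrow> \<phi> x = 0) \<Longrightarrow> L2inner K U (grad3 \<phi>) = 0) \<Longrightarrow>
      r * L2norm K (div3 p) \<le> C * L2norm K (\<lambda>x. U x - p x)"
    by blast
  show ?thesis
  proof (rule that[of "8 * \<kappa> * C"])
    show "0 < 8 * \<kappa> * C" using C assms by simp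
    fix \<Omega> T u w K
    assume "piecewise_approximation \<Omega> T \<kappa> m u w" and K: "K \<in> T"
    then interpret piecewise_approximation \<Omega> T \<kappa> m u w by simp
    obtain x0 r where r: "0 < r" "cball x0 r \<subseteq> K" "diameter K \<le> 4 * \<kappa> * r"
    proof -
      have "0 < \<kappa>" using assms by simp
      from inball_exists[OF simp3[OF K] this shape[OF K]] that show ?thesis by blast
    qed
    obtain p where p: "\<And>i. polyfun m (\<lambda>x. p x $ i)" "\<And>x. x \<in> interior K \<Longrightarrow> w x = p x"
      and d: "L2norm K (div3 w) = L2norm K (div3 p)"
      using local_polynomial[OF K] by blast
    have sK: "K \<in> sets lebesgue" using union_elements(1)[of "{K}"] K by auto
    have x0: "x0 \<in> K" using r by auto
    have e1: "L2norm K (\<lambda>x. u x - p x) = L2norm K (\<lambda>x. u x - w x)"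
    proof (rule L2_cong_negligible(2)[OF _ sK sK negl_frontier[OF K]])
      show "(\<lambda>x. u x - w x) \<in> L2 K" using L2_element[OF err K] by (simp add: err_def)
      show "u x - p x = u x - w x" if "x \<in> K" "x \<notin> frontier K" for x
        using that closure_subset[of K] p(2)[of x] by (auto simp: frontier_def)
    qed auto
    have "r / 2 * L2norm K (div3 p) \<le> C * L2norm K (\<lambda>x. u x - p x)"
    proof (rule est)
      show "0 < r / 2" using r by simp
      have b2: "cball x0 (r / 2) \<subseteq> ball x0 r" using r by auto
      then show bK: "cball x0 (r / 2) \<subseteq> K" using r(2) ball_subset_cball[of x0 r] by blast
      have "ball x0 r \<subseteq> interior K" using r(2) ball_subset_cball[of x0 r] by (intro interior_maximal) auto
      then have b\<Omega>: "cball x0 (r / 2) \<subseteq> \<Omega>" using b2 interior_el[OF K] by blast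
      show "K \<subseteq> cball x0 (8 * \<kappa> * (r / 2))"
      proof
        fix x assume "x \<in> K"
        then have "dist x0 x \<le> diameter K"
          using x0 compact_imp_bounded[OF compact_el[OF K]] by (intro diameter_bounded_bound)
        then show "x \<in> cball x0 (8 * \<kappa> * (r / 2))" using r(3) by simp
      qed
      show "compact K" by (rule compact_el[OF K])
      show "u \<in> L2 K" by (rule L2_element[OF u K])
      show "L2inner K u (grad3 \<phi>) = 0" if "tame \<phi>" "\<And>x. r / 2 \<le> dist x0 x \<Longrightarrow> \<phi> x = 0" for \<phi>
        using b\<Omega> bK sK that by (rule orthogonal)
    qed (rule p)
    then have "8 * \<kappa> * (r / 2 * L2norm K (div3 p)) \<le> 8 * \<kappa> * (C * L2norm K (\<lambda>x. u x - p x))"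
      using assms by (intro mult_left_mono) auto
    moreover have "diameter K * L2norm K (div3 p) \<le> 4 * \<kappa> * r * L2norm K (div3 p)"
      using r(3) L2norm_nonneg by (rule mult_right_mono)
    ultimately show "diameter K * L2norm K (div3 w) \<le> 8 * \<kappa> * C * L2norm K (\<lambda>x. u x - w x)"
      unfolding d e1 by (simp add: mult_ac)
  qed
qed

context piecewise_approximation
begin

lemma inball:
  assumes "K \<in> T"
  obtains x0 r where "0 < r" "cball x0 r \<subseteq> K" "diameter K \<le> 4 * \<kappa> * r"
proof -
  have "0 < \<kappa>" using \<kappa> by simp
  from inball_exists[OF simp3[OF assms] this shape[OF assms]] that show ?thesis by blast
qed

text \<open>One neighbour comes with the definition of an inner face, the other from applying the
  existence result to \<open>n\<close> or to \<open>- n\<close>, according to the side of the first.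
  Ordering the pair by the sign along \<open>n\<close> matches it with the two one-sided
  traces.\<close>

lemma inner_face_elements:
  assumes F: "F \<in> inner_faces \<Omega> T" and abc: "F = convex hull {a, b, c}"
    and n: "norm n = 1" "n \<bullet> (b - a) = 0" "n \<bullet> (c - a) = 0"
  obtains K1 K2 d1 d2 where "K1 \<in> T" "F facet_of K1" "K1 = convex hull {a, b, c, d1}" "n \<bullet> (d1 - a) < 0"
    "K2 \<in> T" "F facet_of K2" "K2 = convex hull {a, b, c, d2}" "0 < n \<bullet> (d2 - a)"
proof -
  have pos: "\<exists>d. K = convex hull {a, b, c, d} \<and> n' \<bullet> (d - a) \<noteq> 0 \<and> (\<forall>x\<in>K. 0 \<le> (n' \<bullet> (x - a)) * (n' \<bullet> (d - a)))"
    if K: "K \<in> T" "F facet_of K" and n': "norm n' = 1" "n' \<bullet> (b - a) = 0" "n' \<bullet> (c - a) = 0" for K n'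
  proof -
    obtain d where d: "K = convex hull {a, b, c, d}" using facet_of_3_simplex_vertices[OF simp3[OF K(1)] K(2) abc] .
    obtain x0 r where r: "0 < r" "cball x0 r \<subseteq> K" using inball[OF K(1)] by metis
    show ?thesis using tetra_near_face(1,3)[OF d r n'] d by blast
  qed
  have "{a, b, c} \<subseteq> {x. n \<bullet> (x - a) = 0}" using n by simp
  moreover have "convex {x. n \<bullet> (x - a) = 0}" using convex_hyperplane[of n "n \<bullet> a"] by (simp add: inner_diff_right)
  ultimately have "F \<subseteq> {x. n \<bullet> (x - a) = 0}" unfolding abc by (rule hull_minimal)
  then have Fn: "n \<bullet> (x - a) = 0" if "x \<in> F" for x using that by blast
  have aF: "a \<in> F" unfolding abc by (rule hull_inc) simp
  obtain K where K: "K \<in> T" "F facet_of K" and rF: "rel_interior F \<subseteq> \<Omega>" using F by (auto simp: inner_faces_def)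
  obtain d where d: "K = convex hull {a, b, c, d}" "n \<bullet> (d - a) \<noteq> 0" and side: "\<And>x. x \<in> K \<Longrightarrow> 0 \<le> (n \<bullet> (x - a)) * (n \<bullet> (d - a))"
    using pos[OF K n] by blast
  have other: "\<exists>K' d'. K' \<in> T \<and> F facet_of K' \<and> K' = convex hull {a, b, c, d'} \<and> 0 < n' \<bullet> (d' - a)"
    if n': "norm n' = 1" "n' \<bullet> (b - a) = 0" "n' \<bullet> (c - a) = 0" "\<And>x. x \<in> F \<Longrightarrow> n' \<bullet> (x - a) = 0"
      and s: "\<And>x. x \<in> K \<Longrightarrow> n' \<bullet> (x - a) \<le> 0" for n'
  proof -
    have "n' \<noteq> 0" using n'(1) by auto
    from opposite_element[OF mesh op K(2,1) rF aF n'(4) this s]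
    obtain K' where K': "K' \<in> T" "F facet_of K'" and ex: "\<exists>x\<in>K'. 0 < n' \<bullet> (x - a)" by metis
    obtain d' where d': "K' = convex hull {a, b, c, d'}" "n' \<bullet> (d' - a) \<noteq> 0" and side': "\<And>x. x \<in> K' \<Longrightarrow> 0 \<le> (n' \<bullet> (x - a)) * (n' \<bullet> (d' - a))"
      using pos[OF K' n'(1-3)] by blast
    obtain x where "x \<in> K'" "0 < n' \<bullet> (x - a)" using ex by blast
    then have "0 < n' \<bullet> (d' - a)" using side'[of x] d'(2) by (simp add: zero_le_mult_iff)
    then show ?thesis using K' d'(1) by blast
  qed
  show ?thesis
  proof (cases "n \<bullet> (d - a) < 0")
    case True
    have "n \<bullet> (x - a) \<le> 0" if "x \<in> K" for x using side[OF that] True by (simp add: zero_le_mult_iff)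
    from other[OF n Fn this] show ?thesis using that[OF K d(1) True] by blast
  next
    case False
    then have p: "0 < n \<bullet> (d - a)" using d(2) by simp
    have "(- n) \<bullet> (x - a) \<le> 0" if "x \<in> K" for x using side[OF that] p by (simp add: zero_le_mult_iff)
    moreover have "norm (- n) = 1" "(- n) \<bullet> (b - a) = 0" "(- n) \<bullet> (c - a) = 0" "\<And>x. x \<in> F \<Longrightarrow> (- n) \<bullet> (x - a) = 0"
      using n Fn by simp_all
    ultimately obtain K' d' where "K' \<in> T" "F facet_of K'" "K' = convex hull {a, b, c, d'}" "0 < (- n) \<bullet> (d' - a)"
      using other[of "- n"] by blast
    then show ?thesis using that[of K' d' K d] K d(1) p by simp
  qed
qed

end

section \<open>Vertices, normal and jump of a single face\<close>

lemma triangle_vertices_eq: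
  assumes "3 simplex K" "F facet_of K" "triangle_vertices F = (a, b, c)"
  shows "F = convex hull {a, b, c}"
proof -
  obtain V where "F = convex hull V" "card V = 3" using facet_of_3_simplex[OF assms(1,2)] by metis
  then obtain a' b' c' where "F = convex hull {a', b', c'}" unfolding card_3_iff by auto
  then have "\<exists>p. (case p of (a, b, c) \<Rightarrow> F = convex hull {a, b, c})" by (intro exI[of _ "(a', b', c')"]) simp
  then have "case triangle_vertices F of (a, b, c) \<Rightarrow> F = convex hull {a, b, c}"
    unfolding triangle_vertices_def by (rule someI_ex)
  then show ?thesis using assms(3) by simp
qed

text \<open>The normalised cross product of two edges witnesses the choice. The sign of the chosen
  normal remains unknown; it will decide which neighbour is called \<open>K1\<close>.\<close>

lemma face_normal_eq:
  assumes F: "F = convex hull {a, b, c}" and cr: "cross3 (b - a) (c - a) \<noteq> 0"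
  shows "norm (face_normal F) = 1" "face_normal F \<bullet> (b - a) = 0" "face_normal F \<bullet> (c - a) = 0"
proof -
  let ?n = "(1 / norm (cross3 (b - a) (c - a))) *\<^sub>R cross3 (b - a) (c - a)"
  have "{a, b, c} \<subseteq> {x. ?n \<bullet> (x - a) = 0}" by (simp add: dot_cross_self)
  moreover have "convex {x. ?n \<bullet> (x - a) = 0}" using convex_hyperplane[of ?n "?n \<bullet> a"] by (simp only: inner_diff_right) simp
  ultimately have sub: "F \<subseteq> {x. ?n \<bullet> (x - a) = 0}" unfolding F by (rule hull_minimal)
  have "?n \<bullet> (x - y) = 0" if "x \<in> F" "y \<in> F" for x y
  proof -
    have "?n \<bullet> (x - a) = 0" "?n \<bullet> (y - a) = 0" using sub that by blast+
    then show ?thesis by (simp only: inner_diff_right)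
  qed
  moreover have "norm ?n = 1" using cr by simp
  ultimately have "\<exists>n. norm n = 1 \<and> (\<forall>x\<in>F. \<forall>y\<in>F. n \<bullet> (x - y) = 0)" by blast
  then have "norm (face_normal F) = 1 \<and> (\<forall>x\<in>F. \<forall>y\<in>F. face_normal F \<bullet> (x - y) = 0)"
    unfolding face_normal_def by (rule someI_ex)
  moreover have "a \<in> F" "b \<in> F" "c \<in> F" unfolding F by (auto intro: hull_inc)
  ultimately show "norm (face_normal F) = 1" "face_normal F \<bullet> (b - a) = 0" "face_normal F \<bullet> (c - a) = 0" by blast+
qed

lemma negligible_reference_triangle_edges:
  "negligible ({z::real \<times> real. fst z = 0} \<union> {z. snd z = 0} \<union> {z. fst z + snd z = 1})"
proof -
  have "negligible {z::real \<times> real. (1, 0) \<bullet> z = 0}" "negligible {z::real \<times> real. (0, 1) \<bullet> z = 0}"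
    "negligible {z::real \<times> real. (1, 1) \<bullet> z = 1}"
    by (rule negligible_hyperplane; simp add: zero_prod_def)+
  then show ?thesis by (intro negligible_Un) (simp_all add: inner_prod_def)
qed

text \<open>At relative interior points of the face both one-sided limits exist, as values of
  polynomials. On the edges nothing is known about \<open>Lim\<close>, but their parameters form a
  null set. The order of the difference is immaterial under the square.\<close>

lemma normal_jump_norm_eq:
  assumes tv: "triangle_vertices F = (a, b, c)"
    and p: "continuous_on UNIV p1" "continuous_on UNIV p2"
    and lim: "\<And>s t. 0 < s \<Longrightarrow> 0 < t \<Longrightarrow> s + t < 1 \<Longrightarrow>
        \<forall>\<^sub>F \<tau> in at_right 0. w (a + s *\<^sub>R (b - a) + t *\<^sub>R (c - a) - \<tau> *\<^sub>R face_normal F) = p1 (a + s *\<^sub>R (b - a) + t *\<^sub>R (c - a) - \<tau> *\<^sub>R face_normal F)"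
      "\<And>s t. 0 < s \<Longrightarrow> 0 < t \<Longrightarrow> s + t < 1 \<Longrightarrow>
        \<forall>\<^sub>F \<tau> in at_right 0. w (a + s *\<^sub>R (b - a) + t *\<^sub>R (c - a) + \<tau> *\<^sub>R face_normal F) = p2 (a + s *\<^sub>R (b - a) + t *\<^sub>R (c - a) + \<tau> *\<^sub>R face_normal F)"
  shows "normal_jump_norm F w = sqrt (norm (cross3 (b - a) (c - a)) * (LINT z|lebesgue_on reference_triangle.
      (face_normal F \<bullet> (p1 (a + fst z *\<^sub>R (b - a) + snd z *\<^sub>R (c - a)) - p2 (a + fst z *\<^sub>R (b - a) + snd z *\<^sub>R (c - a))))\<^sup>2))"
proof -
  let ?n = "face_normal F" and ?x = "\<lambda>z. a + fst z *\<^sub>R (b - a) + snd z *\<^sub>R (c - a)"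
  have J: "jump F (\<lambda>x. w x \<bullet> ?n) (?x z) = p2 (?x z) \<bullet> ?n - p1 (?x z) \<bullet> ?n"
    if z: "0 < fst z" "0 < snd z" "fst z + snd z < 1" for z
  proof -
    have c: "isCont p1 (?x z)" "isCont p2 (?x z)" using p by (auto simp: continuous_on_eq_continuous_at)
    have "((\<lambda>\<tau>. ?x z + \<tau> *\<^sub>R ?n) \<longlongrightarrow> ?x z + 0 *\<^sub>R ?n) (at_right 0)" "((\<lambda>\<tau>. ?x z - \<tau> *\<^sub>R ?n) \<longlongrightarrow> ?x z - 0 *\<^sub>R ?n) (at_right 0)"
      by (intro tendsto_intros)+
    then have l: "((\<lambda>\<tau>. ?x z + \<tau> *\<^sub>R ?n) \<longlongrightarrow> ?x z) (at_right 0)" "((\<lambda>\<tau>. ?x z - \<tau> *\<^sub>R ?n) \<longlongrightarrow> ?x z) (at_right 0)" by simp_all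
    have "((\<lambda>\<tau>. p2 (?x z + \<tau> *\<^sub>R ?n) \<bullet> ?n) \<longlongrightarrow> p2 (?x z) \<bullet> ?n) (at_right 0)"
      by (intro tendsto_intros isCont_tendsto_compose[OF c(2) l(1)])
    then have "((\<lambda>\<tau>. w (?x z + \<tau> *\<^sub>R ?n) \<bullet> ?n) \<longlongrightarrow> p2 (?x z) \<bullet> ?n) (at_right 0)"
      by (rule Lim_transform_eventually) (use lim(2)[OF z] in eventually_elim, simp)
    then have 1: "Lim (at_right 0) (\<lambda>\<tau>. w (?x z + \<tau> *\<^sub>R ?n) \<bullet> ?n) = p2 (?x z) \<bullet> ?n"
      by (intro tendsto_Lim) auto
    have "((\<lambda>\<tau>. p1 (?x z - \<tau> *\<^sub>R ?n) \<bullet> ?n) \<longlongrightarrow> p1 (?x z) \<bullet> ?n) (at_right 0)"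
      by (intro tendsto_intros isCont_tendsto_compose[OF c(1) l(2)])
    then have "((\<lambda>\<tau>. w (?x z - \<tau> *\<^sub>R ?n) \<bullet> ?n) \<longlongrightarrow> p1 (?x z) \<bullet> ?n) (at_right 0)"
      by (rule Lim_transform_eventually) (use lim(1)[OF z] in eventually_elim, simp)
    then have 2: "Lim (at_right 0) (\<lambda>\<tau>. w (?x z - \<tau> *\<^sub>R ?n) \<bullet> ?n) = p1 (?x z) \<bullet> ?n"
      by (intro tendsto_Lim) auto
    show ?thesis unfolding jump_def 1 2 ..
  qed
  have "(LINT z|lebesgue_on reference_triangle. (jump F (\<lambda>x. w x \<bullet> ?n) (?x z))\<^sup>2)
      = (LINT z|lebesgue_on reference_triangle. (?n \<bullet> (p1 (?x z) - p2 (?x z)))\<^sup>2)"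
  proof (rule integral_lebesgue_on_cong_negligible[OF _ _ negligible_reference_triangle_edges])
    show "(\<lambda>z. (?n \<bullet> (p1 (?x z) - p2 (?x z)))\<^sup>2) \<in> borel_measurable borel"
      by (intro borel_measurable_continuous_onI continuous_intros continuous_on_compose2[OF p(1)] continuous_on_compose2[OF p(2)]) auto
    show "reference_triangle \<in> sets lebesgue"
      using lmeasurable_compact[OF reference_triangle_compact] by (rule fmeasurableD)
    fix z assume z: "z \<in> reference_triangle" "z \<notin> {z. fst z = 0} \<union> {z. snd z = 0} \<union> {z. fst z + snd z = 1}"
    then have "0 < fst z" "0 < snd z" "fst z + snd z < 1" by (auto simp: reference_triangle_def)
    from J[OF this] show "(jump F (\<lambda>x. w x \<bullet> ?n) (?x z))\<^sup>2 = (?n \<bullet> (p1 (?x z) - p2 (?x z)))\<^sup>2"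
      by (simp add: inner_diff_right inner_commute power2_commute)
  qed
  then show ?thesis
    unfolding normal_jump_norm_def face_L2norm_def face_integral_def tv by simp
qed

text \<open>The element estimate on the two neighbours turns the divergence terms into the error on
  the patch, so \<open>\<Delta> = (1 + Ce) * E\<close> serves for all three quantities that the face
  estimate asks to be bounded.\<close>

lemma face_indicator_estimate:
  assumes \<kappa>1: "1 \<le> \<kappa>"
  obtains C where "0 < C"
    "\<And>\<Omega> T u w F. piecewise_approximation \<Omega> T \<kappa> m u w \<Longrightarrow> F \<in> inner_faces \<Omega> T \<Longrightarrow>
      sqrt (diameter F) * normal_jump_norm F w \<le> C * L2norm (face_patch T F) (\<lambda>x. u x - w x)"
proof -
  obtain Ce where Ce: "0 < Ce" and elem: "\<And>\<Omega> T u w K. piecewise_approximation \<Omega> T \<kappa> m u w \<Longrightarrow> K \<in> T \<Longrightarrow>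
      diameter K * L2norm K (div3 w) \<le> Ce * L2norm K (\<lambda>x. u x - w x)"
    using element_indicator_estimate[OF \<kappa>1, of m] by metis
  have "1 \<le> 12 * \<kappa>" using \<kappa>1 by simp
  from face_estimate[OF this, of m] obtain Cf where Cf: "0 < Cf" and face: "\<And>a b c n y \<rho> p1 p2 U \<Delta>.
      0 < \<rho> \<Longrightarrow> norm n = 1 \<Longrightarrow> n \<bullet> b = 0 \<Longrightarrow> n \<bullet> c = 0 \<Longrightarrow> cross3 b c \<noteq> 0 \<Longrightarrow> n \<bullet> (y - a) = 0 \<Longrightarrow>
      (\<And>s t. dist y (a + s *\<^sub>R b + t *\<^sub>R c) \<le> \<rho> \<Longrightarrow> 0 \<le> s \<and> 0 \<le> t \<and> s + t \<le> 1) \<Longrightarrow>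
      (\<And>s t. 0 \<le> s \<Longrightarrow> 0 \<le> t \<Longrightarrow> s + t \<le> 1 \<Longrightarrow> dist y (a + s *\<^sub>R b + t *\<^sub>R c) \<le> 12 * \<kappa> * \<rho>) \<Longrightarrow>
      (\<And>i. polyfun m (\<lambda>x. p1 x $ i)) \<Longrightarrow> (\<And>i. polyfun m (\<lambda>x. p2 x $ i)) \<Longrightarrow> U \<in> L2 (cball y \<rho>) \<Longrightarrow>
      (\<And>\<phi>. tame \<phi> \<Longrightarrow> (\<And>x. \<rho> \<le> dist y x \<Longrightarrow> \<phi> x = 0) \<Longrightarrow> L2inner (cball y \<rho>) U (grad3 \<phi>) = 0) \<Longrightarrow>
      L2norm (cball y \<rho>) (\<lambda>x. U x - (if n \<bullet> (x - a) \<le> 0 then p1 x else p2 x)) \<le> \<Delta> \<Longrightarrow>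
      \<rho> * L2norm (cball y \<rho> \<inter> {x. n \<bullet> (x - a) \<le> 0}) (div3 p1) \<le> \<Delta> \<Longrightarrow>
      \<rho> * L2norm (cball y \<rho> \<inter> {x. 0 \<le> n \<bullet> (x - a)}) (div3 p2) \<le> \<Delta> \<Longrightarrow>
      sqrt \<rho> * sqrt (norm (cross3 b c) * (LINT z|lebesgue_on reference_triangle.
         (n \<bullet> (p1 (a + fst z *\<^sub>R b + snd z *\<^sub>R c) - p2 (a + fst z *\<^sub>R b + snd z *\<^sub>R c)))\<^sup>2)) \<le> Cf * \<Delta>"
    by blast
  show ?thesis
  proof (rule that[of "sqrt (12 * \<kappa>) * (Cf * (1 + Ce))"])
    show "0 < sqrt (12 * \<kappa>) * (Cf * (1 + Ce))" using Cf Ce \<kappa>1 by simp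
    fix \<Omega> T u w F
    assume pa: "piecewise_approximation \<Omega> T \<kappa> m u w" and F: "F \<in> inner_faces \<Omega> T"
    then interpret piecewise_approximation \<Omega> T \<kappa> m u w by simp
    obtain a b c where tv: "triangle_vertices F = (a, b, c)" by (metis prod_cases3)
    define n where "n = face_normal F"
    define y where "y = (1/3) *\<^sub>R (a + b + c)"
    define h where "h = diameter F"
    obtain K0 where K0: "K0 \<in> T" "F facet_of K0" using F by (auto simp: inner_faces_def)
    have abc: "F = convex hull {a, b, c}" by (rule triangle_vertices_eq[OF simp3[OF K0(1)] K0(2) tv])
    have cr: "cross3 (b - a) (c - a) \<noteq> 0"
    proof -
      obtain d where d: "K0 = convex hull {a, b, c, d}" using facet_of_3_simplex_vertices[OF simp3[OF K0(1)] K0(2) abc] .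
      obtain x0 r where r: "0 < r" "cball x0 r \<subseteq> K0" using inball[OF K0(1)] by metis
      show ?thesis using tetra_coordinates[OF d r] by metis
    qed
    have n: "norm n = 1" "n \<bullet> (b - a) = 0" "n \<bullet> (c - a) = 0"
      unfolding n_def by (rule face_normal_eq[OF abc cr])+
    obtain K1 K2 d1 d2 where K1: "K1 \<in> T" "F facet_of K1" and d1: "K1 = convex hull {a, b, c, d1}" "n \<bullet> (d1 - a) < 0"
      and K2: "K2 \<in> T" "F facet_of K2" and d2: "K2 = convex hull {a, b, c, d2}" "0 < n \<bullet> (d2 - a)"
      using inner_face_elements[OF F abc n] by metis
    have compF: "compact F" unfolding abc by (intro finite_imp_compact_convex_hull) simp
    have ya: "n \<bullet> (y - a) = 0"
    proof -
      have "y - a = (1/3) *\<^sub>R (b - a) + (1/3) *\<^sub>R (c - a)" by (simp add: y_def vec_eq_iff algebra_simps)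
      then show ?thesis using n by (simp add: inner_add_right)
    qed
    have yF: "y \<in> F"
      unfolding abc convex_hull_3 y_def by (intro CollectI exI[of _ "1/3"]) (simp add: scaleR_add_right)
    have scale: "h \<le> diameter K \<and> diameter K \<le> 4 * \<kappa> * r \<and> 4 / 3 * r \<le> h \<and> cball x0 r \<subseteq> K"
      if K: "K \<in> T" "F facet_of K" "K = convex hull {a, b, c, d}" and r: "0 < r" "cball x0 r \<subseteq> K" "diameter K \<le> 4 * \<kappa> * r" for K d x0 r
    proof -
      have "h \<le> diameter K"
        unfolding h_def using facet_of_imp_subset[OF K(2)] compact_imp_bounded[OF compact_el[OF K(1)]] by (rule diameter_subset)
      moreover have "4 / 3 * r \<le> h"
      proof -
        \<comment> \<open>A segment through the barycentre along an edge direction, of half-length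
          \<open>2 / 3 * r\<close>, stays in the element and in the plane, hence in the face. So the
          diameter of the face is at least \<open>4 / 3 * r\<close>, in particular positive.\<close>
        define e where "e = (1 / norm (b - a)) *\<^sub>R (b - a)"
        have "b \<noteq> a" using cr by auto
        then have e: "norm e = 1" "n \<bullet> e = 0" using n by (auto simp: e_def)
        note tn = tetra_near_face[OF K(3) r(1,2) n]
        have inF: "y + s *\<^sub>R e \<in> F" if "\<bar>s\<bar> \<le> 2 / 3 * r" for s
        proof -
          have z: "n \<bullet> (y + s *\<^sub>R e - a) = 0" using ya e by (simp add: inner_diff_right inner_add_right)
          have "y + s *\<^sub>R e \<in> K" by (rule tn(4)) (use z that e in \<open>auto simp: y_def[symmetric] dist_norm\<close>)
          from tn(5)[OF this z] obtain s' t where st: "y + s *\<^sub>R e = a + s' *\<^sub>R (b - a) + t *\<^sub>R (c - a)" "0 \<le> s'" "0 \<le> t" "s' + t \<le> 1" by blast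
          show ?thesis unfolding abc convex_hull_3 st(1)
            by (intro CollectI exI[of _ "1 - s' - t"] exI[of _ s'] exI[of _ t]) (use st in \<open>simp add: algebra_simps\<close>)
        qed
        have "dist (y + (2 / 3 * r) *\<^sub>R e) (y + (- (2 / 3 * r)) *\<^sub>R e) \<le> diameter F"
          using r by (intro diameter_bounded_bound compact_imp_bounded compF inF) auto
        moreover have "dist (y + (2 / 3 * r) *\<^sub>R e) (y + (- (2 / 3 * r)) *\<^sub>R e) = norm ((4 / 3 * r) *\<^sub>R e)"
          by (simp add: dist_norm flip: scaleR_add_left)
        ultimately show ?thesis using e r by (simp add: h_def)
      qed
      ultimately show ?thesis using r by simp
    qed
    obtain x1 r1 where r1: "0 < r1" "cball x1 r1 \<subseteq> K1" "diameter K1 \<le> 4 * \<kappa> * r1" using inball[OF K1(1)] .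
    obtain x2 r2 where r2: "0 < r2" "cball x2 r2 \<subseteq> K2" "diameter K2 \<le> 4 * \<kappa> * r2" using inball[OF K2(1)] .
    note s1 = scale[OF K1 d1(1) r1] and s2 = scale[OF K2 d2(1) r2]
    note tn1 = tetra_near_face[OF d1(1) r1(1,2) n] and tn2 = tetra_near_face[OF d2(1) r2(1,2) n]
    \<comment> \<open>From \<open>h \<le> 4 * \<kappa> * r1\<close> and
      \<open>h \<le> 4 * \<kappa> * r2\<close> one gets \<open>2 * \<rho> \<le> 2 / 3 * r1\<close>
      and likewise for \<open>r2\<close>. Thus even the doubled ball around the barycentre is
      covered by the two elements, and the closed ball of radius \<open>\<rho>\<close> lies in the
      open set \<open>\<Omega>\<close>. The face itself is within
      \<open>h = 12 * \<kappa> * \<rho>\<close>.\<close>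
    define \<rho> where "\<rho> = h / (12 * \<kappa>)"
    have h: "0 < h" using s1 r1 by linarith
    have \<rho>: "0 < \<rho>" using h \<kappa>1 by (simp add: \<rho>_def)
    have h\<rho>: "h = 12 * \<kappa> * \<rho>" using \<kappa>1 by (simp add: \<rho>_def)
    have \<rho>r: "2 * \<rho> \<le> 2 / 3 * r1" "2 * \<rho> \<le> 2 / 3 * r2"
    proof -
      have "12 * \<kappa> * \<rho> \<le> 4 * \<kappa> * r1" "12 * \<kappa> * \<rho> \<le> 4 * \<kappa> * r2" using s1 s2 h\<rho> by linarith+
      then have "\<kappa> * (3 * \<rho>) \<le> \<kappa> * r1" "\<kappa> * (3 * \<rho>) \<le> \<kappa> * r2" by simp_all
      then show "2 * \<rho> \<le> 2 / 3 * r1" "2 * \<rho> \<le> 2 / 3 * r2" using \<kappa>1 by (simp_all add: mult_le_cancel_left_pos)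
    qed
    have side1: "x \<in> K1" if "dist y x \<le> 2 * \<rho>" "n \<bullet> (x - a) \<le> 0" for x
      using that \<rho>r(1) d1(2) by (intro tn1(4)) (auto simp: y_def[symmetric] mult_nonpos_nonpos)
    have side2: "x \<in> K2" if "dist y x \<le> 2 * \<rho>" "0 \<le> n \<bullet> (x - a)" for x
      using that \<rho>r(2) d2(2) by (intro tn2(4)) (auto simp: y_def[symmetric])
    have "cball y (2 * \<rho>) \<subseteq> K1 \<union> K2" using side1 side2 by (auto simp: subset_iff) (meson linear)
    then have "ball y (2 * \<rho>) \<subseteq> closure \<Omega>" using Un K1(1) K2(1) ball_subset_cball[of y "2 * \<rho>"] by blast
    then have "ball y (2 * \<rho>) \<subseteq> \<Omega>" using int_closure interior_maximal[OF _ open_ball] by blast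
    then have B\<Omega>: "cball y \<rho> \<subseteq> \<Omega>" using \<rho> by (force simp: subset_iff)
    let ?S = "{K \<in> T. F facet_of K}"
    have ST: "?S \<subseteq> T" by blast
    have patch: "face_patch T F = \<Union>?S" by (simp add: face_patch_def)
    define E where "E = L2norm (face_patch T F) (\<lambda>x. u x - w x)"
    have E: "0 \<le> E" unfolding E_def by (rule L2norm_nonneg)
    have eE: "L2norm A (\<lambda>x. u x - w x) \<le> E" if "A \<subseteq> \<Union>?S" "A \<in> sets lebesgue" for A
      using err_mono[OF ST that] by (simp add: E_def patch err_def)
    have sK: "K \<in> sets lebesgue" if "K \<in> T" for K using union_elements(1)[of "{K}"] that by auto
    obtain p1 where p1: "\<And>i. polyfun m (\<lambda>x. p1 x $ i)" "\<And>x. x \<in> interior K1 \<Longrightarrow> w x = p1 x" "L2norm K1 (div3 w) = L2norm K1 (div3 p1)"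
      using local_polynomial[OF K1(1)] by blast
    obtain p2 where p2: "\<And>i. polyfun m (\<lambda>x. p2 x $ i)" "\<And>x. x \<in> interior K2 \<Longrightarrow> w x = p2 x" "L2norm K2 (div3 w) = L2norm K2 (div3 p2)"
      using local_polynomial[OF K2(1)] by blast
    \<comment> \<open>As \<open>\<rho> \<le> h \<le> diameter K\<close>, scaling by
      \<open>\<rho>\<close> gives less than the element estimate already controls.\<close>
    have divest: "\<rho> * L2norm A (div3 p) \<le> (1 + Ce) * E"
      if K: "K \<in> T" "F facet_of K" and A: "A \<subseteq> K" "A \<in> sets lebesgue" and p: "\<And>i. polyfun m (\<lambda>x. p x $ i)"
        and d: "L2norm K (div3 w) = L2norm K (div3 p)" and hK: "h \<le> diameter K" for K A p
    proof -
      have "continuous_on UNIV (div3 p)"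
        unfolding div3_def[abs_def] by (intro continuous_on_sum tame_continuous_on[OF polyfun_imp_tame[OF polyfun_pderiv3[OF p]]])
      then have "div3 p \<in> L2 K" using compact_el[OF K(1)] by (rule L2_continuous)
      then have "L2norm A (div3 p) \<le> L2norm K (div3 p)" using sK[OF K(1)] A by (intro L2_subset(2))
      moreover have "\<rho> \<le> diameter K" using hK h\<rho> \<kappa>1 \<rho> mult_right_mono[of 1 "12 * \<kappa>" \<rho>] by linarith
      ultimately have "\<rho> * L2norm A (div3 p) \<le> diameter K * L2norm K (div3 w)"
        unfolding d using \<rho> by (intro mult_mono L2norm_nonneg) auto
      also have "\<dots> \<le> Ce * L2norm K (\<lambda>x. u x - w x)" by (rule elem[OF pa K(1)])
      also have "\<dots> \<le> Ce * E" using Ce K sK by (intro mult_left_mono eE) auto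
      also have "\<dots> \<le> (1 + Ce) * E" using E by (simp add: algebra_simps)
      finally show ?thesis .
    qed
    \<comment> \<open>Going against the normal enters \<open>K1\<close> and going along it enters
      \<open>K2\<close>, because \<open>d1\<close> and \<open>d2\<close> lie on these sides.\<close>
    have njn: "normal_jump_norm F w = sqrt (norm (cross3 (b - a) (c - a)) * (LINT z|lebesgue_on reference_triangle.
        (n \<bullet> (p1 (a + fst z *\<^sub>R (b - a) + snd z *\<^sub>R (c - a)) - p2 (a + fst z *\<^sub>R (b - a) + snd z *\<^sub>R (c - a))))\<^sup>2))"
      unfolding n_def
    proof (rule normal_jump_norm_eq[OF tv])
      show "continuous_on UNIV p1" "continuous_on UNIV p2"
        using tame_continuous_on[OF polyfun_imp_tame[OF p1(1)]] continuous_on_vec_lambda[of UNIV "\<lambda>i x. p1 x $ i"]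
          tame_continuous_on[OF polyfun_imp_tame[OF p2(1)]] continuous_on_vec_lambda[of UNIV "\<lambda>i x. p2 x $ i"] by auto
      fix s t :: real assume st: "0 < s" "0 < t" "s + t < 1"
      have nn: "n \<bullet> n = 1" using n(1) by (simp add: power2_norm_eq_inner[symmetric])
      have "\<forall>\<^sub>F \<tau> in at_right 0. a + s *\<^sub>R (b - a) + t *\<^sub>R (c - a) + \<tau> *\<^sub>R (- n) \<in> interior K1"
        by (rule tn1(6)[OF st]) (use nn d1(2) in simp)
      then show "\<forall>\<^sub>F \<tau> in at_right 0. w (a + s *\<^sub>R (b - a) + t *\<^sub>R (c - a) - \<tau> *\<^sub>R face_normal F)
          = p1 (a + s *\<^sub>R (b - a) + t *\<^sub>R (c - a) - \<tau> *\<^sub>R face_normal F)"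
        by eventually_elim (simp add: n_def p1(2))
      have "\<forall>\<^sub>F \<tau> in at_right 0. a + s *\<^sub>R (b - a) + t *\<^sub>R (c - a) + \<tau> *\<^sub>R n \<in> interior K2"
        by (rule tn2(6)[OF st]) (use nn d2(2) in simp)
      then show "\<forall>\<^sub>F \<tau> in at_right 0. w (a + s *\<^sub>R (b - a) + t *\<^sub>R (c - a) + \<tau> *\<^sub>R face_normal F)
          = p2 (a + s *\<^sub>R (b - a) + t *\<^sub>R (c - a) + \<tau> *\<^sub>R face_normal F)"
        by eventually_elim (simp add: n_def p2(2))
    qed
    have "sqrt \<rho> * normal_jump_norm F w \<le> Cf * ((1 + Ce) * E)"
      unfolding njn
    proof (rule face[OF \<rho> n cr ya])
      have seg: "n \<bullet> (a + s *\<^sub>R (b - a) + t *\<^sub>R (c - a) - a) = 0" for s t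
        using n by (simp add: inner_add_right)
      show "0 \<le> s \<and> 0 \<le> t \<and> s + t \<le> 1" if "dist y (a + s *\<^sub>R (b - a) + t *\<^sub>R (c - a)) \<le> \<rho>" for s t
        by (rule tn1(7), rule side1) (use that \<rho> seg[of s t] in auto)
      show "dist y (a + s *\<^sub>R (b - a) + t *\<^sub>R (c - a)) \<le> 12 * \<kappa> * \<rho>" if "0 \<le> s" "0 \<le> t" "s + t \<le> 1" for s t
      proof -
        have "a + s *\<^sub>R (b - a) + t *\<^sub>R (c - a) \<in> F" unfolding abc convex_hull_3
          by (intro CollectI exI[of _ "1 - s - t"] exI[of _ s] exI[of _ t]) (use that in \<open>simp add: algebra_simps\<close>)
        then show ?thesis unfolding h\<rho>[symmetric] h_def
          using yF compF by (intro diameter_bounded_bound compact_imp_bounded)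
      qed
      show "u \<in> L2 (cball y \<rho>)" by (rule L2_subset(1)[OF u _ _ B\<Omega>]) (use op in auto)
      show "L2inner (cball y \<rho>) u (grad3 \<phi>) = 0" if "tame \<phi>" "\<And>x. \<rho> \<le> dist y x \<Longrightarrow> \<phi> x = 0" for \<phi>
        using that by (intro orthogonal[OF B\<Omega>]) auto
      have "cball y \<rho> \<subseteq> cball y (2 * \<rho>)" using \<rho> by auto
      then have Bs: "cball y \<rho> \<subseteq> K1 \<union> K2" using \<open>cball y (2 * \<rho>) \<subseteq> K1 \<union> K2\<close> by (rule subset_trans)
      have "L2norm (cball y \<rho>) (\<lambda>x. u x - (if n \<bullet> (x - a) \<le> 0 then p1 x else p2 x)) = L2norm (cball y \<rho>) (\<lambda>x. u x - w x)"
      proof (rule L2_cong_negligible(2)[where N="frontier K1 \<union> frontier K2"])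
        show "(\<lambda>x. u x - w x) \<in> L2 (cball y \<rho>)" using L2_subset(1)[OF err _ _ B\<Omega>] op by (simp add: err_def)
        show "negligible (frontier K1 \<union> frontier K2)" using negl_frontier K1(1) K2(1) by (intro negligible_Un)
        fix x assume x: "x \<in> cball y \<rho>" "x \<notin> frontier K1 \<union> frontier K2"
        have xd: "dist y x \<le> 2 * \<rho>" using x(1) \<rho> by simp
        show "u x - (if n \<bullet> (x - a) \<le> 0 then p1 x else p2 x) = u x - w x"
        proof (cases "n \<bullet> (x - a) \<le> 0")
          case True
          then have "x \<in> interior K1" using side1[OF xd] x(2) closure_subset[of K1] by (auto simp: frontier_def)
          then show ?thesis using True p1(2) by simp
        next
          case False
          then have "x \<in> interior K2" using side2[OF xd] x(2) closure_subset[of K2] by (auto simp: frontier_def)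
          then show ?thesis using False p2(2) by simp
        qed
      qed auto
      also have "\<dots> \<le> E" using Bs K1 K2 by (intro eE) auto
      also have "\<dots> \<le> (1 + Ce) * E" using Ce E by (simp add: algebra_simps)
      finally show "L2norm (cball y \<rho>) (\<lambda>x. u x - (if n \<bullet> (x - a) \<le> 0 then p1 x else p2 x)) \<le> (1 + Ce) * E" .
      have cl: "closed {x. n \<bullet> (x - a) \<le> 0}" "closed {x. 0 \<le> n \<bullet> (x - a)}" by (intro closed_Collect_le continuous_intros)+
      show "\<rho> * L2norm (cball y \<rho> \<inter> {x. n \<bullet> (x - a) \<le> 0}) (div3 p1) \<le> (1 + Ce) * E"
        by (rule divest[OF K1 _ _ p1(1,3)]) (use side1 \<rho> s1 cl in auto)
      show "\<rho> * L2norm (cball y \<rho> \<inter> {x. 0 \<le> n \<bullet> (x - a)}) (div3 p2) \<le> (1 + Ce) * E"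
        by (rule divest[OF K2 _ _ p2(1,3)]) (use side2 \<rho> s2 cl in auto)
    qed (rule p1(1) p2(1))+
    then have "sqrt (12 * \<kappa>) * (sqrt \<rho> * normal_jump_norm F w) \<le> sqrt (12 * \<kappa>) * (Cf * ((1 + Ce) * E))"
      using \<kappa>1 by (intro mult_left_mono) auto
    moreover have "sqrt (diameter F) = sqrt (12 * \<kappa>) * sqrt \<rho>" unfolding h_def[symmetric] h\<rho> by (rule real_sqrt_mult)
    ultimately show "sqrt (diameter F) * normal_jump_norm F w \<le> sqrt (12 * \<kappa>) * (Cf * (1 + Ce)) * L2norm (face_patch T F) (\<lambda>x. u x - w x)"
      by (simp add: E_def mult_ac)
  qed
qed

text \<open>At most 16 faces, each with weight \<open>1 / 4\<close>, give \<open>4 * Cf^2\<close>.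
  Every patch of a face of \<open>K\<close> is part of the patch of \<open>K\<close>, and so is
  \<open>K\<close> itself, since it shares a facet with itself.\<close>

lemma (in piecewise_approximation) error_indicator_le:
  assumes K: "K \<in> T" and C: "0 \<le> Ce" "0 \<le> Cf"
    and el: "diameter K * L2norm K (div3 w) \<le> Ce * L2norm K (\<lambda>x. u x - w x)"
    and fc: "\<And>F. F \<in> inner_faces \<Omega> T \<Longrightarrow>
      sqrt (diameter F) * normal_jump_norm F w \<le> Cf * L2norm (face_patch T F) (\<lambda>x. u x - w x)"
  shows "error_indicator \<Omega> T w K \<le> sqrt (Ce\<^sup>2 + 4 * Cf\<^sup>2) * L2norm (element_patch T K) (\<lambda>x. u x - w x)"
proof -
  let ?S = "{K' \<in> T. \<exists>F. F facet_of K \<and> F facet_of K'}"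
  have ST: "?S \<subseteq> T" by blast
  have patch: "element_patch T K = \<Union>?S" by (simp add: element_patch_def)
  define E where "E = L2norm (element_patch T K) (\<lambda>x. u x - w x)"
  have E: "0 \<le> E" unfolding E_def by (rule L2norm_nonneg)
  have eE: "L2norm A (\<lambda>x. u x - w x) \<le> E" if "A \<subseteq> \<Union>?S" "A \<in> sets lebesgue" for A
    using err_mono[OF ST that] by (simp add: E_def patch err_def)
  let ?\<F> = "{F. F \<in> inner_faces \<Omega> T \<and> F \<subseteq> frontier K}"
  \<comment> \<open>An inner face in the frontier of \<open>K\<close> is known to be a facet of some
    element, perhaps another one; conformity makes it a facet of \<open>K\<close>.\<close>
  have facet: "F facet_of K" if F: "F \<in> ?\<F>" for F
  proof -
    obtain K' where K': "K' \<in> T" "F facet_of K'" using F by (auto simp: inner_faces_def)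
    have "frontier K \<subseteq> K" using compact_imp_closed[OF compact_el[OF K]] by (rule frontier_subset_closed)
    then have "F \<subseteq> K" using F by blast
    then show ?thesis using shared_facet[OF tri K'(1) K _ simp3[OF K'(1)] simp3[OF K] K'(2)] K'(2) by blast
  qed
  then have sub: "?\<F> \<subseteq> {F. F facet_of K}" by blast
  have "card ?\<F> \<le> 16"
    using card_mono[OF facets_card_le(1)[OF simp3[OF K]] sub] facets_card_le(2)[OF simp3[OF K]] by linarith
  have "polytope K" using simp3[OF K] simplex_imp_polytope by blast
  moreover have "0 < aff_dim K" using aff_dim_simplex[OF simp3[OF K]] by simp
  ultimately obtain F0 where "F0 facet_of K" by (rule polytope_facet_exists)
  then have "K \<subseteq> \<Union>?S" using K by blast
  then have "L2norm K (\<lambda>x. u x - w x) \<le> E" using union_elements(1)[of "{K}"] K by (intro eE) auto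
  then have "diameter K * L2norm K (div3 w) \<le> Ce * E"
    using el C(1) by (meson mult_left_mono order_trans)
  moreover have "0 \<le> diameter K * L2norm K (div3 w)"
    by (intro mult_nonneg_nonneg L2norm_nonneg diameter_ge_0 compact_imp_bounded compact_el K)
  ultimately have 1: "(diameter K)\<^sup>2 * (L2norm K (div3 w))\<^sup>2 \<le> (Ce * E)\<^sup>2"
    unfolding power_mult_distrib[symmetric] by (rule power_mono)
  have 2: "diameter F / 4 * (normal_jump_norm F w)\<^sup>2 \<le> (Cf * E)\<^sup>2 / 4" if F: "F \<in> ?\<F>" for F
  proof -
    have FS: "{K \<in> T. F facet_of K} \<subseteq> ?S" using facet[OF F] by blast
    have "face_patch T F \<subseteq> \<Union>?S" unfolding face_patch_def using FS by (rule Union_mono)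
    moreover have "face_patch T F \<in> sets lebesgue" unfolding face_patch_def by (rule union_elements(1)) blast
    ultimately have "L2norm (face_patch T F) (\<lambda>x. u x - w x) \<le> E" by (rule eE)
    then have "sqrt (diameter F) * normal_jump_norm F w \<le> Cf * E"
      using fc[of F] F C(2) by (metis (no_types, lifting) mem_Collect_eq mult_left_mono order_trans)
    moreover have "bounded F"
      using facet_of_imp_subset[OF facet[OF F]] compact_imp_bounded[OF compact_el[OF K]] bounded_subset by blast
    then have dF: "0 \<le> diameter F" by (rule diameter_ge_0)
    moreover have "0 \<le> normal_jump_norm F w"
      unfolding normal_jump_norm_def face_L2norm_def face_integral_def
      by (auto split: prod.split intro!: mult_nonneg_nonneg)
    ultimately have "(sqrt (diameter F) * normal_jump_norm F w)\<^sup>2 \<le> (Cf * E)\<^sup>2" by (intro power_mono) auto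
    then show ?thesis using dF by (simp add: power_mult_distrib)
  qed
  have "(\<Sum>F | F \<in> inner_faces \<Omega> T \<and> F \<subseteq> frontier K. diameter F / 4 * (normal_jump_norm F w)\<^sup>2) \<le> real (card ?\<F>) * ((Cf * E)\<^sup>2 / 4)"
    using 2 by (intro sum_bounded_above)
  also have "\<dots> \<le> 16 * ((Cf * E)\<^sup>2 / 4)" using \<open>card ?\<F> \<le> 16\<close> by (intro mult_right_mono) auto
  finally have "(diameter K)\<^sup>2 * (L2norm K (div3 w))\<^sup>2
      + (\<Sum>F | F \<in> inner_faces \<Omega> T \<and> F \<subseteq> frontier K. diameter F / 4 * (normal_jump_norm F w)\<^sup>2)
      \<le> (Ce\<^sup>2 + 4 * Cf\<^sup>2) * E\<^sup>2"
    using 1 by (simp add: power_mult_distrib algebra_simps)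
  then have "error_indicator \<Omega> T w K \<le> sqrt ((Ce\<^sup>2 + 4 * Cf\<^sup>2) * E\<^sup>2)"
    unfolding error_indicator_def by (rule real_sqrt_le_mono)
  then show ?thesis using E by (simp add: real_sqrt_mult E_def)
qed

theorem theorem4p5:
  fixes \<Omega> :: "(real^3) set"
    and t :: real
    and T :: "'i \<Rightarrow> (real^3) set set"
    and k :: nat
    and lam :: real and u \<sigma> :: "real^3 \<Rightarrow> real^3"
    and lam_h :: "'i \<Rightarrow> real" and u_h \<sigma>_h :: "'i \<Rightarrow> real^3 \<Rightarrow> real^3"
  assumes domain: "open \<Omega>" "connected \<Omega>" "bounded \<Omega>" "\<not> convex \<Omega>"
      "polyhedral_boundary \<Omega>" "lipschitz_boundary \<Omega>"
      "simply_connected \<Omega>" "connected (frontier \<Omega>)"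
    and exponent: "1 / 2 < t" "t < 1" "regularity_exponent \<Omega> t"
    and meshes: "\<And>i. tetrahedral_mesh \<Omega> (T i)" "shape_regular T"
      "\<And>\<epsilon>. \<epsilon> > 0 \<Longrightarrow> \<exists>i. meshsize (T i) < \<epsilon>"
    and continuous_eigenpair: "simple_eigenvalue \<Omega> (H0curl \<Omega>) lam"
      "mixed_eigenpair \<Omega> (H0curl \<Omega>) lam u \<sigma>" "L2norm \<Omega> \<sigma> = 1"
    and discrete_eigenpair: "\<And>i. simple_eigenvalue \<Omega> (nedelec_space \<Omega> (T i) k) (lam_h i)"
      "\<And>i. mixed_eigenpair \<Omega> (nedelec_space \<Omega> (T i) k) (lam_h i) (u_h i) (\<sigma>_h i)"
      "\<And>i. L2norm \<Omega> (\<sigma>_h i) = 1"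
      "(lam_h \<longlongrightarrow> lam) (filtercomap (\<lambda>i. meshsize (T i)) (at_right 0))"
    and a_priori: "\<exists>C>0. \<forall>i. \<bar>lam - lam_h i\<bar> \<le> C * meshsize (T i) powr (2 * t)
        \<and> L2norm \<Omega> (\<lambda>x. \<sigma> x - \<sigma>_h i x) \<le> C * meshsize (T i) powr t"
  shows "\<exists>C>0. \<forall>i.
      (\<forall>K\<in>T i. diameter K * L2norm K (div3 (u_h i)) \<le> C * L2norm K (\<lambda>x. u x - u_h i x)) \<and>
      (\<forall>F\<in>inner_faces \<Omega> (T i). sqrt (diameter F) * normal_jump_norm F (u_h i)
          \<le> C * L2norm (face_patch (T i) F) (\<lambda>x. u x - u_h i x)) \<and>
      (\<forall>K\<in>T i. error_indicator \<Omega> (T i) (u_h i) K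
          \<le> C * L2norm (element_patch (T i) K) (\<lambda>x. u x - u_h i x))"
proof -
  obtain \<kappa>0 where \<kappa>0: "0 < \<kappa>0" "\<And>i K. K \<in> T i \<Longrightarrow> diameter K \<le> \<kappa>0 * inball_diameter K"
    using meshes(2) unfolding shape_regular_def by blast
  \<comment> \<open>The estimates start from a constant of at least one; enlarging it keeps shape
    regularity because inscribed diameters are nonnegative.\<close>
  define \<kappa> where "\<kappa> = max 1 \<kappa>0"
  have \<kappa>: "1 \<le> \<kappa>" by (simp add: \<kappa>_def)
  have shape: "diameter K \<le> \<kappa> * inball_diameter K" if K: "K \<in> T i" for i K
  proof -
    have "3 simplex K" using meshes(1)[of i] K by (simp add: tetrahedral_mesh_def)
    then have "0 \<le> diameter K" using compact_imp_bounded[OF compact_simplex] diameter_ge_0 by blast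
    then have "0 \<le> inball_diameter K" using \<kappa>0(2)[OF K] \<kappa>0(1) by (meson order_trans zero_le_mult_iff not_le)
    then have "\<kappa>0 * inball_diameter K \<le> \<kappa> * inball_diameter K" by (intro mult_right_mono) (simp_all add: \<kappa>_def)
    then show ?thesis using \<kappa>0(2)[OF K] by linarith
  qed
  \<comment> \<open>The continuous eigenpair supplies the divergence-free field, the discrete one
    the piecewise polynomial of degree \<open>Suc k\<close>; the parameters \<open>\<kappa>\<close>
    and \<open>Suc k\<close> are the same for all meshes.\<close>
  have pa: "piecewise_approximation \<Omega> (T i) \<kappa> (Suc k) u (u_h i)" for i
  proof
    show "open \<Omega>" by (rule domain(1))
    show "interior (closure \<Omega>) \<subseteq> \<Omega>" using domain(1,6) by (rule interior_closure_lipschitz)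
    show "tetrahedral_mesh \<Omega> (T i)" by (rule meshes(1))
    show "1 \<le> \<kappa>" by (rule \<kappa>)
    show "diameter K \<le> \<kappa> * inball_diameter K" if "K \<in> T i" for K using that by (rule shape)
    show "u \<in> L2 \<Omega>"
      using continuous_eigenpair(2) by (auto simp: mixed_eigenpair_def H0curl_def has_weak_curl_def)
    show "L2inner \<Omega> u (grad3 \<phi>) = 0" if "tame \<phi>" "supported_in \<Omega> \<phi>" for \<phi>
      using continuous_eigenpair(2) domain(1,3) that by (rule eigenpair_div_free)
    have uh: "u_h i \<in> nedelec_space \<Omega> (T i) k"
      using discrete_eigenpair(2)[of i] by (simp add: mixed_eigenpair_def)
    then show "u_h i \<in> L2 \<Omega>" by (auto simp: nedelec_space_def H0curl_def has_weak_curl_def)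
    show "\<exists>p. (\<forall>j. polyfun (Suc k) (\<lambda>x. p x $ j)) \<and> (\<forall>x\<in>interior K. u_h i x = p x)" if "K \<in> T i" for K
      using uh that nedelec_local_polyfun unfolding nedelec_space_def by blast
  qed
  obtain Ce where Ce: "0 < Ce" and el: "\<And>\<Omega> T u w K. piecewise_approximation \<Omega> T \<kappa> (Suc k) u w \<Longrightarrow> K \<in> T \<Longrightarrow>
      diameter K * L2norm K (div3 w) \<le> Ce * L2norm K (\<lambda>x. u x - w x)"
    using element_indicator_estimate[OF \<kappa>, of "Suc k"] by metis
  obtain Cf where Cf: "0 < Cf" and fc: "\<And>\<Omega> T u w F. piecewise_approximation \<Omega> T \<kappa> (Suc k) u w \<Longrightarrow> F \<in> inner_faces \<Omega> T \<Longrightarrow>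
      sqrt (diameter F) * normal_jump_norm F w \<le> Cf * L2norm (face_patch T F) (\<lambda>x. u x - w x)"
    using face_indicator_estimate[OF \<kappa>, of "Suc k"] by metis
  define C where "C = Ce + Cf + sqrt (Ce\<^sup>2 + 4 * Cf\<^sup>2)"
  have C: "0 < C" "Ce \<le> C" "Cf \<le> C" "sqrt (Ce\<^sup>2 + 4 * Cf\<^sup>2) \<le> C"
    using Ce Cf by (simp_all add: C_def add_pos_nonneg)
  have up: "a \<le> C * L2norm S f" if "a \<le> c * L2norm S f" "c \<le> C" for a c S and f :: "real^3 \<Rightarrow> real^3"
    using that(1) mult_right_mono[OF that(2) L2norm_nonneg[of S f]] by linarith
  show ?thesis
  proof (intro exI[of _ C] conjI allI ballI)
    fix i K assume K: "K \<in> T i"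
    show "diameter K * L2norm K (div3 (u_h i)) \<le> C * L2norm K (\<lambda>x. u x - u_h i x)"
      by (rule up[OF el[OF pa K] C(2)])
    have "error_indicator \<Omega> (T i) (u_h i) K \<le> sqrt (Ce\<^sup>2 + 4 * Cf\<^sup>2) * L2norm (element_patch (T i) K) (\<lambda>x. u x - u_h i x)"
      using Ce Cf by (intro piecewise_approximation.error_indicator_le[OF pa K _ _ el[OF pa K] fc[OF pa]]) auto
    then show "error_indicator \<Omega> (T i) (u_h i) K \<le> C * L2norm (element_patch (T i) K) (\<lambda>x. u x - u_h i x)"
      by (rule up[OF _ C(4)])
  next
    fix i F assume F: "F \<in> inner_faces \<Omega> (T i)"
    show "sqrt (diameter F) * normal_jump_norm F (u_h i) \<le> C * L2norm (face_patch (T i) F) (\<lambda>x. u x - u_h i x)"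
      by (rule up[OF fc[OF pa F] C(3)])
  qed (rule C(1))
qed

end
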